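(* Let $\{\mathbf Z_n\}_{n\ge 0}=\{(X_n,Y_n)\}_{n\ge 0}$, $X_0=Y_0=0$, be the anisotropic random walk on $\mathbb Z^2$ with column probabilities $\{p_j\}_{j\in\mathbb Z}$ (see context). Assume that for some constant $1<\gamma<\infty$, as $k\to\infty$, $$k^{-1}\sum_{j=1}^k p_j^{-1}=2\gamma+o(1),\qquad k^{-1}\sum_{j=1}^k p_{-j}^{-1}=2\gamma+o(1).$$ Then, on an appropriate probability space for this random walk $\{\mathbf Z_n\}$, one can construct two independent standard Wiener processes $\{W_1(t),t\ge 0\}$ and $\{W_2(t),t\ge 0\}$ so that, with $$\mathbf W_n(t):=\left(\frac{W_1(nt\gamma^{-1})}{n^{1/2}},\ \frac{W_2(nt(1-\gamma^{-1}))}{n^{1/2}}\right),\quad t\ge 0,\ n\ge 1,$$ we have for all fixed $T>0$, as $n\to\infty$, $$\sup_{0\le t\le T}\left\Vert n^{-1/2}\mathbf Z_{[nt]}-\mathbf W_n(t)\right\Vert=\sup_{0\le t\le T}\left\Vert\left(\frac{X_{[nt]}-W_1(nt\gamma^{-1})}{n^{1/2}},\ \frac{Y_{[nt]}-W_2(nt(1-\gamma^{-1}))}{n^{1/2}}\right)\right\Vert=o_P(1).$$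
   Context: Anisotropic random walk: $\{p_j\}_{j\in\mathbb Z}$ are real numbers with $0<p_j\le 1/2$ for all $j$ and $\min_{j\in\mathbb Z}p_j<1/2$ (i.e. some $p_j<1/2$). $\{(X_n,Y_n)\}_{n\ge 0}$ is the Markov chain on $\mathbb Z^2$ started at $X_0=Y_0=0$ with transition probabilities, for $(j,k)\in\mathbb Z^2$, $n=0,1,2,\dots$, $$P\{(X_{n+1},Y_{n+1})=(j\pm1,k)\mid (X_n,Y_n)=(j,k)\}=p_j,$$ $$P\{(X_{n+1},Y_{n+1})=(j,k\pm1)\mid (X_n,Y_n)=(j,k)\}=\tfrac12-p_j$$ (each of the two horizontal neighbours has probability $p_j$ and each of the two vertical neighbours has probability $\frac12-p_j$). "On an appropriate probability space for the random walk one can construct" means: there is a probability space carrying a process with the same law as the walk (denoted by the same symbols) together with the Wiener processes. $[x]$ is the integer part of $x$; $\Vert\cdot\Vert$ is a norm on $\mathbb R^2$; $o_P(1)$ denotes a quantity converging to $0$ in probability. *)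

theory Defs
  imports "HOL-Probability.Probability"
begin

text \<open>One-step transition probabilities of the anisotropic walk with column probabilities \<open>p\<close>.\<close>

definition aniso_step :: "(int \<Rightarrow> real) \<Rightarrow> int \<times> int \<Rightarrow> int \<times> int \<Rightarrow> real" where
  "aniso_step p z w =
     (case z of (j, k) \<Rightarrow>
        if w = (j + 1, k) \<or> w = (j - 1, k) then p j
        else if w = (j, k + 1) \<or> w = (j, k - 1) then 1 / 2 - p j
        else 0)"

text \<open>
  The Markov property is expressed by elementary conditional probabilities given the whole past.
  The restriction to histories of positive probability is needed because \<^const>\<open>cond_prob\<close>
  divides by the probability of the conditioning event (and \<open>x / 0 = 0\<close>).
\<close>

definition aniso_walk ::
  "(int \<Rightarrow> real) \<Rightarrow> 'a measure \<Rightarrow> (nat \<Rightarrow> 'a \<Rightarrow> int \<times> int) \<Rightarrow> bool" where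
  "aniso_walk p M Z \<longleftrightarrow>
     prob_space M \<and>
     (\<forall>n. Z n \<in> measurable M (count_space UNIV)) \<and>
     (\<forall>\<omega>\<in>space M. Z 0 \<omega> = (0, 0)) \<and>
     (\<forall>n z w. \<P>(\<omega> in M. \<forall>i\<le>n. Z i \<omega> = z i) > 0 \<longrightarrow>
        \<P>(\<omega> in M. Z (Suc n) \<omega> = w \<bar> \<forall>i\<le>n. Z i \<omega> = z i) = aniso_step p (z n) w)"

text \<open>
  Standard Wiener process with time set \<open>{0..}\<close>; the values of \<open>W t\<close> for \<open>t < 0\<close> are irrelevant.
  Every path is continuous, so suprema over compact time intervals are finite.
\<close>

definition wiener_process :: "'a measure \<Rightarrow> (real \<Rightarrow> 'a \<Rightarrow> real) \<Rightarrow> bool" where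
  "wiener_process M W \<longleftrightarrow>
     prob_space M \<and>
     (\<forall>t\<ge>0. W t \<in> borel_measurable M) \<and>
     (\<forall>\<omega>\<in>space M. W 0 \<omega> = 0) \<and>
     (\<forall>\<omega>\<in>space M. continuous_on {0..} (\<lambda>t. W t \<omega>)) \<and>
     (\<forall>s t. 0 \<le> s \<and> s < t \<longrightarrow>
        distributed M lborel (\<lambda>\<omega>. W t \<omega> - W s \<omega>) (normal_density 0 (sqrt (t - s)))) \<and>
     (\<forall>(m::nat) \<tau>. 0 \<le> \<tau> 0 \<and> mono \<tau> \<longrightarrow>
        prob_space.indep_vars M (\<lambda>_. borel) (\<lambda>i \<omega>. W (\<tau> (Suc i)) \<omega> - W (\<tau> i) \<omega>) {..<m})"

text \<open>Independence of the processes as random elements of the product space \<open>\<real>\<^bsup>[0,\<infinity>)\<^esup>\<close>.\<close>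

definition indep_processes ::
  "'a measure \<Rightarrow> (real \<Rightarrow> 'a \<Rightarrow> real) \<Rightarrow> (real \<Rightarrow> 'a \<Rightarrow> real) \<Rightarrow> bool" where
  "indep_processes M V W \<longleftrightarrow>
     prob_space.indep_var M
       (Pi\<^sub>M {0..} (\<lambda>_. borel)) (\<lambda>\<omega>. \<lambda>t\<in>{0..}. V t \<omega>)
       (Pi\<^sub>M {0..} (\<lambda>_. borel)) (\<lambda>\<omega>. \<lambda>t\<in>{0..}. W t \<omega>)"

text \<open>
  Measurability is part of the definition: \<^const>\<open>measure\<close> is \<open>0\<close> on non-measurable sets.
\<close>

definition tends_to_0_in_prob :: "'a measure \<Rightarrow> (nat \<Rightarrow> 'a \<Rightarrow> real) \<Rightarrow> bool" where
  "tends_to_0_in_prob M R \<longleftrightarrow>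
     (\<forall>n. R n \<in> borel_measurable M) \<and>
     (\<forall>\<epsilon>>0. (\<lambda>n. \<P>(\<omega> in M. \<bar>R n \<omega>\<bar> > \<epsilon>)) \<longlonglongrightarrow> 0)"

definition is_norm :: "('v::real_vector \<Rightarrow> real) \<Rightarrow> bool" where
  "is_norm N \<longleftrightarrow>
     (\<forall>x. N x = 0 \<longleftrightarrow> x = 0) \<and>
     (\<forall>c x. N (c *\<^sub>R x) = \<bar>c\<bar> * N x) \<and>
     (\<forall>x y. N (x + y) \<le> N x + N y)"

definition real_point :: "int \<times> int \<Rightarrow> real \<times> real" where
  "real_point z = (real_of_int (fst z), real_of_int (snd z))"

definition scaled_wiener ::
  "real \<Rightarrow> (real \<Rightarrow> 'a \<Rightarrow> real) \<Rightarrow> (real \<Rightarrow> 'a \<Rightarrow> real) \<Rightarrow> nat \<Rightarrow> real \<Rightarrow> 'a \<Rightarrow> real \<times> real" where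
  "scaled_wiener \<gamma> W1 W2 n t \<omega> =
     (W1 (real n * t * inverse \<gamma>) \<omega> / sqrt (real n),
      W2 (real n * t * (1 - inverse \<gamma>)) \<omega> / sqrt (real n))"

text \<open>
  Joint sample paths of a lattice walk and two real processes. Any realisation of such a triple,
  with continuous real paths, on any probability space can be transported to a probability space
  over this type as the image under the path map, so asking for a measure over this type does not
  restrict the choice of the probability space.
\<close>

type_synonym joint_path = "(nat \<Rightarrow> int \<times> int) \<times> (real \<Rightarrow> real) \<times> (real \<Rightarrow> real)"

end

theory Submission
  imports Defs
begin

text \<open>
  Take two independent Wiener processes and an independent sequence of uniform variables. Each Wiener
  process determines a simple random walk: on consecutive blocks of slowly growing length its increment
  is turned, by a quantile transformation, into a block of fair signs with nearly the same sum. By the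
  central limit theorem the mean square error in a block is small relative to its length, and Kolmogorov's
  inequality gives \<open>max\<^bsub>k\<le>n\<^esub> \<bar>S\<^sub>k - W(k)\<bar> = o\<^sub>P(\<surd>n)\<close>. The anisotropic walk uses the signs of
  the first walk for its horizontal and those of the second for its vertical moves, the uniform variables
  deciding between the two, so that \<open>X\<^sub>n = S\<^sub>1(H\<^sub>n)\<close> and \<open>Y\<^sub>n = S\<^sub>2(n - H\<^sub>n)\<close>, where \<open>H\<^sub>n\<close> counts the
  horizontal moves.

  It remains to see that \<open>H\<^sub>n/n \<rightarrow> 1/\<gamma>\<close> in probability. Let \<open>u\<close> solve the discrete Poisson equation
  \<open>(u(x+1) + u(x-1))/2 - u(x) = 1/(2p\<^sub>x) - \<gamma>\<close>. Then \<open>u(X\<^sub>n) - n + \<gamma>H\<^sub>n\<close> is a martingale, and the hypothesis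
  on the averages of \<open>1/p\<^sub>j\<close> says that the gradient of \<open>u\<close> is \<open>o(\<bar>x\<bar>)\<close>. As the second moment of \<open>X\<^sub>n\<close> is at
  most \<open>n\<close>, both the martingale and \<open>u(X\<^sub>n)\<close> are \<open>o(n)\<close> in mean.
\<close>

section \<open>Maximal inequality\<close>

text \<open>The coordinates of the walk are dependent, whereas the Wiener processes must be
  independent. All dependence is therefore put into the clock \<open>H\<close>: the signs of the two
  simple walks come from independent inputs, and \<open>p\<close> only decides which of them is
  consumed next. The constant \<gamma> is a mean waiting time. In column x a horizontal move has
  probability 2 p(x), so it takes 1/(2 p(x)) steps on average, and the mean of this over many
  columns is \<gamma>; the right-hand side of the Poisson equation is the deviation of the local
  waiting time from that mean. A single waiting time can be arbitrarily long, as only Cesaro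
  averages of 1/p are controlled. Hence each estimate for the clock has the form constant +
  \<epsilon> N, with a constant that depends on \<epsilon>, and \<epsilon> is fixed before n grows.
  The coupling of signs with a Wiener process is equally soft: growing blocks let the central limit
  theorem enter without any rate, which suffices for an error of smaller order than sqrt n.
  Replacing the clock by its limit is then a matter of the modulus of continuity at scale sqrt
  n.\<close>

text \<open>With high probability; \<open>Q\<close> need not be measurable, only the exceptional sets \<open>B\<close> are.\<close>

definition whp :: "'a measure \<Rightarrow> (nat \<Rightarrow> 'a \<Rightarrow> bool) \<Rightarrow> bool" where
  "whp M Q \<longleftrightarrow> (\<forall>\<eta>>0. \<forall>\<^sub>F n in sequentially.
     \<exists>B\<in>sets M. measure M B \<le> \<eta> \<and> (\<forall>\<omega>\<in>space M - B. Q n \<omega>))"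

lemma whp_mono:
  assumes "whp M Q" "\<And>n \<omega>. n \<ge> N \<Longrightarrow> \<omega> \<in> space M \<Longrightarrow> Q n \<omega> \<Longrightarrow> R n \<omega>"
  shows "whp M R"
  unfolding whp_def
proof safe
  fix \<eta> :: real assume "0 < \<eta>"
  then have "\<forall>\<^sub>F n in sequentially. \<exists>B\<in>sets M. measure M B \<le> \<eta> \<and> (\<forall>\<omega>\<in>space M - B. Q n \<omega>)"
    using assms(1) by (auto simp: whp_def)
  then show "\<forall>\<^sub>F n in sequentially. \<exists>B\<in>sets M. measure M B \<le> \<eta> \<and> (\<forall>\<omega>\<in>space M - B. R n \<omega>)"
    using eventually_ge_at_top[of N] by eventually_elim (use assms(2) in blast)
qed

lemma (in finite_measure) whp_conj:
  assumes "whp M Q" "whp M R" shows "whp M (\<lambda>n \<omega>. Q n \<omega> \<and> R n \<omega>)"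
  unfolding whp_def
proof safe
  fix \<eta> :: real assume "0 < \<eta>"
  then have "0 < \<eta> / 2" by simp
  with assms have
    "\<forall>\<^sub>F n in sequentially. \<exists>B\<in>sets M. measure M B \<le> \<eta>/2 \<and> (\<forall>\<omega>\<in>space M - B. Q n \<omega>)"
    "\<forall>\<^sub>F n in sequentially. \<exists>B\<in>sets M. measure M B \<le> \<eta>/2 \<and> (\<forall>\<omega>\<in>space M - B. R n \<omega>)"
    unfolding whp_def by blast+
  then show "\<forall>\<^sub>F n in sequentially. \<exists>B\<in>sets M. measure M B \<le> \<eta> \<and> (\<forall>\<omega>\<in>space M - B. Q n \<omega> \<and> R n \<omega>)"
  proof eventually_elim
    case (elim n)
    then obtain A B where *: "A \<in> sets M" "measure M A \<le> \<eta>/2" "\<forall>\<omega>\<in>space M - A. Q n \<omega>"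
       "B \<in> sets M" "measure M B \<le> \<eta>/2" "\<forall>\<omega>\<in>space M - B. R n \<omega>" by blast
    have "measure M (A \<union> B) \<le> \<eta>" using measure_Un_le[OF *(1,4)] * by simp
    then show ?case using * by (intro bexI[of _ "A \<union> B"]) auto
  qed
qed

lemma whpI:
  assumes "\<And>n. n \<ge> N \<Longrightarrow> B n \<in> sets M" "\<And>n \<omega>. n \<ge> N \<Longrightarrow> \<omega> \<in> space M - B n \<Longrightarrow> Q n \<omega>"
    and "\<And>n. n \<ge> N \<Longrightarrow> measure M (B n) \<le> b n" "b \<longlonglongrightarrow> 0"
  shows "whp M Q"
  unfolding whp_def
proof safe
  fix \<eta> :: real assume "0 < \<eta>"
  then have "\<forall>\<^sub>F n in sequentially. b n < \<eta>" using assms(4) by (simp add: order_tendstoD)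
  then show "\<forall>\<^sub>F n in sequentially. \<exists>B\<in>sets M. measure M B \<le> \<eta> \<and> (\<forall>\<omega>\<in>space M - B. Q n \<omega>)"
    using eventually_ge_at_top[of N]
  proof eventually_elim
    case (elim n)
    then show ?case using assms(1-3)[of n] by (intro bexI[of _ "B n"]) auto
  qed
qed

lemma whp_eventually:
  assumes "\<And>n \<omega>. n \<ge> N \<Longrightarrow> \<omega> \<in> space M \<Longrightarrow> Q n \<omega>" shows "whp M Q"
  by (rule whpI[where N=N and B="\<lambda>_. {}" and b="\<lambda>_. 0"]) (use assms in auto)

lemma integrable_indicator_mult:
  "A \<in> sets M \<Longrightarrow> integrable M f \<Longrightarrow> integrable M (\<lambda>x. indicator A x * f x :: real)"
  using integrable_mult_indicator[of A M f] by simp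

text \<open>Since \<open>f\<close> lies above its tangents, \<open>f(S\<^sub>m) \<ge> f(S\<^sub>j) + f'(S\<^sub>j)(S\<^sub>m - S\<^sub>j)\<close>, and the last term
  vanishes in expectation on the event that \<open>j\<close> is the first exceedance.\<close>

lemma (in prob_space) maximal_inequality:
  fixes X :: "nat \<Rightarrow> 'a \<Rightarrow> real" and f f' :: "real \<Rightarrow> real"
  assumes indep: "indep_vars (\<lambda>_. borel) X {..<m}"
    and int: "\<And>i. i < m \<Longrightarrow> integrable M (X i)"
    and mean: "\<And>i. i < m \<Longrightarrow> expectation (X i) = 0"
    and tangent: "\<And>s r. f s + f' s * r \<le> f (s + r)"
    and f_nonneg: "\<And>s. 0 \<le> f s"
    and f_lower: "\<And>s. x < \<bar>s\<bar> \<Longrightarrow> c \<le> f s" and c: "0 < c"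
    and [measurable]: "f \<in> borel_measurable borel" "f' \<in> borel_measurable borel"
    and intf: "\<And>j. j \<le> m \<Longrightarrow> integrable M (\<lambda>\<omega>. f (\<Sum>i<j. X i \<omega>))"
    and intf': "\<And>j. j \<le> m \<Longrightarrow> integrable M (\<lambda>\<omega>. f' (\<Sum>i<j. X i \<omega>))"
  shows "prob {\<omega>\<in>space M. \<exists>j\<le>m. x < \<bar>\<Sum>i<j. X i \<omega>\<bar>} \<le> expectation (\<lambda>\<omega>. f (\<Sum>i<m. X i \<omega>)) / c"
proof -
  \<comment> \<open>Padding with zeros makes every \<open>S j\<close> a random variable, also beyond
    the index range in which measurability of \<open>X\<close> is given.\<close>
  define Y where "Y i = (if i < m then X i else (\<lambda>_. 0))" for i
  have [measurable]: "random_variable borel (Y i)" for i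
    using indep by (auto simp: indep_vars_def Y_def)
  define S where "S j \<omega> = (\<Sum>i<j. Y i \<omega>)" for j \<omega>
  have [measurable]: "random_variable borel (S j)" for j unfolding S_def by measurable
  have S_eq: "S j = (\<lambda>\<omega>. \<Sum>i<j. X i \<omega>)" if "j \<le> m" for j
    using that by (auto simp: S_def Y_def fun_eq_iff intro!: sum.cong)
  define A where "A j = {\<omega>\<in>space M. x < \<bar>S j \<omega>\<bar> \<and> (\<forall>i<j. \<bar>S i \<omega>\<bar> \<le> x)}" for j
  have [measurable]: "A j \<in> events" for j unfolding A_def by measurable
  have disj: "disjoint_family_on A {..m}"
    unfolding disjoint_family_on_def A_def by (auto simp: not_le) (metis linorder_neqE_nat not_less)
  have eq: "{\<omega>\<in>space M. \<exists>j\<le>m. x < \<bar>\<Sum>i<j. X i \<omega>\<bar>} = (\<Union>j\<in>{..m}. A j)"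
  proof (safe)
    fix \<omega> j assume w: "\<omega> \<in> space M" "j \<le> m" "x < \<bar>\<Sum>i<j. X i \<omega>\<bar>"
    then have *: "x < \<bar>S j \<omega>\<bar>" by (simp add: S_eq)
    define k where "k = (LEAST k. x < \<bar>S k \<omega>\<bar>)"
    have "x < \<bar>S k \<omega>\<bar>" unfolding k_def by (rule LeastI[where P="\<lambda>k. x < \<bar>S k \<omega>\<bar>", OF *])
    moreover have "k \<le> j" unfolding k_def by (rule Least_le[where P="\<lambda>k. x < \<bar>S k \<omega>\<bar>", OF *])
    moreover have "\<bar>S i \<omega>\<bar> \<le> x" if "i < k" for i
      using not_less_Least[of i "\<lambda>k. x < \<bar>S k \<omega>\<bar>"] that by (auto simp: k_def)
    ultimately show "\<omega> \<in> (\<Union>j\<in>{..m}. A j)" using w by (auto simp: A_def intro!: bexI[of _ k])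
  qed (auto simp: A_def S_eq)
  have intS: "integrable M (\<lambda>\<omega>. f (S j \<omega>))" "integrable M (\<lambda>\<omega>. f' (S j \<omega>))" if "j \<le> m" for j
    using intf[OF that] intf'[OF that] by (simp_all add: S_eq[OF that])
  have key: "c * prob (A j) \<le> expectation (\<lambda>\<omega>. indicator (A j) \<omega> * f (S m \<omega>))" if j: "j \<le> m" for j
  proof -
    \<comment> \<open>The slope \<open>f' (S j)\<close> on the event of a first exceedance at
      \<open>j\<close> is a function of the coordinates before \<open>j\<close>; the remaining
      increment \<open>S m - S j\<close> is one of those from \<open>j\<close> on.\<close>
    have ind: "indep_var (PiM {..<j} (\<lambda>_. borel)) (\<lambda>\<omega>. restrict (\<lambda>i. X i \<omega>) {..<j})
                 (PiM {j..<m} (\<lambda>_. borel)) (\<lambda>\<omega>. restrict (\<lambda>i. X i \<omega>) {j..<m})"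
      using j by (intro indep_var_restrict[OF indep]) auto
    define F where "F g = (\<lambda>i. \<Sum>k<i. g k :: real)" for g :: "nat \<Rightarrow> real"
    define Y1 where "Y1 g = (if x < \<bar>F g j\<bar> \<and> (\<forall>i\<in>{..<j}. \<bar>F g i\<bar> \<le> x) then f' (F g j) else 0)" for g
    define Y2 where "Y2 g = (\<Sum>k\<in>{j..<m}. g k :: real)" for g :: "nat \<Rightarrow> real"
    have mF: "(\<lambda>g. F g i) \<in> borel_measurable (PiM {..<j} (\<lambda>_. borel))" if "i \<le> j" for i
      unfolding F_def using that by (intro borel_measurable_sum measurable_component_singleton) auto
    have m1: "Y1 \<in> borel_measurable (PiM {..<j} (\<lambda>_. borel))"
    proof -
      have [measurable]: "(\<lambda>g. F g j) \<in> borel_measurable (PiM {..<j} (\<lambda>_. borel))" by (rule mF) simp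
      have "{g\<in>space (PiM {..<j} (\<lambda>_. borel)). \<forall>i\<in>{..<j}. \<bar>F g i\<bar> \<le> x} \<in> sets (PiM {..<j} (\<lambda>_. borel))"
        using mF by (intro sets.sets_Collect_finite_All borel_measurable_le borel_measurable_abs) auto
      then have [measurable]: "Measurable.pred (PiM {..<j} (\<lambda>_. borel)) (\<lambda>g. \<forall>i\<in>{..<j}. \<bar>F g i\<bar> \<le> x)"
        by (simp only: pred_def)
      show ?thesis unfolding Y1_def by measurable
    qed
    have m2: "Y2 \<in> borel_measurable (PiM {j..<m} (\<lambda>_. borel))"
      unfolding Y2_def by (intro borel_measurable_sum measurable_component_singleton) auto
    have "indep_var borel (Y1 \<circ> (\<lambda>\<omega>. restrict (\<lambda>i. X i \<omega>) {..<j})) borel (Y2 \<circ> (\<lambda>\<omega>. restrict (\<lambda>i. X i \<omega>) {j..<m}))"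
      by (rule indep_var_compose[OF ind m1 m2])
    moreover have FS: "F (restrict (\<lambda>i. X i \<omega>) {..<j}) i = S i \<omega>" if "i \<le> j" for i \<omega>
      using that j by (auto simp: F_def S_def Y_def intro!: sum.cong)
    moreover have "(Y1 \<circ> (\<lambda>\<omega>. restrict (\<lambda>i. X i \<omega>) {..<j})) \<omega> = (if x < \<bar>S j \<omega>\<bar> \<and> (\<forall>i<j. \<bar>S i \<omega>\<bar> \<le> x) then f' (S j \<omega>) else 0)" for \<omega>
      unfolding Y1_def comp_def using FS by auto
    moreover have Y2_eq: "(Y2 \<circ> (\<lambda>\<omega>. restrict (\<lambda>i. X i \<omega>) {j..<m})) \<omega> = S m \<omega> - S j \<omega>" for \<omega>
    proof -
      have "S m \<omega> = S j \<omega> + (\<Sum>k\<in>{j..<m}. Y k \<omega>)"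
        unfolding S_def lessThan_atLeast0 using j by (simp add: sum.atLeastLessThan_concat)
      then show ?thesis by (auto simp: Y2_def Y_def)
    qed
    ultimately have iv: "indep_var borel (\<lambda>\<omega>. if x < \<bar>S j \<omega>\<bar> \<and> (\<forall>i<j. \<bar>S i \<omega>\<bar> \<le> x) then f' (S j \<omega>) else 0)
        borel (\<lambda>\<omega>. S m \<omega> - S j \<omega>)" by (simp add: comp_def cong: if_cong)
    let ?V = "\<lambda>\<omega>. if x < \<bar>S j \<omega>\<bar> \<and> (\<forall>i<j. \<bar>S i \<omega>\<bar> \<le> x) then f' (S j \<omega>) else 0"
    have iR: "integrable M (\<lambda>\<omega>. S m \<omega> - S j \<omega>)" and eR: "expectation (\<lambda>\<omega>. S m \<omega> - S j \<omega>) = 0"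
    proof -
      have Y: "integrable M (Y i)" "expectation (Y i) = 0" for i using int mean by (auto simp: Y_def)
      have "integrable M (S k)" "expectation (S k) = 0" for k
        unfolding S_def using Y by (auto intro!: Bochner_Integration.integrable_sum simp: Bochner_Integration.integral_sum)
      then show "integrable M (\<lambda>\<omega>. S m \<omega> - S j \<omega>)" "expectation (\<lambda>\<omega>. S m \<omega> - S j \<omega>) = 0" by auto
    qed
    have iV: "integrable M ?V"
      by (rule Bochner_Integration.integrable_bound[OF intS(2)[OF j]]) auto
    have iVR: "integrable M (\<lambda>\<omega>. ?V \<omega> * (S m \<omega> - S j \<omega>))" 
      using indep_var_integrable[OF iv iV iR] .
    have eVR: "expectation (\<lambda>\<omega>. ?V \<omega> * (S m \<omega> - S j \<omega>)) = 0"
      using indep_var_lebesgue_integral[OF iv iV iR] eR by simp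
    have iI: "integrable M (\<lambda>\<omega>. c * indicator (A j) \<omega>)" by (intro integrable_mult_right integrable_real_indicator) (auto simp: less_top[symmetric])
    have "c * prob (A j) = expectation (\<lambda>\<omega>. c * indicator (A j) \<omega> + ?V \<omega> * (S m \<omega> - S j \<omega>))"
      using iVR eVR iI by (subst Bochner_Integration.integral_add) auto
    also have "\<dots> \<le> expectation (\<lambda>\<omega>. indicator (A j) \<omega> * f (S m \<omega>))"
    proof (rule integral_mono)
      show "integrable M (\<lambda>\<omega>. c * indicator (A j) \<omega> + ?V \<omega> * (S m \<omega> - S j \<omega>))" using iVR iI by (rule Bochner_Integration.integrable_add[rotated])
      show "integrable M (\<lambda>\<omega>. indicator (A j) \<omega> * f (S m \<omega>))"
        using intS(1)[of m] by (intro integrable_indicator_mult) auto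
      fix \<omega> assume w: "\<omega> \<in> space M"
      show "c * indicator (A j) \<omega> + ?V \<omega> * (S m \<omega> - S j \<omega>) \<le> indicator (A j) \<omega> * f (S m \<omega>)"
        using tangent[of "S j \<omega>" "S m \<omega> - S j \<omega>"] f_lower[of "S j \<omega>"] w by (auto simp: A_def indicator_def)
    qed
    finally show ?thesis .
  qed
  have "c * prob (\<Union>j\<in>{..m}. A j) = (\<Sum>j\<le>m. c * prob (A j))"
    using disj by (subst finite_measure_finite_Union) (auto simp: sum_distrib_left)
  also have "\<dots> \<le> (\<Sum>j\<le>m. expectation (\<lambda>\<omega>. indicator (A j) \<omega> * f (S m \<omega>)))"
    by (intro sum_mono key) auto
  also have "\<dots> = expectation (\<lambda>\<omega>. \<Sum>j\<le>m. indicator (A j) \<omega> * f (S m \<omega>))"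
    using intS(1)[of m] by (intro Bochner_Integration.integral_sum[symmetric] integrable_indicator_mult) auto
  also have "\<dots> \<le> expectation (\<lambda>\<omega>. f (S m \<omega>))"
  proof (rule integral_mono)
    show "integrable M (\<lambda>\<omega>. \<Sum>j\<le>m. indicator (A j) \<omega> * f (S m \<omega>))"
      using intS(1)[of m] by (intro Bochner_Integration.integrable_sum integrable_indicator_mult) auto
    show "integrable M (\<lambda>\<omega>. f (S m \<omega>))" by (rule intS) simp
    fix \<omega> 
    have "(\<Sum>j\<le>m. indicator (A j) \<omega> * f (S m \<omega>)) = indicator (\<Union>j\<in>{..m}. A j) \<omega> * f (S m \<omega>)"
      unfolding sum_distrib_right[symmetric]
      by (subst indicator_UN_disjoint[OF _ disj]) simp_all
    also have "\<dots> \<le> f (S m \<omega>)" using f_nonneg by (auto simp: indicator_def)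
    finally show "(\<Sum>j\<le>m. indicator (A j) \<omega> * f (S m \<omega>)) \<le> f (S m \<omega>)" .
  qed
  finally show ?thesis using c unfolding eq S_eq[OF order_refl] by (simp add: field_simps)
qed

section \<open>Independent blocks and rotation of Gaussian pairs\<close>

lemma (in prob_space) indep_var_of_indep_vars:
  assumes "indep_vars M' X I" "i \<in> I" "j \<in> I" "i \<noteq> j"
  shows "indep_var (M' i) (X i) (M' j) (X j)"
proof -
  have "indep_var (PiM {i} M') (\<lambda>\<omega>. restrict (\<lambda>i. X i \<omega>) {i}) (PiM {j} M') (\<lambda>\<omega>. restrict (\<lambda>i. X i \<omega>) {j})"
    using assms by (intro indep_var_restrict) auto
  from indep_var_compose[OF this, of "\<lambda>f. f i" "M' i" "\<lambda>f. f j" "M' j"]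
  show ?thesis by (simp add: comp_def measurable_component_singleton)
qed

text \<open>A finite intersection meets only finitely many blocks, so its probability factors first
  over these blocks and then inside each of them. This reduces independence of a transformed family
  to a check within each block when the transformation respects the blocks.\<close>

lemma (in prob_space) indep_vars_blocks:
  assumes T: "disjoint_family_on T L" "I = (\<Union>l\<in>L. T l)"
    and out: "indep_vars (\<lambda>l. PiM (T l) M') (\<lambda>l \<omega>. restrict (\<lambda>i. V i \<omega>) (T l)) L"
    and ins: "\<And>l. l \<in> L \<Longrightarrow> indep_vars M' V (T l)"
  shows "indep_vars M' V I"
  unfolding indep_vars_def2
proof (intro conjI ballI)
  fix i assume "i \<in> I" then show "random_variable (M' i) (V i)" using T ins by (auto simp: indep_vars_def2)
next
  have rv: "random_variable (M' i) (V i)" if "i \<in> I" for i using that T ins by (auto simp: indep_vars_def2)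
  show "indep_sets (\<lambda>i. {V i -` A \<inter> space M |A. A \<in> sets (M' i)}) I"
  proof (rule indep_setsI)
    fix i assume "i \<in> I" then show "{V i -` A \<inter> space M |A. A \<in> sets (M' i)} \<subseteq> events"
      using rv by (auto intro: measurable_sets)
  next
    fix A J assume J: "J \<noteq> {}" "J \<subseteq> I" "finite J" "\<forall>j\<in>J. A j \<in> {V j -` A \<inter> space M |A. A \<in> sets (M' j)}"
    then have "\<forall>j\<in>J. \<exists>B. A j = V j -` B \<inter> space M \<and> B \<in> sets (M' j)" by blast
    from bchoice[OF this] obtain B where B: "\<And>j. j \<in> J \<Longrightarrow> A j = V j -` B j \<inter> space M" "\<And>j. j \<in> J \<Longrightarrow> B j \<in> sets (M' j)"
      by blast
    define L' where "L' = {l\<in>L. T l \<inter> J \<noteq> {}}"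
    have uniq: "\<And>l l' i. l \<in> L \<Longrightarrow> l' \<in> L \<Longrightarrow> i \<in> T l \<Longrightarrow> i \<in> T l' \<Longrightarrow> l = l'"
      using T(1) by (auto simp: disjoint_family_on_def)
    have JU: "J = (\<Union>l\<in>L'. J \<inter> T l)" using J(2) T(2) by (fastforce simp: L'_def)
    have "finite L'"
    proof -
      have "L' \<subseteq> (\<lambda>i. THE l. l \<in> L \<and> i \<in> T l) ` J"
      proof
        fix l assume "l \<in> L'"
        then obtain i where i: "i \<in> J" "i \<in> T l" "l \<in> L" by (auto simp: L'_def)
        then have "(THE l. l \<in> L \<and> i \<in> T l) = l" using uniq by (intro the_equality) auto
        then show "l \<in> (\<lambda>i. THE l. l \<in> L \<and> i \<in> T l) ` J" using i by force
      qed
      then show ?thesis using J(3) by (meson finite_surj)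
    qed
    have "L' \<noteq> {}" using JU J(1) by auto
    \<comment> \<open>The cylinder in the coordinates of block \<open>l\<close> that prescribes
      \<open>B i\<close> at the indices of \<open>J\<close> and leaves the others free.\<close>
    define E where "E l = (\<Pi>\<^sub>E i\<in>T l. if i \<in> J then B i else space (M' i)) " for l
    have E: "E l = {x\<in>space (PiM (T l) M'). \<forall>i\<in>J \<inter> T l. x i \<in> B i}" for l
      unfolding E_def using B(2)[THEN sets.sets_into_space]
      by (auto simp: space_PiM PiE_def Pi_def extensional_def split: if_splits)
    have Esets: "E l \<in> sets (PiM (T l) M')" if "l \<in> L'" for l
      unfolding E using J(3) B(2) 
      by (intro sets.sets_Collect_finite_All) (auto intro!: measurable_sets_Collect[OF measurable_component_singleton])
    have pre: "(\<lambda>\<omega>. restrict (\<lambda>i. V i \<omega>) (T l)) -` E l \<inter> space M = (\<Inter>i\<in>J \<inter> T l. A i) \<inter> space M" if "l \<in> L'" for l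
    proof -
      have "V i \<omega> \<in> space (M' i)" if "i \<in> T l" "\<omega> \<in> space M" for i \<omega>
        using measurable_space[OF rv[of i]] that \<open>l \<in> L'\<close> T(2) by (auto simp: L'_def)
      then show ?thesis unfolding E using B(1) by (auto simp: space_PiM PiE_def Pi_def)
    qed
    have ne: "J \<inter> T l \<noteq> {}" if "l \<in> L'" for l using that by (auto simp: L'_def)
    have sub: "(\<Inter>i\<in>J \<inter> T l. A i) \<inter> space M = (\<Inter>i\<in>J \<inter> T l. A i)" if "l \<in> L'" for l
      using ne[OF that] B(1) by auto
    have "(\<Inter>j\<in>J. A j) = (\<Inter>l\<in>L'. \<Inter>i\<in>J \<inter> T l. A i)" by (subst JU) blast
    also have "prob \<dots> = prob (\<Inter>l\<in>L'. (\<lambda>\<omega>. restrict (\<lambda>i. V i \<omega>) (T l)) -` E l \<inter> space M)"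
      using pre sub by simp
    also have "\<dots> = (\<Prod>l\<in>L'. prob ((\<lambda>\<omega>. restrict (\<lambda>i. V i \<omega>) (T l)) -` E l \<inter> space M))"
      using \<open>L' \<noteq> {}\<close> \<open>finite L'\<close> Esets by (intro indep_varsD[OF out]) (auto simp: L'_def)
    also have "\<dots> = (\<Prod>l\<in>L'. \<Prod>i\<in>J \<inter> T l. prob (A i))"
    proof (intro prod.cong refl)
      fix l assume l: "l \<in> L'"
      have "prob (\<Inter>i\<in>J \<inter> T l. V i -` B i \<inter> space M) = (\<Prod>i\<in>J \<inter> T l. prob (V i -` B i \<inter> space M))"
        using l ne[OF l] J(3) B(2) by (intro indep_varsD[OF ins[of l]]) (auto simp: L'_def)
      then show "prob ((\<lambda>\<omega>. restrict (\<lambda>i. V i \<omega>) (T l)) -` E l \<inter> space M) = (\<Prod>i\<in>J \<inter> T l. prob (A i))"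
        using pre[OF l] sub[OF l] B(1) by simp
    qed
    also have "\<dots> = (\<Prod>j\<in>(\<Union>l\<in>L'. J \<inter> T l). prob (A j))"
      using \<open>finite L'\<close> J(3) uniq by (intro prod.UNION_disjoint[symmetric]) (auto simp: L'_def)
    finally show "prob (\<Inter>j\<in>J. A j) = (\<Prod>j\<in>J. prob (A j))" using JU by simp
  qed
qed

lemma (in prob_space) indep_vars_singleton:
  assumes "random_variable (M' i) (V i)" shows "indep_vars M' V {i}"
  unfolding indep_vars_def2
proof (intro conjI ballI indep_setsI)
  fix A J assume J: "J \<noteq> {}" "J \<subseteq> {i}" 
  then have "J = {i}" by auto
  then show "prob (\<Inter>j\<in>J. A j) = (\<Prod>j\<in>J. prob (A j))" by simp
qed (use assms in \<open>auto intro: measurable_sets\<close>)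

lemma (in prob_space) indep_vars_two:
  assumes "indep_var (M' i) (V i) (M' j) (V j)" "i \<noteq> j" shows "indep_vars M' V {i, j}"
  unfolding indep_vars_def2
proof (intro conjI ballI indep_setsI)
  note rv = indep_var_rv1[OF assms(1)] indep_var_rv2[OF assms(1)]
  fix k assume "k \<in> {i,j}" then show "random_variable (M' k) (V k)" using rv by auto
  then show "{V k -` A \<inter> space M |A. A \<in> sets (M' k)} \<subseteq> events" by (auto intro: measurable_sets)
next
  fix A J assume J: "J \<noteq> {}" "J \<subseteq> {i,j}" "\<forall>k\<in>J. A k \<in> {V k -` A \<inter> space M |A. A \<in> sets (M' k)}"
  consider "J = {i}" | "J = {j}" | "J = {i,j}" using J by blast
  then show "prob (\<Inter>j\<in>J. A j) = (\<Prod>j\<in>J. prob (A j))"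
  proof cases
    case 3
    with J obtain B C where *: "A i = V i -` B \<inter> space M" "B \<in> sets (M' i)" "A j = V j -` C \<inter> space M" "C \<in> sets (M' j)"
      by auto
    have "A i \<inter> A j = (\<lambda>\<omega>. (V i \<omega>, V j \<omega>)) -` (B \<times> C) \<inter> space M" using * by auto
    then show ?thesis using indep_varD[OF assms(1) *(2,4)] assms(2) 3 * by simp
  qed auto
qed

text \<open>The product density depends on x^2 + y^2 only, and x = (s + t)/2, y = (s - t)/2 give x^2
  + y^2 = (s^2 + t^2)/2. The factor 1/2 on the left is the Jacobian of this substitution.\<close>

lemma normal_density_rotate:
  assumes "0 < \<sigma>"
  shows "normal_density 0 \<sigma> ((s + t) / 2) * normal_density 0 \<sigma> ((s - t) / 2) / 2
    = normal_density 0 (sqrt 2 * \<sigma>) s * normal_density 0 (sqrt 2 * \<sigma>) t"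
proof -
  have "- ((s + t) / 2)\<^sup>2 / (2 * \<sigma>\<^sup>2) + - ((s - t) / 2)\<^sup>2 / (2 * \<sigma>\<^sup>2) = - s\<^sup>2 / (2 * (sqrt 2 * \<sigma>)\<^sup>2) + - t\<^sup>2 / (2 * (sqrt 2 * \<sigma>)\<^sup>2)"
    using assms by (simp add: power_mult_distrib) (simp add: field_simps power2_eq_square)
  then have *: "exp (- ((s + t) / 2)\<^sup>2 / (2 * \<sigma>\<^sup>2)) * exp (- ((s - t) / 2)\<^sup>2 / (2 * \<sigma>\<^sup>2))
     = exp (- s\<^sup>2 / (2 * (sqrt 2 * \<sigma>)\<^sup>2)) * exp (- t\<^sup>2 / (2 * (sqrt 2 * \<sigma>)\<^sup>2))"
    unfolding exp_add[symmetric] by simp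
  have c: "1 / sqrt (2 * pi * \<sigma>\<^sup>2) * (1 / sqrt (2 * pi * \<sigma>\<^sup>2)) / 2 =
     1 / sqrt (2 * pi * (sqrt 2 * \<sigma>)\<^sup>2) * (1 / sqrt (2 * pi * (sqrt 2 * \<sigma>)\<^sup>2))"
    using assms by (simp add: power_mult_distrib)
  show ?thesis unfolding normal_density_def diff_0_right
    using arg_cong2[OF c *, of "(*)"] by (simp add: mult_ac)
qed

text \<open>The planar change of variables is carried out as two affine substitutions on the line: y
  = s - x for fixed x, and after exchanging the integrals x = (s + t)/2 for fixed s.\<close>

lemma nn_integral_normal_rotate:
  assumes s: "0 < \<sigma>" and [measurable]: "h \<in> borel_measurable (borel \<Otimes>\<^sub>M borel)"
  shows "(\<integral>\<^sup>+x. \<integral>\<^sup>+y. h (x + y, x - y) * ennreal (normal_density 0 \<sigma> x * normal_density 0 \<sigma> y) \<partial>lborel \<partial>lborel)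
    = (\<integral>\<^sup>+s. \<integral>\<^sup>+t. h (s, t) * ennreal (normal_density 0 (sqrt 2 * \<sigma>) s * normal_density 0 (sqrt 2 * \<sigma>) t) \<partial>lborel \<partial>lborel)"
    (is "?l = ?r")
proof -
  let ?f = "normal_density 0 \<sigma>" and ?n = "normal_density 0 (sqrt 2 * \<sigma>)"
  have "?l = (\<integral>\<^sup>+x. \<integral>\<^sup>+s. h (s, 2 * x - s) * ennreal (?f x * ?f (s - x)) \<partial>lborel \<partial>lborel)"
      proof (rule nn_integral_cong)
    fix x :: real
    show "(\<integral>\<^sup>+y. h (x + y, x - y) * ennreal (?f x * ?f y) \<partial>lborel) = (\<integral>\<^sup>+s. h (s, 2 * x - s) * ennreal (?f x * ?f (s - x)) \<partial>lborel)"
      by (subst nn_integral_real_affine[where t="-x" and c=1]) (auto simp: algebra_simps)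
  qed
  also have "\<dots> = (\<integral>\<^sup>+s. \<integral>\<^sup>+x. h (s, 2 * x - s) * ennreal (?f x * ?f (s - x)) \<partial>lborel \<partial>lborel)"
    by (intro lborel_pair.Fubini') measurable
  also have "\<dots> = ?r"
  proof (rule nn_integral_cong)
    fix s :: real
    have "(\<integral>\<^sup>+x. h (s, 2 * x - s) * ennreal (?f x * ?f (s - x)) \<partial>lborel)
      = ennreal (1/2) * (\<integral>\<^sup>+t. h (s, t) * ennreal (?f ((s+t)/2) * ?f ((s-t)/2)) \<partial>lborel)"
      by (subst nn_integral_real_affine[where t="s/2" and c="1/2"]) (auto simp: field_simps)
    also have "\<dots> = (\<integral>\<^sup>+t. h (s, t) * (ennreal (1/2) * ennreal (?f ((s+t)/2) * ?f ((s-t)/2))) \<partial>lborel)"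
      by (subst nn_integral_cmult[symmetric]) (auto simp: mult_ac)
    also have "\<dots> = (\<integral>\<^sup>+t. h (s, t) * ennreal (?n s * ?n t) \<partial>lborel)"
      by (intro nn_integral_cong arg_cong2[where f="(*)"] refl, subst ennreal_mult[symmetric])
         (auto simp: normal_density_rotate[OF s, symmetric])
    finally show "(\<integral>\<^sup>+x. h (s, 2 * x - s) * ennreal (?f x * ?f (s - x)) \<partial>lborel)
        = (\<integral>\<^sup>+t. h (s, t) * ennreal (?n s * ?n t) \<partial>lborel)" .
  qed
  finally show ?thesis .
qed

text \<open>Rotation invariance of a centred Gaussian pair. In the midpoint construction
  \<open>X\<close> is half of an increment and \<open>Y\<close> the fresh displacement; sum and
  difference are the increments over the two halves of the interval.\<close>

lemma (in prob_space) indep_normal_rotate: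
  assumes s: "0 < \<sigma>" and ind: "indep_var borel X borel Y"
    and X: "distributed M lborel X (normal_density 0 \<sigma>)" and Y: "distributed M lborel Y (normal_density 0 \<sigma>)"
  shows "indep_var borel (\<lambda>\<omega>. X \<omega> + Y \<omega>) borel (\<lambda>\<omega>. X \<omega> - Y \<omega>)"
    and "distributed M lborel (\<lambda>\<omega>. X \<omega> + Y \<omega>) (normal_density 0 (sqrt 2 * \<sigma>))"
    and "distributed M lborel (\<lambda>\<omega>. X \<omega> - Y \<omega>) (normal_density 0 (sqrt 2 * \<sigma>))"
proof -
  have [measurable]: "random_variable borel X" "random_variable borel Y"
    using indep_var_rv1[OF ind] indep_var_rv2[OF ind] by auto
  have sq: "sqrt (\<sigma>\<^sup>2 + \<sigma>\<^sup>2) = sqrt 2 * \<sigma>" using s by (simp add: real_sqrt_mult flip: mult_2)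
  show 1: "distributed M lborel (\<lambda>\<omega>. X \<omega> + Y \<omega>) (normal_density 0 (sqrt 2 * \<sigma>))"
    using add_indep_normal[OF ind s s X Y] sq by simp
  show 2: "distributed M lborel (\<lambda>\<omega>. X \<omega> - Y \<omega>) (normal_density 0 (sqrt 2 * \<sigma>))"
    using diff_indep_normal[OF ind s s X Y] sq by simp
  let ?f = "normal_density 0 \<sigma>" and ?n = "normal_density 0 (sqrt 2 * \<sigma>)"
  have J: "distributed M (lborel \<Otimes>\<^sub>M lborel) (\<lambda>x. (X x, Y x)) (\<lambda>(x, y). ennreal (?f x) * ennreal (?f y))"
  proof (rule distributed_joint_indep[OF _ _ X Y])
    show "indep_var lborel X lborel Y" using ind by (simp add: indep_var_eq cong: measurable_cong_sets)
  qed (auto intro: sigma_finite_lborel)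
  interpret N: prob_space "density lborel ?n" using s by (intro prob_space_normal_density) auto
  have D: "distr M borel (\<lambda>\<omega>. X \<omega> + Y \<omega>) = density lborel ?n" "distr M borel (\<lambda>\<omega>. X \<omega> - Y \<omega>) = density lborel ?n"
    using 1 2 by (auto simp: distributed_def cong: distr_cong)
  have "distr M (borel \<Otimes>\<^sub>M borel) (\<lambda>\<omega>. (X \<omega> + Y \<omega>, X \<omega> - Y \<omega>)) = density lborel ?n \<Otimes>\<^sub>M density lborel ?n"
  proof (rule measure_eqI)
    show "sets (distr M (borel \<Otimes>\<^sub>M borel) (\<lambda>\<omega>. (X \<omega> + Y \<omega>, X \<omega> - Y \<omega>))) = sets (density lborel ?n \<Otimes>\<^sub>M density lborel ?n)"
      by (simp cong: sets_pair_measure_cong)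
    fix A assume "A \<in> sets (distr M (borel \<Otimes>\<^sub>M borel) (\<lambda>\<omega>. (X \<omega> + Y \<omega>, X \<omega> - Y \<omega>)))"
    then have A[measurable]: "A \<in> sets (borel \<Otimes>\<^sub>M borel)" by simp
    have "emeasure (distr M (borel \<Otimes>\<^sub>M borel) (\<lambda>\<omega>. (X \<omega> + Y \<omega>, X \<omega> - Y \<omega>))) A
      = (\<integral>\<^sup>+\<omega>. indicator A (X \<omega> + Y \<omega>, X \<omega> - Y \<omega>) \<partial>M)"
      by (subst nn_integral_indicator[symmetric], simp, subst nn_integral_distr) auto
    also have "\<dots> = (\<integral>\<^sup>+z. (case z of (x, y) \<Rightarrow> ennreal (?f x) * ennreal (?f y)) * indicator A (fst z + snd z, fst z - snd z) \<partial>(lborel \<Otimes>\<^sub>M lborel))"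
      by (subst distributed_nn_integral[OF J]) auto
    also have "\<dots> = (\<integral>\<^sup>+x. \<integral>\<^sup>+y. indicator A (x + y, x - y) * ennreal (?f x * ?f y) \<partial>lborel \<partial>lborel)"
      by (subst lborel.nn_integral_fst[symmetric]) (auto simp: ennreal_mult mult_ac)
    also have "\<dots> = (\<integral>\<^sup>+x. \<integral>\<^sup>+y. indicator A (x, y) * ennreal (?n x * ?n y) \<partial>lborel \<partial>lborel)"
      by (rule nn_integral_normal_rotate[OF s]) measurable
    also have "\<dots> = emeasure (density lborel ?n \<Otimes>\<^sub>M density lborel ?n) A"
    proof -
      have "emeasure (density lborel ?n \<Otimes>\<^sub>M density lborel ?n) A = emeasure (density (lborel \<Otimes>\<^sub>M lborel) (\<lambda>(x,y). ennreal (?n x) * ennreal (?n y))) A"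
        by (subst pair_measure_density) (auto simp: sigma_finite_lborel N.sigma_finite_measure_axioms)
      also have "\<dots> = (\<integral>\<^sup>+z. (case z of (x, y) \<Rightarrow> ennreal (?n x) * ennreal (?n y)) * indicator A z \<partial>(lborel \<Otimes>\<^sub>M lborel))"
        by (subst emeasure_density) auto
      also have "\<dots> = (\<integral>\<^sup>+x. \<integral>\<^sup>+y. indicator A (x, y) * ennreal (?n x * ?n y) \<partial>lborel \<partial>lborel)"
        by (subst lborel.nn_integral_fst[symmetric]) (auto simp: ennreal_mult mult_ac)
      finally show ?thesis by simp
    qed
    finally show "emeasure (distr M (borel \<Otimes>\<^sub>M borel) (\<lambda>\<omega>. (X \<omega> + Y \<omega>, X \<omega> - Y \<omega>))) A
       = emeasure (density lborel ?n \<Otimes>\<^sub>M density lborel ?n) A" .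
  qed
  then show "indep_var borel (\<lambda>\<omega>. X \<omega> + Y \<omega>) borel (\<lambda>\<omega>. X \<omega> - Y \<omega>)"
    unfolding indep_var_distribution_eq D by simp
qed

section \<open>Limits of independent and of normal variables\<close>

text \<open>Independence is tested on products of continuous functions with values in [0,1], where
  dominated convergence applies along the sequence. Such functions then converge to indicators of
  closed sets, which form an intersection-stable generator of the Borel sets.\<close>

lemma (in prob_space) indep_vars_limit:
  fixes X :: "nat \<Rightarrow> 'i \<Rightarrow> 'a \<Rightarrow> real" and Y :: "'i \<Rightarrow> 'a \<Rightarrow> real"
  assumes I: "finite I" and ind: "\<And>n. indep_vars (\<lambda>_. borel) (X n) I"
    and Y: "\<And>i. i \<in> I \<Longrightarrow> random_variable borel (Y i)"
    and lim: "\<And>i. i \<in> I \<Longrightarrow> AE \<omega> in M. (\<lambda>n. X n i \<omega>) \<longlonglongrightarrow> Y i \<omega>"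
  shows "indep_vars (\<lambda>_. borel) Y I"
proof (cases "I = {}")
  case True then show ?thesis by (auto simp: indep_vars_def2 indep_sets_def)
next
  case ne: False
  have X[measurable]: "random_variable borel (X n i)" if "i \<in> I" for n i
    using ind[of n] that by (auto simp: indep_vars_def2)
  have step: "expectation (\<lambda>\<omega>. \<Prod>i\<in>I. g i (Y i \<omega>)) = (\<Prod>i\<in>I. expectation (\<lambda>\<omega>. g i (Y i \<omega>)))"
    if g: "\<And>i. i \<in> I \<Longrightarrow> continuous_on UNIV (g i)" "\<And>i x. i \<in> I \<Longrightarrow> 0 \<le> g i x \<and> g i x \<le> (1::real)"
    for g :: "'i \<Rightarrow> real \<Rightarrow> real"
  proof (rule LIMSEQ_unique)
    have gm: "g i \<in> borel_measurable borel" if "i \<in> I" for i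
      using g(1)[OF that] by (rule borel_measurable_continuous_onI)
    have conv: "AE \<omega> in M. (\<lambda>n. g i (X n i \<omega>)) \<longlonglongrightarrow> g i (Y i \<omega>)" if "i \<in> I" for i
      using lim[OF that] by eventually_elim
        (use g(1)[OF that] in \<open>auto intro!: isCont_tendsto_compose[of _ "g i"] simp: continuous_on_eq_continuous_at\<close>)
    have mXY: "(\<lambda>\<omega>. g i (X n i \<omega>)) \<in> borel_measurable M" "(\<lambda>\<omega>. g i (Y i \<omega>)) \<in> borel_measurable M" if "i \<in> I" for n i
      using measurable_compose[OF X[OF that] gm[OF that]] measurable_compose[OF Y[OF that] gm[OF that]] by auto
    have bnd: "norm (\<Prod>i\<in>I. g i (Z i)) \<le> 1" for Z
      using g(2) by (auto simp: abs_prod intro!: prod_le_1)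
    show "(\<lambda>n. expectation (\<lambda>\<omega>. \<Prod>i\<in>I. g i (X n i \<omega>))) \<longlonglongrightarrow> expectation (\<lambda>\<omega>. \<Prod>i\<in>I. g i (Y i \<omega>))"
    proof (rule integral_dominated_convergence[where w="\<lambda>_. 1"])
      have "AE \<omega> in M. \<forall>i\<in>I. (\<lambda>n. g i (X n i \<omega>)) \<longlonglongrightarrow> g i (Y i \<omega>)"
        using I conv by (simp add: AE_finite_all)
      then show "AE \<omega> in M. (\<lambda>n. \<Prod>i\<in>I. g i (X n i \<omega>)) \<longlonglongrightarrow> (\<Prod>i\<in>I. g i (Y i \<omega>))"
        by eventually_elim (auto intro!: tendsto_prod)
    qed (use mXY bnd in \<open>auto intro!: borel_measurable_prod\<close>)
    have "expectation (\<lambda>\<omega>. \<Prod>i\<in>I. g i (X n i \<omega>)) = (\<Prod>i\<in>I. expectation (\<lambda>\<omega>. g i (X n i \<omega>)))" for n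
    proof (rule indep_vars_lebesgue_integral[OF I])
      show "indep_vars (\<lambda>_. borel) (\<lambda>i \<omega>. g i (X n i \<omega>)) I"
        using gm by (intro indep_vars_compose2[OF ind]) auto
      fix i assume "i \<in> I" then show "integrable M (\<lambda>\<omega>. g i (X n i \<omega>))"
        using g(2) mXY by (intro integrable_const_bound[where B=1]) auto
    qed
    moreover have "(\<lambda>n. expectation (\<lambda>\<omega>. g i (X n i \<omega>))) \<longlonglongrightarrow> expectation (\<lambda>\<omega>. g i (Y i \<omega>))" if i: "i \<in> I" for i
      using conv[OF i] mXY[OF i] g(2)[OF i] by (intro integral_dominated_convergence[where w="\<lambda>_. 1"]) auto
    ultimately show "(\<lambda>n. expectation (\<lambda>\<omega>. \<Prod>i\<in>I. g i (X n i \<omega>))) \<longlonglongrightarrow> (\<Prod>i\<in>I. expectation (\<lambda>\<omega>. g i (Y i \<omega>)))"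
      by (auto intro!: tendsto_prod)
  qed
  \<comment> \<open>Continuous approximation of the indicator of a closed set. The empty set is
    treated apart because \<open>infdist x {}\<close> is 0, which would produce the constant
    1.\<close>
  define h :: "real set \<Rightarrow> nat \<Rightarrow> real \<Rightarrow> real" where
    "h A m x = (if A = {} then 0 else max 0 (1 - real m * infdist x A))" for A m x
  have h01: "0 \<le> h A m x" "h A m x \<le> 1" for A m x by (auto simp: h_def infdist_nonneg)
  have hc: "continuous_on UNIV (h A m)" for A m
    unfolding h_def by (cases "A = {}") (auto intro!: continuous_intros)
  then have hm[measurable]: "h A m \<in> borel_measurable borel" for A m by (rule borel_measurable_continuous_onI)
  have hlim: "(\<lambda>m. h A m x) \<longlonglongrightarrow> indicator A x" if "closed A" for A x
  proof (cases "x \<in> A")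
    case True
    then have "A \<noteq> {}" by auto
    then show ?thesis using True by (simp add: h_def)
  next
    case False
    show ?thesis
    proof (cases "A = {}")
      case True then show ?thesis by (simp add: h_def)
    next
      case ne: False
      then have pos: "0 < infdist x A" using that False
        by (metis in_closed_iff_infdist_zero infdist_nonneg less_eq_real_def)
      have "\<forall>\<^sub>F m in sequentially. h A m x = 0"
      proof -
        obtain m0 :: nat where "1 < real m0 * infdist x A" using reals_Archimedean3[OF pos] by blast
        then have "1 \<le> real m * infdist x A" if "m0 \<le> m" for m
          using that pos by (meson less_imp_le mult_right_mono of_nat_le_iff order_trans)
        then show ?thesis using ne unfolding eventually_sequentially by (intro exI[of _ m0]) (simp add: h_def)
      qed
      then show ?thesis using False by (simp add: tendsto_eventually)
    qed
  qed
  have bc: "sets borel = sigma_sets (UNIV::real set) (Collect closed)"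
    using borel_eq_closed[where 'a=real] by (metis sets_measure_of top_greatest Pow_UNIV)
  show ?thesis
  proof (subst indep_vars_finite[OF ne I, where E="\<lambda>_. Collect closed"])
    show "\<forall>A\<in>I \<rightarrow> Collect closed. prob (\<Inter>j\<in>I. Y j -` A j \<inter> space M) = (\<Prod>j\<in>I. prob (Y j -` A j \<inter> space M))"
    proof
      fix A assume A: "A \<in> I \<rightarrow> (Collect closed :: real set set)"
      then have cl: "closed (A i)" if "i \<in> I" for i using that by auto
      have mh: "(\<lambda>\<omega>. h (A i) m (Y i \<omega>)) \<in> borel_measurable M" if "i \<in> I" for i m
        using measurable_compose[OF Y[OF that] hm] .
      have mi: "(\<lambda>\<omega>. indicat_real (A i) (Y i \<omega>)) \<in> borel_measurable M" if "i \<in> I" for i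
        using cl[OF that] by (intro measurable_compose[OF Y[OF that]] borel_measurable_indicator) auto
      have ev: "expectation (\<lambda>\<omega>. indicat_real (A i) (Y i \<omega>)) = prob (Y i -` A i \<inter> space M)" if "i \<in> I" for i
      proof -
        have "Y i -` A i \<inter> space M \<in> events" using cl[OF that] by (intro measurable_sets[OF Y[OF that]]) auto
        moreover have "expectation (\<lambda>\<omega>. indicat_real (A i) (Y i \<omega>)) = expectation (indicator (Y i -` A i \<inter> space M))"
          by (intro Bochner_Integration.integral_cong) (auto simp: indicator_def)
        ultimately show ?thesis by simp
      qed
      have "prob (\<Inter>j\<in>I. Y j -` A j \<inter> space M) = expectation (\<lambda>\<omega>. \<Prod>i\<in>I. indicat_real (A i) (Y i \<omega>))"
      proof -
        have "(\<Inter>j\<in>I. Y j -` A j \<inter> space M) \<in> events" using Y cl ne I by (intro sets.finite_INT) (auto intro: measurable_sets)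
        then have "prob (\<Inter>j\<in>I. Y j -` A j \<inter> space M) = expectation (indicator (\<Inter>j\<in>I. Y j -` A j \<inter> space M))"
          by simp
        also have "\<dots> = expectation (\<lambda>\<omega>. \<Prod>i\<in>I. indicat_real (A i) (Y i \<omega>))"
        proof (intro Bochner_Integration.integral_cong refl)
          fix \<omega> assume "\<omega> \<in> space M"
          then show "indicator (\<Inter>j\<in>I. Y j -` A j \<inter> space M) \<omega> = (\<Prod>i\<in>I. indicat_real (A i) (Y i \<omega>))"
            using I by (cases "\<forall>j\<in>I. Y j \<omega> \<in> A j") (auto simp: indicator_def prod_zero_iff)
        qed
        finally show ?thesis .
      qed
      also have "\<dots> = (\<Prod>i\<in>I. expectation (\<lambda>\<omega>. indicat_real (A i) (Y i \<omega>)))"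
      proof (rule LIMSEQ_unique)
        show "(\<lambda>m. expectation (\<lambda>\<omega>. \<Prod>i\<in>I. h (A i) m (Y i \<omega>))) \<longlonglongrightarrow> expectation (\<lambda>\<omega>. \<Prod>i\<in>I. indicat_real (A i) (Y i \<omega>))"
          using mh mi h01 hlim cl
          by (intro integral_dominated_convergence[where w="\<lambda>_. 1"])
             (auto intro!: borel_measurable_prod tendsto_prod prod_le_1 simp: abs_prod)
        have "expectation (\<lambda>\<omega>. \<Prod>i\<in>I. h (A i) m (Y i \<omega>)) = (\<Prod>i\<in>I. expectation (\<lambda>\<omega>. h (A i) m (Y i \<omega>)))" for m
          by (rule step) (use hc h01 in auto)
        moreover have "(\<lambda>m. expectation (\<lambda>\<omega>. h (A i) m (Y i \<omega>))) \<longlonglongrightarrow> expectation (\<lambda>\<omega>. indicat_real (A i) (Y i \<omega>))" if "i \<in> I" for i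
          using mh[OF that] mi[OF that] h01 hlim[OF cl[OF that]]
          by (intro integral_dominated_convergence[where w="\<lambda>_. 1"]) auto
        ultimately show "(\<lambda>m. expectation (\<lambda>\<omega>. \<Prod>i\<in>I. h (A i) m (Y i \<omega>))) \<longlonglongrightarrow> (\<Prod>i\<in>I. expectation (\<lambda>\<omega>. indicat_real (A i) (Y i \<omega>)))"
          by (auto intro!: tendsto_prod)
      qed
      finally show "prob (\<Inter>j\<in>I. Y j -` A j \<inter> space M) = (\<Prod>j\<in>I. prob (Y j -` A j \<inter> space M))"
        using ev by simp
    qed
  qed (use Y bc in \<open>auto simp: Int_stable_def\<close>)
qed

text \<open>Each centred normal law is the image of the standard one under scaling, so the
  characteristic functions converge with the scales, and the limit is identified by uniqueness. The
  law of \<open>X n\<close> is prescribed only for \<open>0 < s n\<close>, since in the application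
  the sum over an empty dyadic range is 0.\<close>

lemma (in prob_space) normal_limit:
  fixes X :: "nat \<Rightarrow> 'a \<Rightarrow> real"
  assumes X: "\<And>n. 0 < s n \<Longrightarrow> distributed M lborel (X n) (normal_density 0 (s n))"
    and s: "s \<longlonglongrightarrow> \<sigma>" "0 < \<sigma>" and mX: "\<And>n. random_variable borel (X n)"
    and [measurable]: "random_variable borel Y" and lim: "AE \<omega> in M. (\<lambda>n. X n \<omega>) \<longlonglongrightarrow> Y \<omega>"
  shows "distributed M lborel Y (normal_density 0 \<sigma>)"
proof -
  note [measurable] = mX
  let ?N = "std_normal_distribution"
  interpret N: prob_space ?N by (rule prob_space_normal_density) simp
  have [simp]: "space ?N = UNIV" by simp
  have D: "distr M borel (X n) = distr ?N borel (\<lambda>x. s n * x)" if pos: "0 < s n" for n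
  proof -
    have "distributed ?N lborel (\<lambda>x. x) std_normal_density"
      by (auto simp: distributed_def intro!: distr_id2)
    from N.normal_density_affine[OF this, of "s n" 0] pos
    have "distributed ?N lborel (\<lambda>x. s n * x) (normal_density 0 (s n))" by simp
    with X[OF pos] show ?thesis by (auto simp: distributed_def cong: distr_cong)
  qed
  have "char (distr M borel Y) \<theta> = char (distr ?N borel (\<lambda>x. \<sigma> * x)) \<theta>" for \<theta>
  proof (rule LIMSEQ_unique)
    show "(\<lambda>n. char (distr M borel (X n)) \<theta>) \<longlonglongrightarrow> char (distr M borel Y) \<theta>"
      unfolding char_def using lim
      by (subst (1 2) integral_distr) (auto intro!: integral_dominated_convergence[where w="\<lambda>_. 1"] tendsto_intros elim!: eventually_mono)
    have "(\<lambda>n. char (distr ?N borel (\<lambda>x. s n * x)) \<theta>) \<longlonglongrightarrow> char (distr ?N borel (\<lambda>x. \<sigma> * x)) \<theta>"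
      unfolding char_def using s(1)
      by (subst (1 2) integral_distr) (auto intro!: integral_dominated_convergence[where w="\<lambda>_. 1"] tendsto_intros N.integrable_const)
    moreover have "\<forall>\<^sub>F n in sequentially. 0 < s n" using s by (rule order_tendstoD)
    ultimately show "(\<lambda>n. char (distr M borel (X n)) \<theta>) \<longlonglongrightarrow> char (distr ?N borel (\<lambda>x. \<sigma> * x)) \<theta>"
      by (elim Lim_transform_eventually eventually_mono) (simp add: D)
  qed
  then have "distr M borel Y = distr ?N borel (\<lambda>x. \<sigma> * x)"
    by (intro Levy_uniqueness) (auto intro!: N.real_distribution_distr)
  moreover have "distributed ?N lborel (\<lambda>x. \<sigma> * x) (normal_density 0 \<sigma>)"
  proof -
    have "distributed ?N lborel (\<lambda>x. x) std_normal_density"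
      by (auto simp: distributed_def intro!: distr_id2)
    from N.normal_density_affine[OF this, of "\<sigma>" 0] s(2) show ?thesis by simp
  qed
  ultimately show ?thesis by (auto simp: distributed_def cong: distr_cong)
qed

section \<open>Piecewise linear paths and their dyadic refinement\<close>

definition clamp :: "real \<Rightarrow> real" where "clamp x = max 0 (min 1 x)"

text \<open>The piecewise linear path with increment \<open>d j\<close> over \<open>[j, j + 1]\<close>.\<close>

definition interp :: "(nat \<Rightarrow> real) \<Rightarrow> real \<Rightarrow> real" where
  "interp d x = (\<Sum>j<Suc (nat \<lfloor>x\<rfloor>). d j * clamp (x - real j))"

text \<open>A summand whose index is at least \<open>x\<close> vanishes. Hence on a bounded interval
  \<open>interp\<close> is one fixed finite sum, from which continuity is read off.\<close>

lemma interp_eq: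
  assumes "x \<le> real K" shows "interp d x = (\<Sum>j<K. d j * clamp (x - real j))"
proof -
  define m where "m = max K (Suc (nat \<lfloor>x\<rfloor>))"
  have "interp d x = (\<Sum>j<m. d j * clamp (x - real j))"
    unfolding interp_def
  proof (rule sum.mono_neutral_left)
    show "\<forall>j\<in>{..<m} - {..<Suc (nat \<lfloor>x\<rfloor>)}. d j * clamp (x - real j) = 0"
    proof
      fix j assume "j \<in> {..<m} - {..<Suc (nat \<lfloor>x\<rfloor>)}"
      then have "x \<le> real j" by (simp add: not_less) linarith
      then show "d j * clamp (x - real j) = 0" by (simp add: clamp_def)
    qed
  qed (auto simp: m_def)
  also have "\<dots> = (\<Sum>j<K. d j * clamp (x - real j))"
    using assms by (intro sum.mono_neutral_right) (auto simp: m_def clamp_def)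
  finally show ?thesis .
qed

lemma interp_of_nat: "interp d (real k) = (\<Sum>j<k. d j)"
  by (subst interp_eq[OF order_refl]) (auto intro!: sum.cong simp: clamp_def max_def min_def)

lemma continuous_on_interp: "continuous_on {0..real K} (interp d)"
proof -
  have "continuous_on {0..real K} (\<lambda>x. \<Sum>j<K. d j * clamp (x - real j))"
    unfolding clamp_def by (intro continuous_intros)
  then show ?thesis by (rule continuous_on_eq) (auto simp: interp_eq)
qed

lemma continuous_on_atLeast_0I:
  fixes f :: "real \<Rightarrow> real"
  assumes "\<And>K::nat. continuous_on {0..real K} f" shows "continuous_on {0..} f"
  unfolding continuous_on_eq_continuous_within
proof
  fix x :: real assume x: "x \<in> {0..}"
  obtain K :: nat where K: "x < real K" using reals_Archimedean2 by blast
  have "continuous (at x within {0..real K}) f"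
    using assms[of K] K x by (auto simp: continuous_on_eq_continuous_within)
  moreover have "at x within {0..real K} = at x within {0..}"
    by (rule at_within_nhd[where S="{..<real K}"]) (use K in auto)
  ultimately show "continuous (at x within {0..}) f" by simp
qed

text \<open>Splitting the increment \<open>d j\<close> into \<open>d j / 2 + e j\<close> and
  \<open>d j / 2 - e j\<close> keeps the path at integers and adds a tent of height
  \<open>e j\<close> on [j, j + 1]. The tents have disjoint interiors, so the largest height bounds
  the change.\<close>

lemma interp_refine:
  assumes B: "\<And>j. j < K \<Longrightarrow> \<bar>e j\<bar> \<le> B" "0 \<le> B" and x: "0 \<le> x" "x \<le> real K"
  shows "\<bar>interp (\<lambda>j. d (j div 2) / 2 + (if even j then 1 else - 1) * e (j div 2)) (2 * x) - interp d x\<bar> \<le> B"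
proof -
  define tent where "tent y = clamp (2 * y) - clamp (2 * y - 1)" for y
  have tent: "0 \<le> tent y" "tent y \<le> 1" "y \<le> 0 \<Longrightarrow> tent y = 0" "1 \<le> y \<Longrightarrow> tent y = 0" for y
    by (auto simp: tent_def clamp_def max_def min_def)
  have c: "clamp (2 * y) + clamp (2 * y - 1) = 2 * clamp y" for y
    by (auto simp: clamp_def max_def min_def)
  let ?d' = "\<lambda>j. d (j div 2) / 2 + (if even j then 1 else - 1) * e (j div 2)"
  have split: "(\<Sum>j<2 * m. ?d' j * clamp (2 * x - real j)) - (\<Sum>j<m. d j * clamp (x - real j)) = (\<Sum>j<m. e j * tent (x - real j))" for m
  proof (induction m)
    case (Suc m)
    have "?d' (2 * m) * clamp (2 * x - real (2 * m)) + ?d' (Suc (2 * m)) * clamp (2 * x - real (Suc (2 * m)))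
       = d m / 2 * (clamp (2 * (x - real m)) + clamp (2 * (x - real m) - 1)) + e m * tent (x - real m)"
      by (simp add: tent_def algebra_simps)
    then show ?case using Suc unfolding c by (simp add: algebra_simps)
  qed simp
  have "interp ?d' (2 * x) - interp d x = (\<Sum>j<K. e j * tent (x - real j))"
    using x by (subst interp_eq[of "2 * x" "2 * K"], simp, subst interp_eq[OF x(2)], subst split[symmetric]) simp
  \<comment> \<open>At \<open>x\<close> only the tent with index
    \<open>nat \<lfloor>x\<rfloor>\<close> can be nonzero.\<close>
  also have "\<bar>\<dots>\<bar> \<le> (\<Sum>j<K. if j = nat \<lfloor>x\<rfloor> then B else 0)"
  proof (rule sum_abs[THEN order_trans], rule sum_mono)
    fix j assume j: "j \<in> {..<K}"
    show "\<bar>e j * tent (x - real j)\<bar> \<le> (if j = nat \<lfloor>x\<rfloor> then B else 0)"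
    proof (cases "j = nat \<lfloor>x\<rfloor>")
      case True
      have "\<bar>e j\<bar> * tent (x - real j) \<le> B * 1" using tent[of "x - real j"] B j by (intro mult_mono) auto
      then show ?thesis using True tent[of "x - real j"] by (simp add: abs_mult)
    next
      case False
      then have "x - real j \<le> 0 \<or> 1 \<le> x - real j" using x by linarith
      then show ?thesis using False tent by auto
    qed
  qed
  also have "\<dots> \<le> B" using B by (simp add: sum.delta)
  finally show ?thesis .
qed

section \<open>Levy's construction of the Wiener process\<close>

text \<open>Midpoint displacement: \<open>levy g n k\<close> is the increment over the k-th dyadic
  interval of length 2^-n. Both halves of an interval share one normal with opposite signs, so they
  add up to the parent. Its scale 1/(2 sqrt(2^n)) is the standard deviation of half the parent's
  increment, as the rotation of Gaussian pairs requires.\<close>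

fun levy :: "(nat \<Rightarrow> nat \<Rightarrow> real) \<Rightarrow> nat \<Rightarrow> nat \<Rightarrow> real" where
  "levy g 0 k = g 0 k"
| "levy g (Suc n) k = levy g n (k div 2) / 2 + (if even k then 1 else - 1) * (g (Suc n) (k div 2) / (2 * sqrt (2 ^ n)))"

lemma sum_singleton_Times: "sum f ({c} \<times> A) = (\<Sum>j\<in>A. f (c, j))"
  using sum.cartesian_product[of "\<lambda>x y. f (x, y)" A "{c}"] by simp

locale gauss_array = prob_space M for M :: "'a measure" +
  fixes G :: "nat \<Rightarrow> nat \<Rightarrow> 'a \<Rightarrow> real"
  assumes G_indep: "indep_vars (\<lambda>_. borel) (\<lambda>(n, k). G n k) UNIV"
    and G_normal: "\<And>n k. distributed M lborel (G n k) std_normal_density"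
begin

lemma G_measurable[measurable]: "random_variable borel (G n k)"
  using G_normal[of n k] by (auto simp: distributed_def)

definition D :: "nat \<Rightarrow> nat \<Rightarrow> 'a \<Rightarrow> real" where "D n k \<omega> = levy (\<lambda>n k. G n k \<omega>) n k"

lemma D_measurable[measurable]: "random_variable borel (D n k)"
proof (induction n arbitrary: k)
  case 0 then show ?case by (simp add: D_def[abs_def])
next
  case (Suc n) 
  note [measurable] = this
  have "D (Suc n) k = (\<lambda>\<omega>. D n (k div 2) \<omega> / 2 + (if even k then 1 else - 1) * (G (Suc n) (k div 2) \<omega> / (2 * sqrt (2 ^ n))))"
    by (simp add: D_def[abs_def])
  then show ?case by simp
qed

text \<open>The increments at level \<open>n\<close> together with all finer normals; keeping both in one independent
  family makes the passage to the next level local.\<close>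

definition Q :: "nat \<Rightarrow> nat \<times> nat \<Rightarrow> 'a \<Rightarrow> real" where
  "Q n = (\<lambda>(m, k). if m = 0 then D n k else G (n + m) k)"

lemma Q_measurable[measurable]: "random_variable borel (Q n p)"
  by (cases p) (auto simp: Q_def)

text \<open>In the step to level n + 1 the pair \<open>D n k\<close>, \<open>G (Suc n) k\<close> is
  replaced by the two children of interval k, while every finer normal is kept. The blocks stay
  independent because they are functions of disjoint blocks of the old family; the two children are
  independent by rotation.\<close>

lemma Q_indep_normal:
  "indep_vars (\<lambda>_. borel) (Q n) UNIV \<and> (\<forall>k. distributed M lborel (D n k) (normal_density 0 (1 / sqrt (2 ^ n))))"
proof (induction n)
  case 0
  have "Q 0 = (\<lambda>(n, k). G n k)" by (auto simp: Q_def D_def fun_eq_iff)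
  then show ?case using G_indep G_normal by (simp add: D_def[abs_def])
next
  case (Suc n)
  \<comment> \<open>\<open>T p\<close> is a block of the new index set, \<open>S p\<close> the block
    of the old one that it is computed from, and \<open>F p\<close> the deterministic map between
    them.\<close>
  define T :: "nat \<times> nat \<Rightarrow> (nat \<times> nat) set" where
    "T = (\<lambda>(m, k). if m = 0 then {(0, 2 * k), (0, Suc (2 * k))} else {(m, k)})"
  define S :: "nat \<times> nat \<Rightarrow> (nat \<times> nat) set" where
    "S = (\<lambda>(m, k). if m = 0 then {(0, k), (1, k)} else {(Suc m, k)})"
  define F :: "nat \<times> nat \<Rightarrow> (nat \<times> nat \<Rightarrow> real) \<Rightarrow> (nat \<times> nat \<Rightarrow> real)" where
    "F p h = restrict (\<lambda>(m, j). if m = 0 then h (0, j div 2) / 2 + (if even j then 1 else - 1) * (h (1, j div 2) / (2 * sqrt (2 ^ n))) else h (Suc m, j)) (T p)" for p h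
  have QF: "F p (restrict (\<lambda>i. Q n i \<omega>) (S p)) = restrict (\<lambda>i. Q (Suc n) i \<omega>) (T p)" for p \<omega>
    by (cases p) (auto simp: F_def T_def S_def Q_def D_def fun_eq_iff restrict_def)
  have out: "indep_vars (\<lambda>p. PiM (T p) (\<lambda>_. borel)) (\<lambda>p \<omega>. restrict (\<lambda>i. Q (Suc n) i \<omega>) (T p)) UNIV"
  proof -
    have "indep_vars (\<lambda>p. PiM (S p) (\<lambda>_. borel)) (\<lambda>p \<omega>. restrict (\<lambda>i. Q n i \<omega>) (S p)) UNIV"
      using Suc by (intro indep_vars_restrict[where I=UNIV]) (auto simp: S_def disjoint_family_on_def split: if_splits)
    moreover have "F p \<in> PiM (S p) (\<lambda>_. borel) \<rightarrow>\<^sub>M PiM (T p) (\<lambda>_. borel)" for p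
    proof -
      obtain m k where p: "p = (m, k)" by (cases p)
      show "F p \<in> PiM (S p) (\<lambda>_. borel) \<rightarrow>\<^sub>M PiM (T p) (\<lambda>_. borel)"
        unfolding F_def[abs_def]
      proof (rule measurable_restrict)
        fix i assume i: "i \<in> T p"
        show "(\<lambda>x. case i of (m, j) \<Rightarrow> if m = 0 then x (0, j div 2) / 2 + (if even j then 1 else - 1) * (x (1, j div 2) / (2 * sqrt (2 ^ n))) else x (Suc m, j))
            \<in> borel_measurable (PiM (S p) (\<lambda>_. borel))"
        proof (cases "m = 0")
          case True
          have [measurable]: "(\<lambda>x. x (0, k)) \<in> borel_measurable (PiM (S p) (\<lambda>_. borel))" "(\<lambda>x. x (Suc 0, k)) \<in> borel_measurable (PiM (S p) (\<lambda>_. borel))"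
            by (rule measurable_component_singleton; simp add: S_def p True)+
          have "fst i = 0" "snd i div 2 = k" using i by (auto simp: T_def p True)
          then show ?thesis by (cases i) simp
        next
          case False
          then have "i = (m, k)" using i by (auto simp: T_def p)
          then show ?thesis using False by (auto intro!: measurable_component_singleton simp: S_def p)
        qed
      qed
    qed
    ultimately show ?thesis
      using indep_vars_compose2[of _ _ _ F "\<lambda>p. PiM (T p) (\<lambda>_. borel)"] unfolding QF[symmetric] by blast
  qed
  let ?s = "1 / (2 * sqrt (2 ^ n))"
  have s: "0 < ?s" "sqrt 2 * ?s = 1 / sqrt (2 ^ Suc n)"
    by (auto simp: real_sqrt_mult field_simps)
  have nX: "distributed M lborel (\<lambda>\<omega>. D n k \<omega> / 2) (normal_density 0 ?s)" for k
    using normal_density_affine[of "D n k" 0 "1 / sqrt (2 ^ n)" "1/2" 0] Suc by simp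
  have nY: "distributed M lborel (\<lambda>\<omega>. G (Suc n) k \<omega> / (2 * sqrt (2 ^ n))) (normal_density 0 ?s)" for k
    using normal_density_affine[OF G_normal, of "?s" 0 "Suc n" k] by simp
  have iXY: "indep_var borel (\<lambda>\<omega>. D n k \<omega> / 2) borel (\<lambda>\<omega>. G (Suc n) k \<omega> / (2 * sqrt (2 ^ n)))" for k
  proof -
    have "indep_var borel (Q n (0, k)) borel (Q n (1, k))"
      using indep_var_of_indep_vars[OF conjunct1[OF Suc], of "(0,k)" "(1,k)"] by simp
    from indep_var_compose[OF this, of "\<lambda>x. x / 2" borel "\<lambda>x. x / (2 * sqrt (2 ^ n))" borel]
    show ?thesis by (simp add: comp_def Q_def)
  qed
  have De: "D (Suc n) (2 * k) = (\<lambda>\<omega>. D n k \<omega> / 2 + G (Suc n) k \<omega> / (2 * sqrt (2 ^ n)))"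
       "D (Suc n) (Suc (2 * k)) = (\<lambda>\<omega>. D n k \<omega> / 2 - G (Suc n) k \<omega> / (2 * sqrt (2 ^ n)))" for k
    by (simp_all add: D_def[abs_def])
  note rot = indep_normal_rotate[OF s(1) iXY nX nY, folded De, unfolded s(2)]
  have "indep_vars (\<lambda>_. borel) (Q (Suc n)) UNIV"
  proof (rule indep_vars_blocks[OF _ _ out])
    show "disjoint_family_on T UNIV" by (auto simp: T_def disjoint_family_on_def split: if_splits)
    show "UNIV = (\<Union>p. T p)"
    proof -
      have "(m, j) \<in> T (if m = 0 then (0, j div 2) else (m, j))" for m j :: nat by (auto simp: T_def)
      then show ?thesis by fastforce
    qed
    fix p :: "nat \<times> nat"
    show "indep_vars (\<lambda>_. borel) (Q (Suc n)) (T p)"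
    proof (cases "fst p = 0")
      case True
      then have "T p = {(0, 2 * snd p), (0, Suc (2 * snd p))}" by (auto simp: T_def split: prod.splits)
      moreover have "indep_var borel (Q (Suc n) (0, 2 * snd p)) borel (Q (Suc n) (0, Suc (2 * snd p)))"
        using rot(1)[of "snd p"] by (simp add: Q_def)
      ultimately show ?thesis using indep_vars_two[where V="Q (Suc n)" and M'="\<lambda>_. borel"] by simp
    next
      case False
      then have "T p = {p}" by (auto simp: T_def split: prod.splits)
      then show ?thesis by (simp add: indep_vars_singleton)
    qed
  qed
  moreover have "distributed M lborel (D (Suc n) k) (normal_density 0 (1 / sqrt (2 ^ Suc n)))" for k
  proof (cases "even k")
    case True then obtain j where "k = 2 * j" by blast
    then show ?thesis using rot(2)[of j] by simp
  next
    case False then obtain j where "k = Suc (2 * j)" by (metis oddE Suc_eq_plus1)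
    then show ?thesis using rot(3)[of j] by simp
  qed
  ultimately show ?case by blast
qed

lemma D_sums_indep:
  assumes "mono a"
  shows "indep_vars (\<lambda>_. borel) (\<lambda>i \<omega>. \<Sum>j\<in>{a i..<a (Suc i)}. D n j \<omega>) {..<m}"
proof -
  define K where "K i = {0::nat} \<times> {a i..<a (Suc i)}" for i
  have "disjoint_family_on K {..<m}"
    unfolding disjoint_family_on_def
  proof safe
    fix i j x y assume ij: "i \<noteq> j" "(x, y) \<in> K i" "(x, y) \<in> K j"
    have "a (Suc i) \<le> a j \<or> a (Suc j) \<le> a i" using ij(1) by (metis Suc_leI assms linorder_neqE_nat monoD)
    then show "(x, y) \<in> {}" using ij by (auto simp: K_def)
  qed
  then have "indep_vars (\<lambda>i. PiM (K i) (\<lambda>_. borel)) (\<lambda>i \<omega>. restrict (\<lambda>p. Q n p \<omega>) (K i)) {..<m}"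
    using Q_indep_normal[of n] by (intro indep_vars_restrict[where I=UNIV]) auto
  from indep_vars_compose2[OF this, of "\<lambda>i h. \<Sum>p\<in>K i. h p" "\<lambda>_. borel"]
  have "indep_vars (\<lambda>_. borel) (\<lambda>i \<omega>. \<Sum>p\<in>K i. restrict (\<lambda>p. Q n p \<omega>) (K i) p) {..<m}"
    by (auto intro!: borel_measurable_sum measurable_component_singleton)
  moreover have "(\<Sum>p\<in>K i. restrict (\<lambda>p. Q n p \<omega>) (K i) p) = (\<Sum>j\<in>{a i..<a (Suc i)}. D n j \<omega>)" for i \<omega>
    unfolding K_def sum_singleton_Times by (auto simp: Q_def intro!: sum.cong)
  ultimately show ?thesis by simp
qed

lemma D_sum_normal:
  assumes "a < b"
  shows "distributed M lborel (\<lambda>\<omega>. \<Sum>j\<in>{a..<b}. D n j \<omega>) (normal_density 0 (sqrt (real (b - a) / 2 ^ n)))"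
proof -
  let ?I = "{0::nat} \<times> {a..<b}"
  have "indep_vars (\<lambda>_. borel) (Q n) ?I"
    using Q_indep_normal[of n] by (auto intro: indep_vars_subset)
  then have "distributed M lborel (\<lambda>\<omega>. \<Sum>p\<in>?I. Q n p \<omega>) (normal_density (\<Sum>p\<in>?I. 0) (sqrt (\<Sum>p\<in>?I. (1 / sqrt (2 ^ n))\<^sup>2)))"
    using assms Q_indep_normal[of n] by (intro sum_indep_normal) (auto simp: Q_def)
  moreover have "(\<Sum>p\<in>?I. Q n p \<omega>) = (\<Sum>j\<in>{a..<b}. D n j \<omega>)" for \<omega>
    unfolding sum_singleton_Times by (simp add: Q_def)
  ultimately show ?thesis by (simp add: power_divide)
qed

text \<open>The bound is 2^(n/4), while a normal of level n + 1 is scaled by 2^(-n/2)/2; the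
  displacements thus decay geometrically. The first n 2^n intervals of level n fill [0, n], so each
  bounded time interval is covered from some level on.\<close>

definition good :: "'a \<Rightarrow> bool" where
  "good \<omega> \<longleftrightarrow> (\<exists>n0. \<forall>n\<ge>n0. \<forall>j<n * 2 ^ n. \<bar>G (Suc n) j \<omega>\<bar> \<le> sqrt (sqrt 2) ^ n)"

lemma good_measurable[measurable]: "Measurable.pred M good"
  unfolding good_def[abs_def] by measurable

text \<open>Markov's inequality for the eighth moment 7 * 5 * 3 * 1 = 105. With x = 2^(n/4) the
  bound is of order 4^-n, which remains summable after multiplication by the n 2^n variables
  concerned.\<close>

lemma prob_G_large:
  assumes "0 < x" shows "prob {\<omega>\<in>space M. x < \<bar>G n k \<omega>\<bar>} \<le> 105 / x ^ 8"
proof -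
  have 8: "integrable lborel (\<lambda>x. std_normal_density x * x ^ 8)" "(\<integral>x. std_normal_density x * x ^ 8 \<partial>lborel) = 105"
    using std_normal_moment_even[of 4] by (auto simp: has_bochner_integral_iff fact_numeral)
  have i: "integrable M (\<lambda>\<omega>. G n k \<omega> ^ 8)" 
    using distributed_integrable[OF G_normal, of "\<lambda>x. x ^ 8" n k] 8 by simp
  have e: "expectation (\<lambda>\<omega>. G n k \<omega> ^ 8) = 105"
    using distributed_integral[OF G_normal, of "\<lambda>x. x ^ 8" n k] 8 by simp
  have "prob {\<omega>\<in>space M. x < \<bar>G n k \<omega>\<bar>} \<le> prob {\<omega>\<in>space M. x ^ 8 \<le> G n k \<omega> ^ 8}"
  proof (rule finite_measure_mono)
    show "{\<omega>\<in>space M. x < \<bar>G n k \<omega>\<bar>} \<subseteq> {\<omega>\<in>space M. x ^ 8 \<le> G n k \<omega> ^ 8}"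
    proof safe
      fix \<omega> assume "x < \<bar>G n k \<omega>\<bar>"
      then have "x ^ 8 \<le> \<bar>G n k \<omega>\<bar> ^ 8" using assms by (intro power_mono) auto
      then show "x ^ 8 \<le> G n k \<omega> ^ 8" by (simp add: power_even_abs)
    qed
  qed measurable
  also have "\<dots> \<le> 105 / x ^ 8"
    using integral_Markov_inequality_measure[OF i, of "{}" "x ^ 8"] assms e by simp
  finally show ?thesis .
qed

lemma AE_good: "AE \<omega> in M. good \<omega>"
proof -
  let ?r = "sqrt (sqrt 2)"
  define A where "A n = {\<omega>\<in>space M. \<exists>j<n * 2 ^ n. ?r ^ n < \<bar>G (Suc n) j \<omega>\<bar>}" for n
  have [measurable]: "A n \<in> events" for n unfolding A_def by measurable
  have r8: "?r ^ 8 = 4"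
  proof -
    have "?r ^ 8 = ?r ^ (2 * (2 * 2))" by simp
    also have "\<dots> = ((?r ^ 2) ^ 2) ^ 2" by (simp only: power_mult)
    also have "\<dots> = 4" by simp
    finally show ?thesis .
  qed
  have "prob (A n) \<le> 105 * (real n * (1/2) ^ n)" for n
  proof -
    have "prob (A n) \<le> prob (\<Union>j<n * 2 ^ n. {\<omega>\<in>space M. ?r ^ n < \<bar>G (Suc n) j \<omega>\<bar>})"
      by (rule finite_measure_mono) (auto simp: A_def)
    also have "\<dots> \<le> (\<Sum>j<n * 2 ^ n. prob {\<omega>\<in>space M. ?r ^ n < \<bar>G (Suc n) j \<omega>\<bar>})"
      by (intro finite_measure_subadditive_finite) auto
    also have "\<dots> \<le> (\<Sum>j<n * 2 ^ n. 105 / (?r ^ n) ^ 8)"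
      by (intro sum_mono prob_G_large) auto
    also have "(?r ^ n) ^ 8 = 4 ^ n" by (metis r8 power_mult mult.commute)
    also have "(\<Sum>j<n * 2 ^ n. 105 / 4 ^ n) = 105 * (real n * (1/2) ^ n)"
    proof -
      have "(4::real) ^ n = 2 ^ n * 2 ^ n" by (simp flip: power_mult_distrib)
      then show ?thesis by (simp add: power_divide)
    qed
    finally show ?thesis .
  qed
  moreover have "summable (\<lambda>n. 105 * (real n * (1/2) ^ n :: real))"
  proof -
    \<comment> \<open>The derivative of the geometric series at 1/2; passing from the exponent n - 1
      to n costs a factor 2.\<close>
    have "summable (\<lambda>n. real n * (1/2) ^ (n - 1) :: real)"
      using geometric_deriv_sums[of "1/2::real"] by (rule_tac summable_Suc_iff[THEN iffD1]) (auto simp: sums_iff)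
    then have "summable (\<lambda>n. 105 / 2 * (real n * (1/2) ^ (n - 1) :: real))" by (rule summable_mult)
    moreover have "(\<lambda>n. 105 / 2 * (real n * (1/2) ^ (n - 1) :: real)) = (\<lambda>n. 105 * (real n * (1/2) ^ n))"
    proof
      show "105 / 2 * (real n * (1/2) ^ (n - 1) :: real) = 105 * (real n * (1/2) ^ n)" for n by (cases n) auto
    qed
    ultimately show ?thesis by (simp only:)
  qed
  ultimately have "summable (\<lambda>n. prob (A n))"
    by (elim summable_comparison_test'[where N=0]) (simp only: real_norm_def abs_of_nonneg measure_nonneg)
  then have "AE \<omega> in M. eventually (\<lambda>n. \<omega> \<in> space M - A n) sequentially"
    by (intro borel_cantelli_AE1) (auto simp: less_top[symmetric])
  then show ?thesis
  proof eventually_elim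
    case (elim \<omega>)
    then obtain N where "\<forall>n\<ge>N. \<omega> \<in> space M - A n" by (auto simp: eventually_sequentially)
    moreover have "\<omega> \<in> A n" if "\<not> \<bar>G (Suc n) j \<omega>\<bar> \<le> ?r ^ n" "j < n * 2 ^ n" "\<omega> \<in> space M" for n j
      using that by (auto simp: A_def not_le)
    ultimately show ?case unfolding good_def by (intro exI[of _ N] allI impI) (meson DiffD1 DiffD2)
  qed
qed

definition Wn :: "nat \<Rightarrow> real \<Rightarrow> 'a \<Rightarrow> real" where "Wn n t \<omega> = interp (\<lambda>k. D n k \<omega>) (2 ^ n * t)"

text \<open>The limit is written as a telescoping series, so that it is measurable as a sum of
  random variables. On the null set of paths that are not \<open>good\<close> it is set to 0,
  because a Wiener process is required to have every path continuous.\<close>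

definition W :: "real \<Rightarrow> 'a \<Rightarrow> real" where
  "W t \<omega> = (if good \<omega> then Wn 0 t \<omega> + (\<Sum>n. Wn (Suc n) t \<omega> - Wn n t \<omega>) else 0)"

lemma Wn_measurable[measurable]: "random_variable borel (Wn n t)"
  unfolding Wn_def[abs_def] interp_def by measurable

lemma W_measurable[measurable]: "random_variable borel (W t)"
  unfolding W_def[abs_def] by measurable

text \<open>Consecutive levels differ on [0, K] by at most 2^(n/4) / (2 * 2^(n/2)), the terms of a
  convergent geometric series.\<close>

lemma Wn_uniform_limit:
  assumes "good \<omega>" shows "uniform_limit {0..real K} (\<lambda>n t. Wn n t \<omega>) (\<lambda>t. W t \<omega>) sequentially"
proof -
  let ?r = "sqrt (sqrt 2)"
  obtain n0 where n0: "\<And>n j. n \<ge> n0 \<Longrightarrow> j < n * 2 ^ n \<Longrightarrow> \<bar>G (Suc n) j \<omega>\<bar> \<le> ?r ^ n"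
    using assms by (auto simp: good_def)
  have r2: "sqrt (2 ^ n) = ?r ^ n * ?r ^ n" for n by (simp add: real_sqrt_power flip: power_mult_distrib)
  have bound: "\<bar>Wn (Suc n) t \<omega> - Wn n t \<omega>\<bar> \<le> 1 / 2 * (1 / ?r) ^ n"
    if n: "n \<ge> max n0 K" and t: "t \<in> {0..real K}" for n t
  proof -
    have eq: "Wn (Suc n) t \<omega> = interp (\<lambda>j. D n (j div 2) \<omega> / 2 + (if even j then 1 else - 1) * (G (Suc n) (j div 2) \<omega> / (2 * sqrt (2 ^ n)))) (2 * (2 ^ n * t))"
      by (simp add: Wn_def D_def mult.assoc)
    have "\<bar>Wn (Suc n) t \<omega> - Wn n t \<omega>\<bar> \<le> ?r ^ n / (2 * sqrt (2 ^ n))"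
      unfolding eq unfolding Wn_def
    \<comment> \<open>The intervals of level n up to time \<open>K\<close> have indices below K 2^n,
      and \<open>K \<le> n\<close> places them in the range controlled by
      \<open>good\<close>.\<close>
    proof (rule interp_refine[where K="K * 2 ^ n"])
      fix j assume "j < K * 2 ^ n"
      also have "\<dots> \<le> n * 2 ^ n" using n by simp
      finally have "\<bar>G (Suc n) j \<omega>\<bar> \<le> ?r ^ n" using n by (intro n0) auto
      then show "\<bar>G (Suc n) j \<omega> / (2 * sqrt (2 ^ n))\<bar> \<le> ?r ^ n / (2 * sqrt (2 ^ n))"
        by (simp add: abs_divide divide_right_mono)
    qed (use t in \<open>auto simp: mult.commute\<close>)
    also have "\<dots> = 1 / 2 * (1 / ?r) ^ n" unfolding r2 by (simp add: field_simps power_divide)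
    finally show ?thesis .
  qed
  have "uniform_limit {0..real K} (\<lambda>n t. \<Sum>i<n. Wn (Suc i) t \<omega> - Wn i t \<omega>) (\<lambda>t. \<Sum>n. Wn (Suc n) t \<omega> - Wn n t \<omega>) sequentially"
  proof (rule Weierstrass_m_test_ev)
    show "\<forall>\<^sub>F n in sequentially. \<forall>t\<in>{0..real K}. norm (Wn (Suc n) t \<omega> - Wn n t \<omega>) \<le> 1 / 2 * (1 / ?r) ^ n"
      using eventually_ge_at_top[of "max n0 K"] by eventually_elim (use bound in auto)
    show "summable (\<lambda>n. 1 / 2 * (1 / ?r) ^ n)"
      by (intro summable_mult summable_geometric) (simp add: real_less_rsqrt)
  qed
  then have "uniform_limit {0..real K} (\<lambda>n t. Wn 0 t \<omega> + (\<Sum>i<n. Wn (Suc i) t \<omega> - Wn i t \<omega>)) (\<lambda>t. Wn 0 t \<omega> + (\<Sum>n. Wn (Suc n) t \<omega> - Wn n t \<omega>)) sequentially"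
    by (intro uniform_limit_intros)
  moreover have "Wn 0 t \<omega> + (\<Sum>i<n. Wn (Suc i) t \<omega> - Wn i t \<omega>) = Wn n t \<omega>" for n t
    by (subst sum_lessThan_telescope) simp
  ultimately show ?thesis using assms by (simp add: W_def)
qed

lemma W_continuous: "continuous_on {0..} (\<lambda>t. W t \<omega>)"
proof (cases "good \<omega>")
  case True
  show ?thesis
  proof (rule continuous_on_atLeast_0I)
    fix K :: nat
    show "continuous_on {0..real K} (\<lambda>t. W t \<omega>)"
    proof (rule uniform_limit_theorem[OF _ Wn_uniform_limit[OF True]])
      have "continuous_on {0..real K} (\<lambda>t. Wn n t \<omega>)" for n
        unfolding Wn_def
        by (rule continuous_on_compose2[OF continuous_on_interp[of "2 ^ n * K"]]) (auto intro!: continuous_intros)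
      then show "\<forall>\<^sub>F n in sequentially. continuous_on {0..real K} (\<lambda>t. Wn n t \<omega>)" by simp
    qed simp
  qed
qed (simp add: W_def)

lemma W_0: "W 0 \<omega> = 0"
  using interp_of_nat[of _ 0] by (simp add: W_def Wn_def)

text \<open>Uniform convergence permits a time that varies with the level. At the dyadic time just
  below \<open>t\<close> the polygonal path is exactly a sum of increments, whose law is
  known.\<close>

lemma W_dyadic_limit:
  assumes "good \<omega>" "0 \<le> t" shows "(\<lambda>n. \<Sum>j<nat \<lfloor>2 ^ n * t\<rfloor>. D n j \<omega>) \<longlonglongrightarrow> W t \<omega>"
proof -
  obtain K :: nat where K: "t \<le> real K" using real_arch_simple by blast
  define u where "u n = real (nat \<lfloor>2 ^ n * t\<rfloor>) / 2 ^ n" for n :: nat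
  have u: "u n \<in> {0..real K}" "u n \<le> t" "t - 1 / 2 ^ n \<le> u n" for n
  proof -
    have "real (nat \<lfloor>2 ^ n * t\<rfloor>) \<le> 2 ^ n * t" "2 ^ n * t - 1 \<le> real (nat \<lfloor>2 ^ n * t\<rfloor>)" using assms(2) by auto
    then have "u n \<le> 2 ^ n * t / 2 ^ n" "(2 ^ n * t - 1) / 2 ^ n \<le> u n" unfolding u_def by (intro divide_right_mono; simp)+
    then show "u n \<le> t" "t - 1 / 2 ^ n \<le> u n" by (auto simp: diff_divide_distrib)
    then show "u n \<in> {0..real K}" using K by (auto simp: u_def intro: order_trans)
  qed
  have lim_u: "u \<longlonglongrightarrow> t"
  proof (rule tendsto_sandwich[of "\<lambda>n. t - 1 / 2 ^ n" u _ "\<lambda>_. t"])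
    have "(\<lambda>n. t - (1/2) ^ n) \<longlonglongrightarrow> t - 0" by (intro tendsto_intros LIMSEQ_realpow_zero) auto
    then show "(\<lambda>n. t - 1 / 2 ^ n) \<longlonglongrightarrow> t" by (simp add: power_divide)
  qed (use u in auto)
  have "(\<lambda>n. W (u n) \<omega>) \<longlonglongrightarrow> W t \<omega>"
    by (rule continuous_on_tendsto_compose[OF W_continuous lim_u]) (use u assms in auto)
  moreover have "(\<lambda>n. Wn n (u n) \<omega> - W (u n) \<omega>) \<longlonglongrightarrow> 0"
  proof (rule LIMSEQ_I)
    fix e :: real assume "0 < e"
    then obtain N where "\<forall>n\<ge>N. \<forall>s\<in>{0..real K}. dist (Wn n s \<omega>) (W s \<omega>) < e"
      using Wn_uniform_limit[OF assms(1), of K] by (auto simp: uniform_limit_sequentially_iff)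
    then show "\<exists>N. \<forall>n\<ge>N. norm (Wn n (u n) \<omega> - W (u n) \<omega> - 0) < e" using u by (intro exI[of _ N]) (simp add: dist_norm)
  qed
  ultimately have "(\<lambda>n. (Wn n (u n) \<omega> - W (u n) \<omega>) + W (u n) \<omega>) \<longlonglongrightarrow> 0 + W t \<omega>" by (intro tendsto_add)
  moreover have "Wn n (u n) \<omega> = (\<Sum>j<nat \<lfloor>2 ^ n * t\<rfloor>. D n j \<omega>)" for n
    by (simp add: Wn_def u_def interp_of_nat)
  ultimately show ?thesis by simp
qed

lemma W_increment_limit:
  assumes "0 \<le> s" "s \<le> t"
  shows "AE \<omega> in M. (\<lambda>n. \<Sum>j\<in>{nat \<lfloor>2 ^ n * s\<rfloor>..<nat \<lfloor>2 ^ n * t\<rfloor>}. D n j \<omega>) \<longlonglongrightarrow> W t \<omega> - W s \<omega>"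
  using AE_good
proof eventually_elim
  case (elim \<omega>)
  have "(\<lambda>n. (\<Sum>j<nat \<lfloor>2 ^ n * t\<rfloor>. D n j \<omega>) - (\<Sum>j<nat \<lfloor>2 ^ n * s\<rfloor>. D n j \<omega>)) \<longlonglongrightarrow> W t \<omega> - W s \<omega>"
    using assms by (intro tendsto_diff W_dyadic_limit elim) auto
  moreover have "(\<Sum>j<nat \<lfloor>2 ^ n * t\<rfloor>. D n j \<omega>) - (\<Sum>j<nat \<lfloor>2 ^ n * s\<rfloor>. D n j \<omega>)
      = (\<Sum>j\<in>{nat \<lfloor>2 ^ n * s\<rfloor>..<nat \<lfloor>2 ^ n * t\<rfloor>}. D n j \<omega>)" for n
  proof -
    have "nat \<lfloor>2 ^ n * s\<rfloor> \<le> nat \<lfloor>2 ^ n * t\<rfloor>" using assms by (intro nat_mono floor_mono) auto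
    then show ?thesis unfolding lessThan_atLeast0 by (simp add: sum_diff_nat_ivl)
  qed
  ultimately show ?case by simp
qed

theorem wiener_process_W: "wiener_process M W"
  unfolding wiener_process_def
proof (intro conjI allI impI ballI)
  fix s t :: real assume st: "0 \<le> s \<and> s < t"
  define a where "a n u = nat \<lfloor>2 ^ n * u\<rfloor>" for n :: nat and u :: real
  show "distributed M lborel (\<lambda>\<omega>. W t \<omega> - W s \<omega>) (normal_density 0 (sqrt (t - s)))"
  proof (rule normal_limit[where X="\<lambda>n \<omega>. \<Sum>j\<in>{a n s..<a n t}. D n j \<omega>" and s="\<lambda>n. sqrt (real (a n t - a n s) / 2 ^ n)"])
    fix n assume "0 < sqrt (real (a n t - a n s) / 2 ^ n)"
    then have "a n s < a n t" by (simp add: zero_less_divide_iff)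
    then show "distributed M lborel (\<lambda>\<omega>. \<Sum>j\<in>{a n s..<a n t}. D n j \<omega>) (normal_density 0 (sqrt (real (a n t - a n s) / 2 ^ n)))"
      by (rule D_sum_normal)
  next
    have "(\<lambda>n. real (a n t - a n s) / 2 ^ n) \<longlonglongrightarrow> t - s"
    proof (rule tendsto_sandwich[of "\<lambda>n. (t - s) - (1/2) ^ n" _ _ "\<lambda>n. (t - s) + (1/2) ^ n"])
      \<comment> \<open>Rounding both end points down to the grid changes the length of the interval
        by at most one cell.\<close>
      have *: "real (a n t - a n s) \<le> 2 ^ n * (t - s) + 1 \<and> 2 ^ n * (t - s) - 1 \<le> real (a n t - a n s)" for n
      proof -
        have "a n s \<le> a n t" using st unfolding a_def by (intro nat_mono floor_mono) auto
        have b: "real (a n u) \<le> 2 ^ n * u" "2 ^ n * u - 1 \<le> real (a n u)" if "0 \<le> u" for u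
          using that by (auto simp: a_def)
        have "0 \<le> t" using st by simp
        show ?thesis using \<open>a n s \<le> a n t\<close> b[OF conjunct1[OF st]] b[OF \<open>0 \<le> t\<close>] by (simp add: of_nat_diff algebra_simps)
      qed
      show "\<forall>\<^sub>F n in sequentially. (t - s) - (1/2) ^ n \<le> real (a n t - a n s) / 2 ^ n"
      proof (rule always_eventually, rule allI)
        fix n show "(t - s) - (1/2) ^ n \<le> real (a n t - a n s) / 2 ^ n"
          using divide_right_mono[OF conjunct2[OF *[of n]], of "2 ^ n"] by (simp add: diff_divide_distrib power_divide)
      qed
      show "\<forall>\<^sub>F n in sequentially. real (a n t - a n s) / 2 ^ n \<le> (t - s) + (1/2) ^ n"
      proof (rule always_eventually, rule allI)
        fix n show "real (a n t - a n s) / 2 ^ n \<le> (t - s) + (1/2) ^ n"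
          using divide_right_mono[OF conjunct1[OF *[of n]], of "2 ^ n"] by (simp add: add_divide_distrib power_divide)
      qed
      have "(\<lambda>n. (t - s) - (1/2) ^ n) \<longlonglongrightarrow> (t - s) - 0" "(\<lambda>n. (t - s) + (1/2) ^ n) \<longlonglongrightarrow> (t - s) + 0"
        by (intro tendsto_intros LIMSEQ_realpow_zero; simp)+
      then show "(\<lambda>n. (t - s) - (1/2) ^ n) \<longlonglongrightarrow> t - s" "(\<lambda>n. (t - s) + (1/2) ^ n) \<longlonglongrightarrow> t - s" by simp_all
    qed
    then show "(\<lambda>n. sqrt (real (a n t - a n s) / 2 ^ n)) \<longlonglongrightarrow> sqrt (t - s)" by (rule tendsto_real_sqrt)
    show "AE \<omega> in M. (\<lambda>n. \<Sum>j\<in>{a n s..<a n t}. D n j \<omega>) \<longlonglongrightarrow> W t \<omega> - W s \<omega>"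
      unfolding a_def using st by (intro W_increment_limit) auto
  qed (use st in auto)
next
  fix m :: nat and \<tau> :: "nat \<Rightarrow> real" assume \<tau>: "0 \<le> \<tau> 0 \<and> mono \<tau>"
  have pos: "0 \<le> \<tau> i" "\<tau> i \<le> \<tau> (Suc i)" for i using \<tau> by (auto simp: mono_def intro: order_trans)
  show "indep_vars (\<lambda>_. borel) (\<lambda>i \<omega>. W (\<tau> (Suc i)) \<omega> - W (\<tau> i) \<omega>) {..<m}"
  proof (rule indep_vars_limit[where X="\<lambda>n i \<omega>. \<Sum>j\<in>{nat \<lfloor>2 ^ n * \<tau> i\<rfloor>..<nat \<lfloor>2 ^ n * \<tau> (Suc i)\<rfloor>}. D n j \<omega>"])
    fix n
    have "mono (\<lambda>i. nat \<lfloor>2 ^ n * \<tau> i\<rfloor>)" using \<tau> by (intro monoI nat_mono floor_mono) (auto simp: mono_def)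
    then show "indep_vars (\<lambda>_. borel) (\<lambda>i \<omega>. \<Sum>j\<in>{nat \<lfloor>2 ^ n * \<tau> i\<rfloor>..<nat \<lfloor>2 ^ n * \<tau> (Suc i)\<rfloor>}. D n j \<omega>) {..<m}"
      by (rule D_sums_indep)
  qed (use pos in \<open>auto intro!: W_increment_limit\<close>)
qed (auto intro: prob_space_axioms W_continuous simp: W_0)

end

section \<open>Modulus of continuity\<close>

lemma (in prob_space) normal_moments:
  assumes X: "distributed M lborel X (normal_density 0 \<sigma>)" and s: "0 < \<sigma>"
  shows "integrable M (\<lambda>\<omega>. X \<omega> ^ k)" "expectation X = 0" "expectation (\<lambda>\<omega>. X \<omega> ^ 2) = \<sigma> ^ 2"
    "expectation (\<lambda>\<omega>. X \<omega> ^ 4) = 3 * \<sigma> ^ 4"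
proof -
  show "integrable M (\<lambda>\<omega>. X \<omega> ^ k)"
    using distributed_integrable[OF X, of "\<lambda>x. x ^ k"] integrable_normal_moment[OF s, of 0 k] by simp
  show "expectation X = 0"
    using distributed_integral[OF X, of "\<lambda>x. x"] integral_normal_moment_nz_1[OF s, of 0] by simp
  show "expectation (\<lambda>\<omega>. X \<omega> ^ 2) = \<sigma> ^ 2"
    using distributed_integral[OF X, of "\<lambda>x. x ^ 2"] integral_normal_moment_even[OF s, of 0 1] s
    by (simp add: fact_numeral)
  show "expectation (\<lambda>\<omega>. X \<omega> ^ 4) = 3 * \<sigma> ^ 4"
    using distributed_integral[OF X, of "\<lambda>x. x ^ 4"] integral_normal_moment_even[OF s, of 0 2] s
    by (simp add: fact_numeral field_simps)
qed

locale wiener_space = prob_space M for M :: "'a measure" +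
  fixes W :: "real \<Rightarrow> 'a \<Rightarrow> real"
  assumes wiener: "wiener_process M W"
begin

lemma W_measurable: "0 \<le> t \<Longrightarrow> random_variable borel (W t)"
  and W_zero: "\<omega> \<in> space M \<Longrightarrow> W 0 \<omega> = 0"
  and W_continuous: "\<omega> \<in> space M \<Longrightarrow> continuous_on {0..} (\<lambda>t. W t \<omega>)"
  and W_normal: "0 \<le> s \<Longrightarrow> s < t \<Longrightarrow> distributed M lborel (\<lambda>\<omega>. W t \<omega> - W s \<omega>) (normal_density 0 (sqrt (t - s)))"
  and W_indep: "0 \<le> \<tau> 0 \<Longrightarrow> mono \<tau> \<Longrightarrow> indep_vars (\<lambda>_. borel) (\<lambda>i \<omega>. W (\<tau> (Suc i)) \<omega> - W (\<tau> i) \<omega>) {..<m}"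
  using wiener by (auto simp: wiener_process_def)

text \<open>The maximal inequality for the fourth power, with the fourth moment 3 L^2 of a normal
  variable of variance \<open>L\<close>. The power 4 matters later: summed over 1/\<delta> intervals
  of length \<delta>, a bound of order L^2 tends to 0 with \<delta>, while the second moment would
  only give a bound of order 1.\<close>

lemma sup_increment:
  assumes a: "0 \<le> a" and L: "0 < L" and x: "0 < x"
  shows "\<exists>B\<in>events. prob B \<le> 3 * L ^ 2 / x ^ 4 \<and> (\<forall>\<omega>\<in>space M - B. \<forall>s\<in>{a..a + L}. \<bar>W s \<omega> - W a \<omega>\<bar> \<le> x)"
proof -
  define \<tau> where "\<tau> r i = a + real i * L / 2 ^ r" for r i :: nat
  have \<tau>0: "0 \<le> \<tau> r i" "a \<le> \<tau> r i" for r i using a L by (auto simp: \<tau>_def)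
  have \<tau>m: "mono (\<tau> r)" for r using L by (auto simp: \<tau>_def intro!: monoI divide_right_mono mult_right_mono)
  note [measurable] = W_measurable[OF a] W_measurable[OF \<tau>0(1)]
  \<comment> \<open>Exceedances on the dyadic grid of level \<open>r\<close>. The grids are nested,
    so these events increase, and path continuity extends the bound from the grids to the whole
    interval. Their countable union is a measurable exceptional set.\<close>
  define B where "B r = {\<omega>\<in>space M. \<exists>j\<le>2 ^ r. x < \<bar>W (\<tau> r j) \<omega> - W a \<omega>\<bar>}" for r
  have [measurable]: "B r \<in> events" for r unfolding B_def by measurable
  have B_le: "prob (B r) \<le> 3 * L ^ 2 / x ^ 4" for r
  proof -
    let ?X = "\<lambda>i \<omega>. W (\<tau> r (Suc i)) \<omega> - W (\<tau> r i) \<omega>"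
    have S: "(\<Sum>i<j. ?X i \<omega>) = W (\<tau> r j) \<omega> - W a \<omega>" for j \<omega>
      by (subst sum_lessThan_telescope) (simp add: \<tau>_def)
    have n: "distributed M lborel (\<lambda>\<omega>. W (\<tau> r j) \<omega> - W a \<omega>) (normal_density 0 (sqrt (\<tau> r j - a)))" if "0 < j" for j
      using that L a by (intro W_normal) (auto simp: \<tau>_def)
    have pos: "0 < sqrt (\<tau> r j - a)" if "0 < j" for j using that L by (auto simp: \<tau>_def)
    have I: "integrable M (\<lambda>\<omega>. (W (\<tau> r j) \<omega> - W a \<omega>) ^ k)" for j k
    proof (cases "j = 0")
      case True then show ?thesis by (simp add: \<tau>_def)
    next
      case False then show ?thesis using normal_moments(1)[OF n pos] by simp
    qed
    have "prob {\<omega>\<in>space M. \<exists>j\<le>2 ^ r. x < \<bar>\<Sum>i<j. ?X i \<omega>\<bar>} \<le> expectation (\<lambda>\<omega>. (\<Sum>i<2 ^ r. ?X i \<omega>) ^ 4) / x ^ 4"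
    proof (rule maximal_inequality[where f="\<lambda>s. s ^ 4" and f'="\<lambda>s. 4 * s ^ 3"])
      show "indep_vars (\<lambda>_. borel) ?X {..<2 ^ r}" by (rule W_indep[OF \<tau>0(1) \<tau>m])
      show "integrable M (?X i)" for i
      proof -
        have "integrable M (\<lambda>\<omega>. (W (\<tau> r (Suc i)) \<omega> - W a \<omega>) ^ 1 - (W (\<tau> r i) \<omega> - W a \<omega>) ^ 1)"
          by (intro Bochner_Integration.integrable_diff I)
        then show ?thesis by simp
      qed
      show "expectation (?X i) = 0" for i
        using normal_moments(2)[OF W_normal[OF \<tau>0(1)[of r i], of "\<tau> r (Suc i)"]] L by (auto simp: \<tau>_def field_simps)
      show "s ^ 4 + 4 * s ^ 3 * t \<le> (s + t) ^ 4" for s t :: real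
      proof -
        have "(s + t) ^ 4 - (s ^ 4 + 4 * s ^ 3 * t) = t ^ 2 * (2 * s ^ 2 + (2 * s + t) ^ 2)"
          by algebra
        moreover have "0 \<le> t ^ 2 * (2 * s ^ 2 + (2 * s + t) ^ 2)" by simp
        ultimately show ?thesis by linarith
      qed
      show "x ^ 4 \<le> s ^ 4" if "x < \<bar>s\<bar>" for s
        using power_mono[of x "\<bar>s\<bar>" 4] that x by (simp add: power_even_abs)
      show "0 < x ^ 4" using x by simp
    qed (use I in \<open>auto simp: S intro!: integrable_mult_right\<close>)
    also have "expectation (\<lambda>\<omega>. (\<Sum>i<2 ^ r. ?X i \<omega>) ^ 4) = 3 * L ^ 2"
    proof -
      have "\<tau> r (2 ^ r) - a = L" by (simp add: \<tau>_def)
      moreover have "sqrt L ^ 4 = L ^ 2"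
      proof -
        have "sqrt L ^ 4 = (sqrt L ^ 2) ^ 2" by (simp only: power_mult[symmetric]) simp
        then show ?thesis using L by simp
      qed
      ultimately show ?thesis unfolding S using normal_moments(4)[OF n pos, of "2 ^ r"] by simp
    qed
    finally show ?thesis by (simp only: B_def S)
  qed
  have inc: "incseq B"
  proof (rule incseq_SucI, safe)
    fix r \<omega> assume "\<omega> \<in> B r"
    then obtain j where j: "\<omega> \<in> space M" "j \<le> 2 ^ r" "x < \<bar>W (\<tau> r j) \<omega> - W a \<omega>\<bar>" by (auto simp: B_def)
    have "\<tau> (Suc r) (2 * j) = \<tau> r j" by (simp add: \<tau>_def)
    then show "\<omega> \<in> B (Suc r)" using j by (auto simp: B_def intro!: exI[of _ "2 * j"])
  qed
  have "(\<lambda>r. prob (B r)) \<longlonglongrightarrow> prob (\<Union>r. B r)"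
    using inc by (intro finite_Lim_measure_incseq) auto
  then have le: "prob (\<Union>r. B r) \<le> 3 * L ^ 2 / x ^ 4"
    using B_le by (intro LIMSEQ_le_const2) auto
  have "\<bar>W s \<omega> - W a \<omega>\<bar> \<le> x" if w: "\<omega> \<in> space M - (\<Union>r. B r)" and s: "s \<in> {a..a + L}" for \<omega> s
  proof -
    define j where "j r = nat \<lfloor>(s - a) * 2 ^ r / L\<rfloor>" for r :: nat
    have j: "real (j r) \<le> (s - a) * 2 ^ r / L" "(s - a) * 2 ^ r / L - 1 \<le> real (j r)" for r
    proof -
      have "0 \<le> (s - a) * 2 ^ r / L" using s L by auto
      then show "real (j r) \<le> (s - a) * 2 ^ r / L" "(s - a) * 2 ^ r / L - 1 \<le> real (j r)"
        unfolding j_def by linarith+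
    qed
    have j2: "j r \<le> 2 ^ r" for r
    proof -
      have "(s - a) * 2 ^ r / L \<le> 2 ^ r" using s L by (simp add: divide_le_eq mult.commute)
      then have "real (j r) \<le> 2 ^ r" using j(1)[of r] by linarith
      then show ?thesis by (metis of_nat_le_iff of_nat_numeral of_nat_power)
    qed
    have up: "\<tau> r (j r) \<le> s" and lo: "s - L * (1/2) ^ r \<le> \<tau> r (j r)" for r
    proof -
      have "real (j r) * (L / 2 ^ r) \<le> (s - a) * 2 ^ r / L * (L / 2 ^ r)" using L j by (intro mult_right_mono) auto
      then show "\<tau> r (j r) \<le> s" using L by (simp add: \<tau>_def)
      have "((s - a) * 2 ^ r / L - 1) * (L / 2 ^ r) \<le> real (j r) * (L / 2 ^ r)" using L j by (intro mult_right_mono) auto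
      moreover have "((s - a) * 2 ^ r / L - 1) * (L / 2 ^ r) = (s - a) - L / 2 ^ r"
        using L by (subst left_diff_distrib) simp
      ultimately show "s - L * (1/2) ^ r \<le> \<tau> r (j r)" by (simp add: \<tau>_def power_divide)
    qed
    have "(\<lambda>r. \<tau> r (j r)) \<longlonglongrightarrow> s"
    proof (rule tendsto_sandwich[of "\<lambda>r. s - L * (1/2) ^ r" _ _ "\<lambda>_. s"])
      have "(\<lambda>r. s - L * (1/2) ^ r) \<longlonglongrightarrow> s - L * 0" by (intro tendsto_intros LIMSEQ_realpow_zero) auto
      then show "(\<lambda>r. s - L * (1/2) ^ r) \<longlonglongrightarrow> s" by simp
    qed (use up lo in auto)
    then have "(\<lambda>r. W (\<tau> r (j r)) \<omega>) \<longlonglongrightarrow> W s \<omega>"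
      using w s a \<tau>0(1) by (intro continuous_on_tendsto_compose[OF W_continuous]) auto
    then have "(\<lambda>r. \<bar>W (\<tau> r (j r)) \<omega> - W a \<omega>\<bar>) \<longlonglongrightarrow> \<bar>W s \<omega> - W a \<omega>\<bar>"
      by (intro tendsto_intros)
    moreover have "\<bar>W (\<tau> r (j r)) \<omega> - W a \<omega>\<bar> \<le> x" for r
      using w j2[of r] by (auto simp: B_def not_less)
    ultimately show ?thesis by (intro LIMSEQ_le_const2) auto
  qed
  then show ?thesis using le by (intro bexI[of _ "\<Union>r. B r"]) auto
qed

text \<open>Times of distance at most h = \<delta> n lie in a common window [k h, k h + 2 h] with k
  = floor(s/h). By Brownian scaling the resulting bound does not involve n, so one \<delta> serves
  for all n.\<close>

lemma modulus:
  assumes \<epsilon>: "0 < \<epsilon>" and C: "0 < C" and \<eta>: "0 < \<eta>"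
  shows "\<exists>\<delta>>0. \<forall>n\<ge>1::nat. \<exists>B\<in>events. prob B \<le> \<eta> \<and>
    (\<forall>\<omega>\<in>space M - B. \<forall>s t. 0 \<le> s \<and> s \<le> C * real n \<and> 0 \<le> t \<and> t \<le> C * real n \<and> \<bar>s - t\<bar> \<le> \<delta> * real n
       \<longrightarrow> \<bar>W s \<omega> - W t \<omega>\<bar> \<le> \<epsilon> * sqrt (real n))"
proof -
  \<comment> \<open>With windows of length 2 \<delta> n and x = \<epsilon> sqrt(n)/2, one window
    contributes 3 (2 \<delta> n)^2 / x^4 = 192 \<delta>^2 / \<epsilon>^4. At most C/\<delta> + 1
    windows are used, and \<open>\<delta> \<le> 1\<close> bounds the total by 192 \<delta> (C + 1) /
    \<epsilon>^4.\<close>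
  define \<delta> where "\<delta> = min 1 (\<eta> * \<epsilon> ^ 4 / (192 * (C + 1)))"
  have d: "0 < \<delta>" "\<delta> \<le> 1" "192 * (C + 1) * \<delta> \<le> \<eta> * \<epsilon> ^ 4"
  proof -
    show "0 < \<delta>" "\<delta> \<le> 1" using \<epsilon> C \<eta> by (auto simp: \<delta>_def)
    have "\<delta> \<le> \<eta> * \<epsilon> ^ 4 / (192 * (C + 1))" by (simp add: \<delta>_def)
    then show "192 * (C + 1) * \<delta> \<le> \<eta> * \<epsilon> ^ 4" using C by (simp add: le_divide_eq mult_ac)
  qed
  have "\<exists>B\<in>events. prob B \<le> \<eta> \<and>
    (\<forall>\<omega>\<in>space M - B. \<forall>s t. 0 \<le> s \<and> s \<le> C * real n \<and> 0 \<le> t \<and> t \<le> C * real n \<and> \<bar>s - t\<bar> \<le> \<delta> * real n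
       \<longrightarrow> \<bar>W s \<omega> - W t \<omega>\<bar> \<le> \<epsilon> * sqrt (real n))" if n: "1 \<le> n" for n :: nat
  proof -
    define h where "h = \<delta> * real n"
    have h: "0 < h" using d n by (simp add: h_def)
    define x where "x = \<epsilon> * sqrt (real n) / 2"
    have x: "0 < x" using \<epsilon> n by (simp add: x_def)
    have "\<forall>k::nat. \<exists>B\<in>events. prob B \<le> 3 * (2 * h) ^ 2 / x ^ 4 \<and> (\<forall>\<omega>\<in>space M - B. \<forall>s\<in>{real k * h..real k * h + 2 * h}. \<bar>W s \<omega> - W (real k * h) \<omega>\<bar> \<le> x)"
      using h x by (intro allI sup_increment) auto
    then obtain B where B: "\<And>k::nat. B k \<in> events" "\<And>k. prob (B k) \<le> 3 * (2 * h) ^ 2 / x ^ 4"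
      "\<And>k \<omega> s. \<omega> \<in> space M - B k \<Longrightarrow> s \<in> {real k * h..real k * h + 2 * h} \<Longrightarrow> \<bar>W s \<omega> - W (real k * h) \<omega>\<bar> \<le> x"
      by metis
    define K where "K = nat \<lfloor>C / \<delta>\<rfloor>"
    have K: "real K \<le> C / \<delta>" using C d by (simp add: K_def)
    have x4: "x ^ 4 = \<epsilon> ^ 4 * real n ^ 2 / 16"
    proof -
      have "sqrt (real n) ^ 4 = (sqrt (real n) ^ 2) ^ 2" by (simp only: power_mult[symmetric]) simp
      then show ?thesis by (simp add: x_def power_divide power_mult_distrib)
    qed
    have "prob (\<Union>k\<le>K. B k) \<le> (\<Sum>k\<le>K. prob (B k))" using B by (intro finite_measure_subadditive_finite) auto
    also have "\<dots> \<le> (\<Sum>k\<le>K. 3 * (2 * h) ^ 2 / x ^ 4)" by (intro sum_mono B)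
    also have "\<dots> = (real K + 1) * (192 * \<delta> ^ 2 / \<epsilon> ^ 4)"
      using n by (simp add: x4 h_def power_mult_distrib)
    also have "\<dots> \<le> (C / \<delta> + 1) * (192 * \<delta> ^ 2 / \<epsilon> ^ 4)" using K \<epsilon> by (intro mult_right_mono) auto
    also have "\<dots> = 192 * \<delta> * (C + \<delta>) / \<epsilon> ^ 4" using d \<epsilon> by (simp add: field_simps power2_eq_square)
    also have "\<dots> \<le> 192 * \<delta> * (C + 1) / \<epsilon> ^ 4" using d by (intro divide_right_mono mult_left_mono) auto
    also have "\<dots> \<le> \<eta>" using d(3) \<epsilon> by (simp add: divide_le_eq mult_ac)
    finally have pB: "prob (\<Union>k\<le>K. B k) \<le> \<eta>" .
    have main: "\<bar>W s \<omega> - W t \<omega>\<bar> \<le> \<epsilon> * sqrt (real n)"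
      if w: "\<omega> \<in> space M - (\<Union>k\<le>K. B k)" and st: "0 \<le> s" "s \<le> t" "t \<le> C * real n" "t - s \<le> h" for \<omega> s t
    proof -
      define k where "k = nat \<lfloor>s / h\<rfloor>"
      have "0 \<le> s / h" using st h by auto
      then have "real k \<le> s / h" "s / h \<le> real k + 1" unfolding k_def by linarith+
      then have k: "real k * h \<le> s" "s \<le> real k * h + h" using h by (auto simp: field_simps)
      have "s / h \<le> C / \<delta>" using st n d by (simp add: h_def field_simps)
      then have "k \<le> K" unfolding k_def K_def by (intro nat_mono floor_mono)
      then have w': "\<omega> \<in> space M - B k" using w by auto
      have "\<bar>W s \<omega> - W (real k * h) \<omega>\<bar> \<le> x" "\<bar>W t \<omega> - W (real k * h) \<omega>\<bar> \<le> x"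
        using k st h by (intro B(3)[OF w']; simp)+
      then show ?thesis unfolding x_def by linarith
    qed
    show ?thesis
    proof (intro bexI[of _ "\<Union>k\<le>K. B k"] conjI ballI allI impI pB)
      show "(\<Union>k\<le>K. B k) \<in> events" using B by auto
      fix \<omega> s t assume "\<omega> \<in> space M - (\<Union>k\<le>K. B k)"
        and "0 \<le> s \<and> s \<le> C * real n \<and> 0 \<le> t \<and> t \<le> C * real n \<and> \<bar>s - t\<bar> \<le> \<delta> * real n"
      then show "\<bar>W s \<omega> - W t \<omega>\<bar> \<le> \<epsilon> * sqrt (real n)"
        using main[of \<omega> s t] main[of \<omega> t s] by (cases "s \<le> t") (auto simp: h_def)
    qed
  qed
  then show ?thesis using d(1) by blast
qed

end

section \<open>Quantile coupling\<close>

abbreviation Phi :: "real \<Rightarrow> real" where "Phi \<equiv> cdf std_normal_distribution"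

interpretation std_normal: real_distribution std_normal_distribution
  by (rule real_dist_normal_dist)

lemma std_normal_singleton: "measure std_normal_distribution {x} = 0"
proof -
  have "emeasure std_normal_distribution {x} = (\<integral>\<^sup>+y. ennreal (std_normal_density y) * indicator {x} y \<partial>lborel)"
    by (rule emeasure_density) auto
  also have "\<dots> = 0" by (subst nn_integral_indicator_singleton) auto
  finally have "{x} \<in> null_sets std_normal_distribution" by (simp add: null_sets_def)
  then show ?thesis by (simp add: measure_eq_0_null_sets)
qed

lemma isCont_Phi: "isCont Phi x"
  by (simp add: std_normal.isCont_cdf std_normal_singleton)

lemma Phi_strict_mono: assumes "x < y" shows "Phi x < Phi y"
proof -
  have "measure std_normal_distribution {x<..y} \<noteq> 0"
  proof
    assume "measure std_normal_distribution {x<..y} = 0"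
    then have "{x<..y} \<in> null_sets std_normal_distribution"
      by (simp add: null_sets_def std_normal.emeasure_eq_measure)
    then have "AE z in lborel. z \<in> {x<..y} \<longrightarrow> ennreal (std_normal_density z) = 0"
      by (subst (asm) null_sets_density_iff) auto
    then have "AE z in lborel. z \<notin> {x<..y}"
      by eventually_elim (metis ennreal_eq_0_iff normal_density_pos not_le zero_less_one)
    then have "{x<..y} \<in> null_sets lborel" by (simp add: AE_iff_null_sets)
    then show False using assms by (simp add: null_sets_def)
  qed
  then have "0 < measure std_normal_distribution {x<..y}" by (simp add: zero_less_measure_iff)
  then show ?thesis using std_normal.cdf_diff_eq[OF assms] by simp
qed

lemma Phi_less_1: "Phi x < 1"
  using Phi_strict_mono[of x "x + 1"] std_normal.cdf_bounded_prob[of "x + 1"] by simp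

lemma Phi_less_iff: "Phi x < Phi y \<longleftrightarrow> x < y"
  using Phi_strict_mono by (metis linorder_neqE_linordered_idom order_less_asym)

lemma borel_measurable_Phi[measurable]: "Phi \<in> borel_measurable borel"
  using isCont_Phi by (intro borel_measurable_continuous_onI continuous_at_imp_continuous_on) auto

text \<open>A standard normal variable inserted into its own distribution function is uniform: by
  continuity an interior level \<open>c\<close> is attained at some x, and the event is the
  half-line below x. The levels 0 and 1 are treated apart because \<open>Phi\<close> never attains
  them.\<close>

lemma measure_Phi_less:
  assumes "0 \<le> c" "c \<le> 1" shows "measure std_normal_distribution {x. Phi x < c} = c"
proof -
  consider "c = 0" | "c = 1" | "0 < c" "c < 1" using assms by linarith
  then show ?thesis
  proof cases
    case 1
    then have "{x. Phi x < c} = {}" using std_normal.cdf_nonneg by (auto simp: not_less)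
    then show ?thesis using 1 by simp
  next
    case 2
    then have "{x. Phi x < c} = UNIV" using Phi_less_1 by auto
    then show ?thesis using 2 std_normal.prob_space by simp
  next
    case 3
    obtain a where a: "Phi a < c"
      using order_tendstoD(2)[OF std_normal.cdf_lim_at_bot 3(1)] by (auto simp: eventually_at_bot_linorder)
    obtain b where b: "c < Phi b"
      using order_tendstoD(1)[OF std_normal.cdf_lim_at_top_prob 3(2)] by (auto simp: eventually_at_top_linorder)
    have "a \<le> b" using a b std_normal.cdf_nondecreasing[of b a] by linarith
    then obtain x where x: "Phi x = c"
      using IVT[of Phi a c b] a b isCont_Phi by auto
    have "{y. Phi y < c} = {..<x}" using Phi_less_iff[of _ x] x by auto
    also have "measure std_normal_distribution {..<x} = measure std_normal_distribution ({..x} - {x})"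
      by (intro arg_cong[where f="measure _"]) auto
    also have "\<dots> = Phi x"
      by (subst std_normal.finite_measure_Diff) (auto simp: cdf_def std_normal_singleton)
    finally show ?thesis using x by simp
  qed
qed

section \<open>Sign lists ordered by their sum\<close>

definition sign_lists :: "nat \<Rightarrow> int list set" where
  "sign_lists L = {xs. length xs = L \<and> set xs \<subseteq> {1, - 1}}"

definition sorted_signs :: "nat \<Rightarrow> int list list" where
  "sorted_signs L = sort_key sum_list (List.n_lists L [1, - 1])"

text \<open>The sign list attached to a level \<open>u \<in> [0,1)\<close>; as the lists are sorted by their sum, the sum of
  this list is the \<open>u\<close>-quantile of the simple random walk at time \<open>L\<close>.\<close>

definition quantile_signs :: "nat \<Rightarrow> real \<Rightarrow> int list" where
  "quantile_signs L u = sorted_signs L ! nat \<lfloor>2 ^ L * u\<rfloor>"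

lemma set_sorted_signs: "set (sorted_signs L) = sign_lists L"
  by (auto simp: sorted_signs_def sign_lists_def set_n_lists)

lemma length_sorted_signs: "length (sorted_signs L) = 2 ^ L"
  by (simp add: sorted_signs_def length_n_lists numeral_2_eq_2)

lemma distinct_sorted_signs: "distinct (sorted_signs L)"
  by (simp add: sorted_signs_def distinct_n_lists)

lemma sorted_sorted_signs: "i \<le> j \<Longrightarrow> j < 2 ^ L \<Longrightarrow> sum_list (sorted_signs L ! i) \<le> sum_list (sorted_signs L ! j)"
  using sorted_nth_mono[of "map sum_list (sorted_signs L)" i j]
  by (simp add: sorted_signs_def length_n_lists numeral_2_eq_2 flip: length_sorted_signs)

lemma finite_sign_lists: "finite (sign_lists L)"
  by (simp flip: set_sorted_signs)

lemma card_sign_lists: "card (sign_lists L) = 2 ^ L"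
  using distinct_card[OF distinct_sorted_signs] by (simp add: set_sorted_signs length_sorted_signs)

lemma level_index: 
  assumes "0 \<le> u" "u < 1" shows "nat \<lfloor>2 ^ L * u\<rfloor> < 2 ^ L"
proof -
  have "2 ^ L * u < 2 ^ L" using assms by simp
  then have "\<lfloor>2 ^ L * u\<rfloor> < 2 ^ L" by (metis floor_less_iff of_int_numeral of_int_power)
  then show ?thesis using assms by (simp add: nat_less_iff)
qed

lemma quantile_signs_in: "quantile_signs L (Phi x) \<in> sign_lists L"
proof -
  have "nat \<lfloor>2 ^ L * Phi x\<rfloor> < length (sorted_signs L)"
    using level_index[of "Phi x" L] std_normal.cdf_nonneg Phi_less_1 by (simp add: length_sorted_signs)
  then show ?thesis unfolding quantile_signs_def set_sorted_signs[symmetric] by (rule nth_mem)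
qed

lemma measurable_quantile_signs[measurable]: "(\<lambda>x. quantile_signs L (Phi x)) \<in> measurable borel (count_space UNIV)"
  unfolding quantile_signs_def by measurable

text \<open>The i-th sorted list belongs to the levels in [i/2^L, (i + 1)/2^L), a cell of mass 2^-L.
  Each list has a cell of its own, also among lists with equal sums, so the whole list, and not just
  its sum, is distributed as independent fair signs.\<close>

lemma measure_quantile_signs:
  assumes "xs \<in> sign_lists L"
  shows "measure std_normal_distribution {x. quantile_signs L (Phi x) = xs} = 1 / 2 ^ L"
proof -
  obtain i where i: "i < 2 ^ L" "sorted_signs L ! i = xs"
    using assms unfolding set_sorted_signs[symmetric] in_set_conv_nth length_sorted_signs by auto
  have "quantile_signs L (Phi x) = xs \<longleftrightarrow> \<not> Phi x < real i / 2 ^ L \<and> Phi x < (real i + 1) / 2 ^ L" for x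
  proof -
    have "nat \<lfloor>2 ^ L * Phi x\<rfloor> < 2 ^ L" by (intro level_index std_normal.cdf_nonneg Phi_less_1)
    then have "quantile_signs L (Phi x) = xs \<longleftrightarrow> nat \<lfloor>2 ^ L * Phi x\<rfloor> = i"
      unfolding quantile_signs_def using i nth_eq_iff_index_eq[OF distinct_sorted_signs[of L]] by (auto simp: length_sorted_signs)
    also have "\<dots> \<longleftrightarrow> \<lfloor>2 ^ L * Phi x\<rfloor> = int i" using std_normal.cdf_nonneg[of x] by auto
    also have "\<dots> \<longleftrightarrow> real i \<le> 2 ^ L * Phi x \<and> 2 ^ L * Phi x < real i + 1" by (simp add: floor_eq_iff)
    also have "\<dots> \<longleftrightarrow> \<not> Phi x < real i / 2 ^ L \<and> Phi x < (real i + 1) / 2 ^ L" by (auto simp: field_simps not_less)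
    finally show ?thesis .
  qed
  then have "{x. quantile_signs L (Phi x) = xs} = {x. Phi x < (real i + 1) / 2 ^ L} - {x. Phi x < real i / 2 ^ L}"
    by auto
  also have "measure std_normal_distribution \<dots> = (real i + 1) / 2 ^ L - real i / 2 ^ L"
  proof -
    have "real i + 1 \<le> 2 ^ L" using i(1) by (metis Suc_leI of_nat_Suc of_nat_le_iff of_nat_numeral of_nat_power add.commute)
    moreover from this have "real i \<le> 2 ^ L" by linarith
    ultimately have "(real i + 1) / 2 ^ L \<le> 1" "real i / 2 ^ L \<le> 1" by simp_all
    moreover have "{x. Phi x < c} \<in> sets std_normal_distribution" for c by simp
    moreover have "{x. Phi x < real i / 2 ^ L} \<subseteq> {x. Phi x < (real i + 1) / 2 ^ L}"
      by (auto elim!: order.strict_trans2 intro!: divide_right_mono)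
    ultimately show ?thesis
      by (subst std_normal.finite_measure_Diff) (auto simp: measure_Phi_less)
  qed
  also have "\<dots> = 1 / 2 ^ L" by (simp add: diff_divide_distrib[symmetric])
  finally show ?thesis .
qed

lemma sign_lists_Suc: "sign_lists (Suc L) = (\<lambda>(s, xs). s # xs) ` ({1, - 1} \<times> sign_lists L)"
  by (auto simp: sign_lists_def image_iff length_Suc_conv)

lemma sum_sign_lists_Suc:
  fixes f :: "int list \<Rightarrow> 'b::comm_monoid_add"
  shows "(\<Sum>xs\<in>sign_lists (Suc L). f xs) = (\<Sum>xs\<in>sign_lists L. f (1 # xs)) + (\<Sum>xs\<in>sign_lists L. f (- 1 # xs))"
proof -
  have "(\<Sum>xs\<in>sign_lists (Suc L). f xs) = (\<Sum>p\<in>{1, - 1} \<times> sign_lists L. f (fst p # snd p))"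
    unfolding sign_lists_Suc by (subst sum.reindex) (auto simp: inj_on_def case_prod_beta)
  also have "\<dots> = (\<Sum>s\<in>{1, - 1}. \<Sum>xs\<in>sign_lists L. f (s # xs))"
    by (simp add: sum.cartesian_product case_prod_beta)
  finally show ?thesis by simp
qed

lemma sign_lists_0: "sign_lists 0 = {[]}" by (auto simp: sign_lists_def)

lemma sum_sign_lists_mean: "(\<Sum>xs\<in>sign_lists L. real_of_int (sum_list xs)) = 0"
  by (induction L) (simp_all add: sum_sign_lists_Suc sign_lists_0 sum.distrib sum_subtractf)

lemma sum_sign_lists_square: "(\<Sum>xs\<in>sign_lists L. (real_of_int (sum_list xs))\<^sup>2) = real L * 2 ^ L"
proof (induction L)
  case (Suc L)
  have "(\<Sum>xs\<in>sign_lists (Suc L). (real_of_int (sum_list xs))\<^sup>2)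
     = (\<Sum>xs\<in>sign_lists L. (1 + real_of_int (sum_list xs))\<^sup>2 + (- 1 + real_of_int (sum_list xs))\<^sup>2)"
    by (simp add: sum_sign_lists_Suc sum.distrib)
  also have "\<dots> = (\<Sum>xs\<in>sign_lists L. 2 * (real_of_int (sum_list xs))\<^sup>2 + 2)"
    by (intro sum.cong) (auto simp: power2_eq_square algebra_simps)
  also have "\<dots> = real (Suc L) * 2 ^ Suc L"
    using Suc by (simp add: sum.distrib sum_distrib_left[symmetric] card_sign_lists algebra_simps)
  finally show ?case .
qed (simp add: sign_lists_0)

section \<open>Central limit theorem for sums of fair signs\<close>

lemma sum_sign_lists_iexp:
  "(\<Sum>xs\<in>sign_lists L. iexp (\<theta> * real_of_int (sum_list xs))) = (2 * cos (of_real \<theta>)) ^ L"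
proof (induction L)
  case (Suc L)
  have "(\<Sum>xs\<in>sign_lists (Suc L). iexp (\<theta> * real_of_int (sum_list xs)))
     = (\<Sum>xs\<in>sign_lists L. iexp \<theta> * iexp (\<theta> * real_of_int (sum_list xs))) + (\<Sum>xs\<in>sign_lists L. iexp (- \<theta>) * iexp (\<theta> * real_of_int (sum_list xs)))"
    by (simp add: sum_sign_lists_Suc ring_distribs exp_add exp_diff exp_minus divide_inverse mult_ac)
  also have "\<dots> = (iexp \<theta> + iexp (- \<theta>)) * (2 * cos (of_real \<theta>)) ^ L"
    using Suc by (simp add: sum_distrib_left[symmetric] ring_distribs)
  also have "iexp \<theta> + iexp (- \<theta>) = 2 * cos (of_real \<theta>)"
    by (simp add: cos_exp_eq)
  finally show ?case by simp
qed (simp add: sign_lists_0)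

lemma cos_quadratic_approx: fixes x :: real shows "\<bar>cos x - (1 - x\<^sup>2 / 2)\<bar> \<le> \<bar>x\<bar> ^ 3 / 6"
proof -
  obtain t where t: "cos x = (\<Sum>m<3. cos_coeff m * x ^ m) + cos (t + 1 / 2 * real 3 * pi) / fact 3 * x ^ 3"
    using Maclaurin_cos_expansion[of x 3] by blast
  have "cos x - (1 - x\<^sup>2 / 2) = cos (t + 1 / 2 * real 3 * pi) / fact 3 * x ^ 3"
    using t by (simp add: numeral_3_eq_3 cos_coeff_def power2_eq_square)
  also have "\<bar>\<dots>\<bar> = \<bar>cos (t + 1 / 2 * real 3 * pi)\<bar> * (\<bar>x\<bar> ^ 3 / 6)"
    by (simp add: abs_mult power_abs fact_numeral)
  also have "\<dots> \<le> 1 * (\<bar>x\<bar> ^ 3 / 6)" by (intro mult_right_mono) auto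
  finally show ?thesis by simp
qed

text \<open>The comparison is with (1 - t^2/(2n))^n. The n-th powers of two numbers of modulus at
  most 1 differ by at most n times the difference of the bases, which is of order n^(-3/2)
  here.\<close>

lemma cos_power_tendsto: "(\<lambda>n. cos (t / sqrt (real n)) ^ n) \<longlonglongrightarrow> exp (- (t\<^sup>2) / 2)"
proof -
  let ?w = "\<lambda>n. 1 + (- (t\<^sup>2) / 2) / real n"
  have "(\<lambda>n. cos (t / sqrt (real n)) ^ n - ?w n ^ n) \<longlonglongrightarrow> 0"
  proof (rule Lim_null_comparison)
    \<comment> \<open>This makes t^2/(2n) at most 2 for n beyond \<open>N\<close>, so that the base
      \<open>?w n\<close> has modulus at most 1.\<close>
    obtain N :: nat where N: "t\<^sup>2 / 4 \<le> real N" using real_arch_simple by blast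
    show "\<forall>\<^sub>F n in sequentially. norm (cos (t / sqrt (real n)) ^ n - ?w n ^ n) \<le> \<bar>t\<bar> ^ 3 / 6 * (1 / sqrt (real n))"
      using eventually_ge_at_top[of "max N 1"]
    proof eventually_elim
      case (elim n)
      then have n: "0 < real n" "t\<^sup>2 / 4 \<le> real n" using N by (auto intro: order_trans)
      have "t\<^sup>2 / 2 / real n \<le> 2" using n by (simp add: divide_le_eq)
      moreover have "0 \<le> t\<^sup>2 / 2 / real n" by simp
      ultimately have "\<bar>?w n\<bar> \<le> 1" by (simp add: abs_le_iff)
      then have "norm (cos (t / sqrt (real n)) ^ n - ?w n ^ n) \<le> real n * norm (cos (t / sqrt (real n)) - ?w n)"
        by (intro norm_power_diff) auto
      also have "\<dots> \<le> real n * (\<bar>t / sqrt (real n)\<bar> ^ 3 / 6)"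
        using cos_quadratic_approx[of "t / sqrt (real n)"] n by (intro mult_left_mono) (auto simp: power_divide)
      also have "\<dots> = \<bar>t\<bar> ^ 3 / 6 * (1 / sqrt (real n))"
      proof -
        have "sqrt (real n) ^ 3 = real n * sqrt (real n)" by (simp add: power3_eq_cube)
        then show ?thesis using n by (simp add: abs_divide power_divide)
      qed
      finally show ?case .
    qed
    have "(\<lambda>n. 1 / sqrt (real n)) \<longlonglongrightarrow> 0"
      by (intro tendsto_divide_0[OF tendsto_const] filterlim_at_top_imp_at_infinity
          filterlim_compose[OF sqrt_at_top filterlim_real_sequentially])
    then show "(\<lambda>n. \<bar>t\<bar> ^ 3 / 6 * (1 / sqrt (real n))) \<longlonglongrightarrow> 0" by (rule tendsto_mult_right_zero)
  qed
  moreover have "(\<lambda>n. ?w n ^ n) \<longlonglongrightarrow> exp (- (t\<^sup>2) / 2)" by (rule tendsto_exp_limit_sequentially)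
  ultimately show ?thesis using tendsto_add by fastforce
qed

definition walk_law :: "nat \<Rightarrow> real measure" where
  "walk_law L = distr (measure_pmf (pmf_of_set (sign_lists L))) borel (\<lambda>xs. real_of_int (sum_list xs) / sqrt (real L))"

lemma sign_lists_nonempty: "sign_lists L \<noteq> {}"
  using card_sign_lists[of L] by (metis card.empty power_eq_0_iff zero_neq_numeral)

lemma walk_law_distribution: "real_distribution (walk_law L)"
  unfolding walk_law_def by (rule prob_space.real_distribution_distr[OF measure_pmf.prob_space_axioms]) simp

lemma char_walk_law: "char (walk_law L) t = of_real (cos (t / sqrt (real L)) ^ L)"
proof -
  have "char (walk_law L) t = (CLINT xs|measure_pmf (pmf_of_set (sign_lists L)). iexp (t * (real_of_int (sum_list xs) / sqrt (real L))))"
    unfolding char_def walk_law_def by (subst integral_distr) auto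
  also have "\<dots> = (\<Sum>xs\<in>sign_lists L. (1 / 2 ^ L) *\<^sub>R iexp (t * (real_of_int (sum_list xs) / sqrt (real L))))"
    by (subst integral_measure_pmf[where A="sign_lists L"])
       (auto simp: finite_sign_lists sign_lists_nonempty pmf_of_set card_sign_lists)
  also have "\<dots> = (1 / 2 ^ L) *\<^sub>R (\<Sum>xs\<in>sign_lists L. iexp (t / sqrt (real L) * real_of_int (sum_list xs)))"
    by (simp add: scaleR_sum_right)
  also have "\<dots> = of_real (cos (t / sqrt (real L)) ^ L)"
    unfolding sum_sign_lists_iexp cos_of_real by (simp add: scaleR_conv_of_real power_mult_distrib)
  finally show ?thesis .
qed

lemma walk_law_weak_conv: "weak_conv_m walk_law std_normal_distribution"
proof (rule levy_continuity[OF walk_law_distribution real_dist_normal_dist])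
  fix t
  show "(\<lambda>n. char (walk_law n) t) \<longlonglongrightarrow> char std_normal_distribution t"
    unfolding char_walk_law char_std_normal_distribution
    using tendsto_of_real[OF cos_power_tendsto[of t]] by simp
qed

lemma cdf_walk_law: "cdf (walk_law L) y = real (card {xs\<in>sign_lists L. real_of_int (sum_list xs) / sqrt (real L) \<le> y}) / 2 ^ L"
proof -
  have "cdf (walk_law L) y = measure_pmf.prob (pmf_of_set (sign_lists L)) {xs. real_of_int (sum_list xs) / sqrt (real L) \<le> y}"
    unfolding cdf_def walk_law_def by (subst measure_distr) (auto simp: vimage_def)
  also have "\<dots> = real (card (sign_lists L \<inter> {xs. real_of_int (sum_list xs) / sqrt (real L) \<le> y})) / 2 ^ L"
    by (subst measure_pmf_of_set) (auto simp: finite_sign_lists sign_lists_nonempty card_sign_lists)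
  finally show ?thesis by (simp add: Int_def)
qed

section \<open>Convergence of the quantile transform\<close>

definition walk_quantile :: "nat \<Rightarrow> real \<Rightarrow> real" where
  "walk_quantile L x = real_of_int (sum_list (quantile_signs L (Phi x))) / sqrt (real L)"

lemma measurable_walk_quantile[measurable]: "walk_quantile L \<in> borel_measurable borel"
proof -
  have "(\<lambda>xs. real_of_int (sum_list xs) / sqrt (real L)) \<in> measurable (count_space UNIV) borel" by simp
  from measurable_compose[OF measurable_quantile_signs this] show ?thesis
    unfolding walk_quantile_def[abs_def] .
qed

text \<open>The usual duality between quantiles and distribution function. Because of the sorting,
  the lists with normalised sum at most \<open>y\<close> occupy an initial segment of the indices,
  of size 2^L times the distribution function at \<open>y\<close>; the index chosen by
  \<open>x\<close> lies in it exactly if \<open>Phi x\<close> lies below that value.\<close>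

lemma walk_quantile_le_iff: "walk_quantile L x \<le> y \<longleftrightarrow> Phi x < cdf (walk_law L) y"
proof -
  let ?f = "\<lambda>xs. real_of_int (sum_list xs) / sqrt (real L)"
  let ?A = "{xs\<in>sign_lists L. ?f xs \<le> y}"
  let ?I = "{i. i < 2 ^ L \<and> ?f (sorted_signs L ! i) \<le> y}"
  have "card ?A = card ?I"
  proof (rule bij_betw_same_card[symmetric])
    have "inj_on ((!) (sorted_signs L)) {i. i < 2 ^ L}"
      using distinct_sorted_signs[of L] by (auto simp: inj_on_def nth_eq_iff_index_eq length_sorted_signs)
    then show "bij_betw ((!) (sorted_signs L)) ?I ?A"
      unfolding bij_betw_def set_sorted_signs[symmetric] 
      by (auto simp: in_set_conv_nth length_sorted_signs inj_on_def image_iff)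
  qed
  \<comment> \<open>A finite downward closed set of naturals is determined by its
    cardinality.\<close>
  moreover have "?I = {..<card ?I}"
  proof -
    have "j \<in> ?I" if "i \<in> ?I" "j \<le> i" for i j
    proof -
      have "sum_list (sorted_signs L ! j) \<le> sum_list (sorted_signs L ! i)" using that by (intro sorted_sorted_signs) auto
      then have "?f (sorted_signs L ! j) \<le> ?f (sorted_signs L ! i)" by (intro divide_right_mono) auto
      then show ?thesis using that by auto
    qed
    moreover have "finite ?I" by (rule finite_subset[of _ "{..<2 ^ L}"]) auto
    ultimately show ?thesis
    proof -
      assume down: "\<And>i j. i \<in> ?I \<Longrightarrow> j \<le> i \<Longrightarrow> j \<in> ?I" and fin: "finite ?I"
      define m where "m = (LEAST i. i \<notin> ?I)"
      have ex: "\<exists>i. i \<notin> ?I" using fin by (meson UNIV_I ex_new_if_finite infinite_UNIV_nat)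
      have "m \<notin> ?I" unfolding m_def using ex by (rule LeastI_ex)
      moreover have "i \<in> ?I" if "i < m" for i using not_less_Least[of i "\<lambda>i. i \<notin> ?I"] that unfolding m_def by blast
      ultimately have "?I = {..<m}" using down by (metis (no_types, lifting) lessThan_iff not_less set_eqI)
      then show ?thesis by (metis card_lessThan)
    qed
  qed
  moreover define i where "i = nat \<lfloor>2 ^ L * Phi x\<rfloor>"
  have i: "i < 2 ^ L" unfolding i_def by (intro level_index std_normal.cdf_nonneg Phi_less_1)
  have "walk_quantile L x \<le> y \<longleftrightarrow> i \<in> ?I"
    using i by (simp add: walk_quantile_def quantile_signs_def i_def)
  moreover have "i < c \<longleftrightarrow> Phi x < real c / 2 ^ L" for c
  proof -
    have "i < c \<longleftrightarrow> \<lfloor>2 ^ L * Phi x\<rfloor> < int c" using std_normal.cdf_nonneg[of x] by (simp add: i_def nat_less_iff)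
    also have "\<dots> \<longleftrightarrow> 2 ^ L * Phi x < real c" by (simp add: floor_less_iff)
    finally show ?thesis by (simp add: field_simps)
  qed
  ultimately show ?thesis unfolding cdf_walk_law by (metis (no_types, lifting) lessThan_iff)
qed

text \<open>Weak convergence gives convergence of the distribution functions at every point, as
  \<open>Phi\<close> is continuous. Strict monotonicity of \<open>Phi\<close> separates the levels
  on both sides of \<open>x\<close>, and the duality turns this into pointwise convergence of the
  quantiles.\<close>

lemma walk_quantile_tendsto: "(\<lambda>L. walk_quantile L x) \<longlonglongrightarrow> x"
proof (rule order_tendstoI)
  have conv: "(\<lambda>L. cdf (walk_law L) y) \<longlonglongrightarrow> Phi y" for y
    using walk_law_weak_conv isCont_Phi by (auto simp: weak_conv_m_def weak_conv_def)
  fix y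
  show "\<forall>\<^sub>F L in sequentially. walk_quantile L x < y" if "x < y"
  proof -
    obtain z where z: "x < z" "z < y" using dense[OF \<open>x < y\<close>] by blast
    have "\<forall>\<^sub>F L in sequentially. Phi x < cdf (walk_law L) z"
      by (rule order_tendstoD(1)[OF conv Phi_strict_mono[OF z(1)]])
    then show ?thesis by eventually_elim (use z walk_quantile_le_iff in \<open>meson le_less_trans\<close>)
  qed
  show "\<forall>\<^sub>F L in sequentially. y < walk_quantile L x" if "y < x"
  proof -
    have "\<forall>\<^sub>F L in sequentially. cdf (walk_law L) y < Phi x"
      by (rule order_tendstoD(2)[OF conv Phi_strict_mono[OF that]])
    then show ?thesis by eventually_elim (use walk_quantile_le_iff in \<open>meson not_le order.asym\<close>)
  qed
qed

lemma integral_quantile_signs: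
  fixes f :: "int list \<Rightarrow> real"
  shows "integrable std_normal_distribution (\<lambda>x. f (quantile_signs L (Phi x)))"
    and "(\<integral>x. f (quantile_signs L (Phi x)) \<partial>std_normal_distribution) = (\<Sum>xs\<in>sign_lists L. f xs) / 2 ^ L"
proof -
  have eq: "f (quantile_signs L (Phi x)) = (\<Sum>xs\<in>sign_lists L. f xs * indicator {x. quantile_signs L (Phi x) = xs} x)" for x
    using quantile_signs_in[of L x] finite_sign_lists[of L]
    by (simp add: indicator_def if_distrib[of "\<lambda>c. _ * c"] sum.delta cong: if_cong)
  have m: "{x. quantile_signs L (Phi x) = xs} \<in> sets std_normal_distribution" for xs
    using measurable_sets[OF measurable_quantile_signs, of "{xs}" L] by (simp add: vimage_def)
  have i: "integrable std_normal_distribution (\<lambda>x. f xs * indicator {x. quantile_signs L (Phi x) = xs} x)" for xs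
    using m by (intro integrable_mult_right integrable_real_indicator) (auto simp: std_normal.emeasure_eq_measure)
  show "integrable std_normal_distribution (\<lambda>x. f (quantile_signs L (Phi x)))"
    unfolding eq using i by (rule Bochner_Integration.integrable_sum)
  show "(\<integral>x. f (quantile_signs L (Phi x)) \<partial>std_normal_distribution) = (\<Sum>xs\<in>sign_lists L. f xs) / 2 ^ L"
    unfolding eq
    by (subst Bochner_Integration.integral_sum[OF i])
       (simp add: measure_quantile_signs m sum_divide_distrib)
qed

lemma walk_quantile_moments:
  assumes "0 < L"
  shows "integrable std_normal_distribution (walk_quantile L)" "integrable std_normal_distribution (\<lambda>x. (walk_quantile L x)\<^sup>2)"
    "(\<integral>x. walk_quantile L x \<partial>std_normal_distribution) = 0" "(\<integral>x. (walk_quantile L x)\<^sup>2 \<partial>std_normal_distribution) = 1"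
proof -
  let ?f = "\<lambda>xs. real_of_int (sum_list xs) / sqrt (real L)"
  have "(\<Sum>xs\<in>sign_lists L. ?f xs) = 0" using sum_sign_lists_mean[of L] by (simp add: sum_divide_distrib[symmetric])
  moreover have "(\<Sum>xs\<in>sign_lists L. (?f xs)\<^sup>2) = 2 ^ L"
    using sum_sign_lists_square[of L] assms by (simp add: power_divide sum_divide_distrib[symmetric])
  ultimately show "integrable std_normal_distribution (walk_quantile L)" "integrable std_normal_distribution (\<lambda>x. (walk_quantile L x)\<^sup>2)"
    "(\<integral>x. walk_quantile L x \<partial>std_normal_distribution) = 0" "(\<integral>x. (walk_quantile L x)\<^sup>2 \<partial>std_normal_distribution) = 1"
    unfolding walk_quantile_def[abs_def]
    using integral_quantile_signs[of ?f L] integral_quantile_signs[of "\<lambda>xs. (?f xs)\<^sup>2" L] by simp_all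
qed

definition coupling_error :: "nat \<Rightarrow> real" where
  "coupling_error L = (\<integral>x. (walk_quantile L x - x)\<^sup>2 \<partial>std_normal_distribution)"

lemma std_normal_square: "integrable std_normal_distribution (\<lambda>x. x\<^sup>2)" "(\<integral>x. x\<^sup>2 \<partial>std_normal_distribution) = 1"
  using integrable_std_normal_distribution_moment[of 2] std_normal_distribution_even_moments(1)[of 1] by simp_all

lemma walk_quantile_products:
  assumes "0 < L"
  shows "integrable std_normal_distribution (\<lambda>x. (walk_quantile L x - x)\<^sup>2)" "integrable std_normal_distribution (\<lambda>x. (walk_quantile L x + x)\<^sup>2)"
proof -
  have b: "integrable std_normal_distribution (\<lambda>x. 2 * (walk_quantile L x)\<^sup>2 + 2 * x\<^sup>2)"
    using walk_quantile_moments[OF assms] std_normal_square by (intro Bochner_Integration.integrable_add integrable_mult_right)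
  have "(a - b)\<^sup>2 \<le> 2 * a\<^sup>2 + 2 * b\<^sup>2" "(a + b)\<^sup>2 \<le> 2 * a\<^sup>2 + 2 * b\<^sup>2" for a b :: real
    using zero_le_power2[of "a + b"] zero_le_power2[of "a - b"] by (auto simp: power2_eq_square algebra_simps)
  then show "integrable std_normal_distribution (\<lambda>x. (walk_quantile L x - x)\<^sup>2)" "integrable std_normal_distribution (\<lambda>x. (walk_quantile L x + x)\<^sup>2)"
    by (intro Bochner_Integration.integrable_bound[OF b]; simp)+
qed

text \<open>As \<open>(q + x)\<^sup>2 + (q - x)\<^sup>2 = 2 q\<^sup>2 + 2 x\<^sup>2\<close> has constant mean \<open>4\<close>, Fatou's lemma for \<open>(q + x)\<^sup>2 \<rightarrow> 4 x\<^sup>2\<close>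
  bounds the coupling error from above.\<close>

lemma coupling_error_tendsto: "coupling_error \<longlonglongrightarrow> 0"
proof (rule order_tendstoI)
  fix e :: real assume "e < 0"
  then show "\<forall>\<^sub>F L in sequentially. e < coupling_error L"
    by (auto simp: coupling_error_def intro!: always_eventually order.strict_trans2[OF _ Bochner_Integration.integral_nonneg])
next
  fix e :: real assume e: "0 < e"
  have plus: "(\<integral>x. (walk_quantile L x + x)\<^sup>2 \<partial>std_normal_distribution) = 4 - coupling_error L" if L: "0 < L" for L
  proof -
    note i = walk_quantile_products[OF L] walk_quantile_moments[OF L] std_normal_square
    have "(\<integral>x. (walk_quantile L x + x)\<^sup>2 \<partial>std_normal_distribution) + coupling_error L
      = (\<integral>x. (walk_quantile L x + x)\<^sup>2 + (walk_quantile L x - x)\<^sup>2 \<partial>std_normal_distribution)"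
      unfolding coupling_error_def using i by (intro Bochner_Integration.integral_add[symmetric]) auto
    also have "\<dots> = (\<integral>x. 2 * (walk_quantile L x)\<^sup>2 + 2 * x\<^sup>2 \<partial>std_normal_distribution)"
      by (intro Bochner_Integration.integral_cong refl) (simp add: power2_eq_square algebra_simps)
    also have "\<dots> = 4" using i by (subst Bochner_Integration.integral_add) (auto intro!: integrable_mult_right)
    finally show ?thesis by simp
  qed
  have nn: "(\<integral>\<^sup>+x. ennreal ((walk_quantile L x + x)\<^sup>2) \<partial>std_normal_distribution) = ennreal (4 - coupling_error L)" if L: "0 < L" for L
    using walk_quantile_products[OF L] plus[OF L] by (subst nn_integral_eq_integral) auto
  have "ennreal 4 = (\<integral>\<^sup>+x. ennreal (4 * x\<^sup>2) \<partial>std_normal_distribution)"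
    using std_normal_square by (subst nn_integral_eq_integral) (auto intro!: integrable_mult_right)
  also have "\<dots> = (\<integral>\<^sup>+x. liminf (\<lambda>L. ennreal ((walk_quantile L x + x)\<^sup>2)) \<partial>std_normal_distribution)"
  proof (intro nn_integral_cong lim_imp_Liminf[symmetric])
    fix x
    have "(\<lambda>L. ennreal ((walk_quantile L x + x)\<^sup>2)) \<longlonglongrightarrow> ennreal ((x + x)\<^sup>2)"
      by (intro tendsto_intros walk_quantile_tendsto)
    then show "(\<lambda>L. ennreal ((walk_quantile L x + x)\<^sup>2)) \<longlonglongrightarrow> ennreal (4 * x\<^sup>2)" by (simp add: power2_eq_square algebra_simps)
  qed simp
  also have "\<dots> \<le> liminf (\<lambda>L. \<integral>\<^sup>+x. ennreal ((walk_quantile L x + x)\<^sup>2) \<partial>std_normal_distribution)"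
    by (rule nn_integral_liminf) simp
  finally have "ennreal 4 \<le> liminf (\<lambda>L. \<integral>\<^sup>+x. ennreal ((walk_quantile L x + x)\<^sup>2) \<partial>std_normal_distribution)" .
  moreover have "ennreal (4 - e) < ennreal 4" using e by (intro ennreal_lessI) auto
  ultimately have "ennreal (4 - e) < liminf (\<lambda>L. \<integral>\<^sup>+x. ennreal ((walk_quantile L x + x)\<^sup>2) \<partial>std_normal_distribution)"
    by (rule order.strict_trans2[rotated])
  then have "\<forall>\<^sub>F L in sequentially. ennreal (4 - e) < (\<integral>\<^sup>+x. ennreal ((walk_quantile L x + x)\<^sup>2) \<partial>std_normal_distribution)"
    by (rule less_LiminfD)
  then show "\<forall>\<^sub>F L in sequentially. coupling_error L < e"
    using eventually_gt_at_top[of 0]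
  proof eventually_elim
    case (elim L)
    then have "ennreal (4 - e) < ennreal (4 - coupling_error L)" by (simp add: nn)
    then have "4 - e < 4 - coupling_error L" by (meson ennreal_leI not_le)
    then show ?case by simp
  qed
qed

section \<open>Simple random walk close to a Wiener process\<close>

text \<open>The cross term vanishes at each step of the induction, since the new summand is centred
  and independent of the earlier sum.\<close>

lemma (in prob_space) indep_sum_square:
  fixes X :: "nat \<Rightarrow> 'a \<Rightarrow> real"
  assumes ind: "indep_vars (\<lambda>_. borel) X {..<m}"
    and mean: "\<And>i. i < m \<Longrightarrow> expectation (X i) = 0"
    and sq: "\<And>i. i < m \<Longrightarrow> integrable M (\<lambda>\<omega>. (X i \<omega>)\<^sup>2)"
    and k: "k \<le> m"
  shows "integrable M (\<lambda>\<omega>. (\<Sum>i<k. X i \<omega>)\<^sup>2)"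
    "expectation (\<lambda>\<omega>. (\<Sum>i<k. X i \<omega>)\<^sup>2) = (\<Sum>i<k. expectation (\<lambda>\<omega>. (X i \<omega>)\<^sup>2))"
proof -
  have rv[measurable]: "random_variable borel (X i)" if "i < m" for i using ind that by (auto simp: indep_vars_def2)
  have int: "integrable M (X i)" if "i < m" for i
    by (rule square_integrable_imp_integrable[OF rv[OF that] sq[OF that]])
  have "integrable M (\<lambda>\<omega>. (\<Sum>i<k. X i \<omega>)\<^sup>2) \<and>
    expectation (\<lambda>\<omega>. (\<Sum>i<k. X i \<omega>)\<^sup>2) = (\<Sum>i<k. expectation (\<lambda>\<omega>. (X i \<omega>)\<^sup>2))"
    using k
  proof (induction k)
    case (Suc k)
    let ?S = "\<lambda>\<omega>. \<Sum>i<k. X i \<omega>"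
    have km: "k < m" and IH: "integrable M (\<lambda>\<omega>. (?S \<omega>)\<^sup>2)" 
      "expectation (\<lambda>\<omega>. (?S \<omega>)\<^sup>2) = (\<Sum>i<k. expectation (\<lambda>\<omega>. (X i \<omega>)\<^sup>2))" using Suc by auto
    have rS: "random_variable borel ?S" using km rv by (intro borel_measurable_sum) auto
    have iS: "integrable M ?S" using km int by (intro Bochner_Integration.integrable_sum) auto
    have iv: "indep_var borel (X k) borel ?S"
      using km by (intro indep_vars_sum indep_vars_subset[OF ind]) auto
    have iXS: "integrable M (\<lambda>\<omega>. X k \<omega> * ?S \<omega>)" "expectation (\<lambda>\<omega>. X k \<omega> * ?S \<omega>) = 0"
      using indep_var_integrable[OF iv int[OF km] iS] indep_var_lebesgue_integral[OF iv int[OF km] iS] mean[OF km] by auto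
    have eq: "(\<Sum>i<Suc k. X i \<omega>)\<^sup>2 = ((?S \<omega>)\<^sup>2 + 2 * (X k \<omega> * ?S \<omega>)) + (X k \<omega>)\<^sup>2" for \<omega>
      by (simp add: power2_eq_square algebra_simps)
    note i = IH(1) iXS(1) sq[OF km]
    have "integrable M (\<lambda>\<omega>. ((?S \<omega>)\<^sup>2 + 2 * (X k \<omega> * ?S \<omega>)) + (X k \<omega>)\<^sup>2)"
      using i by (intro Bochner_Integration.integrable_add integrable_mult_right)
    moreover have "expectation (\<lambda>\<omega>. ((?S \<omega>)\<^sup>2 + 2 * (X k \<omega> * ?S \<omega>)) + (X k \<omega>)\<^sup>2)
      = expectation (\<lambda>\<omega>. (?S \<omega>)\<^sup>2) + 2 * expectation (\<lambda>\<omega>. X k \<omega> * ?S \<omega>) + expectation (\<lambda>\<omega>. (X k \<omega>)\<^sup>2)"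
      using i by (simp add: Bochner_Integration.integral_add)
    ultimately show ?case unfolding eq using IH(2) iXS(2) by simp
  qed simp
  then show "integrable M (\<lambda>\<omega>. (\<Sum>i<k. X i \<omega>)\<^sup>2)"
    "expectation (\<lambda>\<omega>. (\<Sum>i<k. X i \<omega>)\<^sup>2) = (\<Sum>i<k. expectation (\<lambda>\<omega>. (X i \<omega>)\<^sup>2))" by auto
qed

text \<open>Blocks must grow for the central limit theorem to apply in each of them, but be \<open>o(\<surd>n)\<close> long up to
  time \<open>n\<close> for the walk to be negligible inside a block.\<close>

definition block_length :: "nat \<Rightarrow> nat" where "block_length i = Suc (nat \<lfloor>sqrt (sqrt (real i))\<rfloor>)"
definition block_start :: "nat \<Rightarrow> nat" where "block_start i = (\<Sum>j<i. block_length j)"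
definition block_of :: "nat \<Rightarrow> nat" where "block_of k = (LEAST i. k < block_start (Suc i))"

lemma block_length_mono: "i \<le> j \<Longrightarrow> block_length i \<le> block_length j"
  by (auto simp: block_length_def intro!: nat_mono floor_mono)

lemma block_length_pos: "0 < block_length i" by (simp add: block_length_def)

lemma block_start_Suc: "block_start (Suc i) = block_start i + block_length i"
  by (simp add: block_start_def)

lemma block_start_0: "block_start 0 = 0" by (simp add: block_start_def)

lemma block_start_mono: "i \<le> j \<Longrightarrow> block_start i \<le> block_start j"
  unfolding block_start_def by (rule sum_mono2) auto

lemma block_start_ge: "i \<le> block_start i"
proof (induction i)
  case (Suc i) then show ?case using block_length_pos[of i] by (simp add: block_start_Suc)
qed simp

lemma block_of: "block_start (block_of k) \<le> k" "k < block_start (Suc (block_of k))"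
proof -
  have ex: "k < block_start (Suc k)" using block_start_ge[of "Suc k"] by simp
  then show "k < block_start (Suc (block_of k))" unfolding block_of_def by (rule LeastI)
  show "block_start (block_of k) \<le> k"
  proof (cases "block_of k")
    case (Suc i)
    then show ?thesis using not_less_Least[of i "\<lambda>i. k < block_start (Suc i)"] by (simp add: block_of_def not_less)
  qed (simp add: block_start_0)
qed

lemma block_ofI: assumes "block_start i \<le> k" "k < block_start (Suc i)" shows "block_of k = i"
proof -
  have "block_of k \<le> i" unfolding block_of_def using assms(2) by (rule Least_le)
  moreover have "i \<le> block_of k"
    using block_start_mono[of "Suc (block_of k)" i] assms(1) block_of(2)[of k] by (meson not_less_eq_eq le_trans not_le)
  ultimately show ?thesis by simp
qed

lemma block_length_at_top: "filterlim block_length at_top sequentially"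
proof -
  have "filterlim (\<lambda>i. sqrt (sqrt (real i))) at_top sequentially"
    by (intro filterlim_compose[OF sqrt_at_top] filterlim_real_sequentially)
  then have "filterlim (\<lambda>i. real (block_length i)) at_top sequentially"
    by (rule filterlim_at_top_mono) (auto simp: block_length_def intro!: always_eventually; linarith)
  then show ?thesis by (simp add: filterlim_sequentially_iff_filterlim_real)
qed

lemma block_length_le: "real (block_length (C * n)) \<le> 1 + sqrt (sqrt (real C)) * sqrt (sqrt (real n))"
  unfolding block_length_def by (simp add: real_sqrt_mult)

text \<open>As blocks are nonempty, a time up to C n lies in a block of index at most C n, hence of
  length at most 1 + (C n)^(1/4). The proof compares this with \<epsilon> n^(1/2) through r =
  n^(1/4).\<close>

lemma block_length_small:
  assumes "0 < \<epsilon>" shows "\<forall>\<^sub>F n in sequentially. real (block_length (C * n)) \<le> \<epsilon> * sqrt (real n)"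
proof -
  have "filterlim (\<lambda>n. sqrt (sqrt (real n))) at_top sequentially"
    by (intro filterlim_compose[OF sqrt_at_top] filterlim_real_sequentially)
  then have "\<forall>\<^sub>F n in sequentially. max 1 ((1 + sqrt (sqrt (real C))) / \<epsilon>) \<le> sqrt (sqrt (real n))"
    by (simp only: filterlim_at_top)
  then show ?thesis
  proof eventually_elim
    case (elim n)
    define r where "r = sqrt (sqrt (real n))"
    have r: "1 \<le> r" "1 + sqrt (sqrt (real C)) \<le> \<epsilon> * r" "r * r = sqrt (real n)"
      using elim assms by (auto simp: r_def divide_le_eq mult.commute)
    have "1 + sqrt (sqrt (real C)) * r \<le> (1 + sqrt (sqrt (real C))) * r" using r by (simp add: algebra_simps)
    also have "\<dots> \<le> (\<epsilon> * r) * r" using r by (intro mult_right_mono) auto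
    finally show ?case using block_length_le[of C n] r(3) by (simp add: r_def mult.assoc)
  qed
qed

lemma sqrt_le_self_nat: "sqrt (real n) \<le> real n"
proof (rule real_le_lsqrt)
  show "real n \<le> (real n)\<^sup>2" by (metis le_square of_nat_le_iff of_nat_mult power2_eq_square)
qed simp

lemma sum_lessThan_add: "(\<Sum>j<a + b. f j) = (\<Sum>j<a. f j) + (\<Sum>j<b. f (a + j :: nat) :: 'b::comm_monoid_add)"
  by (induction b) (simp_all add: add_ac)

context wiener_space
begin

definition increment :: "nat \<Rightarrow> 'a \<Rightarrow> real" where
  "increment i \<omega> = (W (real (block_start (Suc i))) \<omega> - W (real (block_start i)) \<omega>) / sqrt (real (block_length i))"

definition signs :: "nat \<Rightarrow> 'a \<Rightarrow> int list" where
  "signs i \<omega> = quantile_signs (block_length i) (Phi (increment i \<omega>))"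

definition \<xi> :: "nat \<Rightarrow> 'a \<Rightarrow> int" where
  "\<xi> k \<omega> = signs (block_of k) \<omega> ! (k - block_start (block_of k))"

definition S :: "nat \<Rightarrow> 'a \<Rightarrow> int" where "S k \<omega> = (\<Sum>j<k. \<xi> j \<omega>)"

lemma increment_measurable[measurable]: "random_variable borel (increment i)"
proof -
  note [measurable] = W_measurable[of "real n" for n, OF of_nat_0_le_iff]
  show ?thesis unfolding increment_def[abs_def] by measurable
qed

lemma signs_measurable[measurable]: "signs i \<in> measurable M (count_space UNIV)"
  unfolding signs_def[abs_def] using measurable_compose[OF increment_measurable measurable_quantile_signs] .

lemma \<xi>_measurable[measurable]: "\<xi> k \<in> measurable M (count_space UNIV)"
  unfolding \<xi>_def[abs_def] by measurable

lemma increment_normal: "distributed M lborel (increment i) std_normal_density"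
proof -
  have "distributed M lborel (\<lambda>\<omega>. W (real (block_start (Suc i))) \<omega> - W (real (block_start i)) \<omega>)
     (normal_density 0 (sqrt (real (block_length i))))"
    using W_normal[of "real (block_start i)" "real (block_start (Suc i))"] block_length_pos[of i]
    by (simp add: block_start_Suc)
  from normal_density_affine[OF this, of "1 / sqrt (real (block_length i))" 0] show ?thesis
    using block_length_pos[of i] by (simp add: increment_def[abs_def])
qed

lemma increment_distr: "distr M borel (increment i) = std_normal_distribution"
  using increment_normal[of i] by (simp add: distributed_def cong: distr_cong)

lemma increment_indep: "indep_vars (\<lambda>_. borel) increment {..<m}"
proof -
  have "mono (\<lambda>i. real (block_start i))" using block_start_mono by (auto intro!: monoI)
  from indep_vars_compose2[OF W_indep[OF _ this], where Y="\<lambda>i x. x / sqrt (real (block_length i))" and N="\<lambda>_. borel"]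
  show ?thesis by (simp add: increment_def[abs_def] block_start_0)
qed

lemma length_signs: "length (signs i \<omega>) = block_length i" and set_signs: "set (signs i \<omega>) \<subseteq> {1, - 1}"
  using quantile_signs_in[of "block_length i" "increment i \<omega>"] by (auto simp: signs_def sign_lists_def)

lemma \<xi>_values: "\<xi> k \<omega> = 1 \<or> \<xi> k \<omega> = - 1"
proof -
  have "k - block_start (block_of k) < length (signs (block_of k) \<omega>)"
    using block_of[of k] by (simp add: length_signs block_start_Suc)
  then have "\<xi> k \<omega> \<in> set (signs (block_of k) \<omega>)" unfolding \<xi>_def by (rule nth_mem)
  then show ?thesis using set_signs by fastforce
qed

lemma abs_\<xi>: "\<bar>\<xi> k \<omega>\<bar> = 1"
  using \<xi>_values[of k \<omega>] by auto

lemma \<xi>_block: "r < block_length i \<Longrightarrow> \<xi> (block_start i + r) \<omega> = signs i \<omega> ! r"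
  unfolding \<xi>_def by (subst (1 2) block_ofI[of i]) (auto simp: block_start_Suc)

text \<open>Up to a block boundary, prescribing the signs amounts to prescribing the list of each
  block. These lists are functions of independent normalised increments and uniform in their
  block.\<close>

lemma prob_\<xi>_blocks:
  assumes s: "\<And>k. k < block_start i \<Longrightarrow> s k = 1 \<or> s k = (- 1 :: int)"
  shows "prob {\<omega>\<in>space M. \<forall>k<block_start i. \<xi> k \<omega> = s k} = (1/2) ^ block_start i"
proof (cases "i = 0")
  case True then show ?thesis by (simp add: block_start_0 prob_space)
next
  case False
  define l where "l j = map s [block_start j..<block_start (Suc j)]" for j
  have l: "l j \<in> sign_lists (block_length j)" if "j < i" for j
  proof -
    have "s k = 1 \<or> s k = - 1" if "k < block_start (Suc j)" for k
      using block_start_mono[of "Suc j" i] that \<open>j < i\<close> by (intro s) simp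
    then have "set (l j) \<subseteq> {1, - 1}" unfolding l_def by force
    then show ?thesis by (simp add: l_def sign_lists_def block_start_Suc)
  qed
  have iff: "(\<forall>k<block_start i. \<xi> k \<omega> = s k) \<longleftrightarrow> (\<forall>j<i. signs j \<omega> = l j)" for \<omega>
  proof safe
    fix j assume *: "\<forall>k<block_start i. \<xi> k \<omega> = s k" "j < i"
    show "signs j \<omega> = l j"
    proof (rule nth_equalityI)
      fix r assume "r < length (signs j \<omega>)"
      then have r: "r < block_length j" by (simp add: length_signs)
      then have "block_start j + r < block_start i" using block_start_mono[of "Suc j" i] *(2) by (simp add: block_start_Suc)
      then show "signs j \<omega> ! r = l j ! r" using * r by (simp add: l_def block_start_Suc flip: \<xi>_block)
    qed (simp add: length_signs l_def block_start_Suc)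
  next
    fix k assume *: "\<forall>j<i. signs j \<omega> = l j" "k < block_start i"
    define j where "j = block_of k"
    note b = block_of[of k, folded j_def]
    have "j < i" using b(1) *(2) block_start_mono[of i j] by (meson leD le_less_linear le_trans)
    then show "\<xi> k \<omega> = s k" using * b \<xi>_block[of "k - block_start j" j \<omega>] by (simp add: l_def block_start_Suc)
  qed
  define A where "A j = {x. quantile_signs (block_length j) (Phi x) = l j}" for j
  have A[measurable]: "A j \<in> sets borel" for j
    using measurable_sets[OF measurable_quantile_signs, of "{l j}" "block_length j"] by (simp add: vimage_def A_def)
  have "{\<omega>\<in>space M. \<forall>k<block_start i. \<xi> k \<omega> = s k} = (\<Inter>j\<in>{..<i}. increment j -` A j \<inter> space M)"
    using False by (auto simp: iff A_def signs_def)
  also have "prob \<dots> = (\<Prod>j<i. prob (increment j -` A j \<inter> space M))"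
    using False by (intro indep_varsD_finite[OF increment_indep]) auto
  also have "\<dots> = (\<Prod>j<i. (1/2) ^ block_length j)"
  proof (intro prod.cong refl)
    fix j assume "j \<in> {..<i}"
    then have "measure (distr M borel (increment j)) (A j) = 1 / 2 ^ block_length j"
      unfolding increment_distr A_def using l by (intro measure_quantile_signs) auto
    then show "prob (increment j -` A j \<inter> space M) = (1/2) ^ block_length j"
      by (simp add: measure_distr power_divide)
  qed
  also have "\<dots> = (1/2) ^ block_start i" unfolding block_start_def by (simp add: power_sum)
  finally show ?thesis .
qed

text \<open>Inside a block the claim is reached by descending from the boundary
  \<open>block_start m\<close>, which lies at or after \<open>m\<close>: an event about n signs is
  the disjoint union of two events about n + 1 signs.\<close>

lemma prob_\<xi>:
  assumes s: "\<And>k. k < m \<Longrightarrow> s k = 1 \<or> s k = (- 1 :: int)"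
  shows "prob {\<omega>\<in>space M. \<forall>k<m. \<xi> k \<omega> = s k} = (1/2) ^ m"
proof -
  have "m \<le> block_start m" by (rule block_start_ge)
  then have "\<forall>s. (\<forall>k<m. s k = 1 \<or> s k = (- 1 :: int)) \<longrightarrow> prob {\<omega>\<in>space M. \<forall>k<m. \<xi> k \<omega> = s k} = (1/2) ^ m"
  proof (induction rule: inc_induct)
    case base then show ?case using prob_\<xi>_blocks by blast
  next
    case (step n)
    show ?case
    proof (intro allI impI)
      fix s :: "nat \<Rightarrow> int" assume s: "\<forall>k<n. s k = 1 \<or> s k = - 1"
      let ?E = "\<lambda>v. {\<omega>\<in>space M. \<forall>k<Suc n. \<xi> k \<omega> = (s(n := v)) k}"
      have p: "prob (?E v) = (1/2) ^ Suc n" if "v = 1 \<or> v = - 1" for v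
      proof -
        have "\<forall>k<Suc n. (s(n := v)) k = 1 \<or> (s(n := v)) k = - 1" using s that by (simp add: less_Suc_eq)
        with step(3) show ?thesis by blast
      qed
      have eq: "{\<omega>\<in>space M. \<forall>k<n. \<xi> k \<omega> = s k} = ?E 1 \<union> ?E (- 1)"
      proof (rule set_eqI)
        fix \<omega>
        show "\<omega> \<in> {\<omega>\<in>space M. \<forall>k<n. \<xi> k \<omega> = s k} \<longleftrightarrow> \<omega> \<in> ?E 1 \<union> ?E (- 1)"
          using \<xi>_values[of n \<omega>] by (auto simp: less_Suc_eq)
      qed
      have ev: "?E v \<in> events" for v by measurable
      have disj: "?E 1 \<inter> ?E (- 1) = {}"
      proof (rule ccontr)
        assume "?E 1 \<inter> ?E (- 1) \<noteq> {}"
        then obtain \<omega> where "\<omega> \<in> ?E 1" "\<omega> \<in> ?E (- 1)" by blast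
        then have "\<forall>k<Suc n. \<xi> k \<omega> = (s(n := 1)) k" "\<forall>k<Suc n. \<xi> k \<omega> = (s(n := - 1)) k" by blast+
        then have "\<xi> n \<omega> = (s(n := 1)) n" "\<xi> n \<omega> = (s(n := - 1)) n" by blast+
        then show False by simp
      qed
      have "prob {\<omega>\<in>space M. \<forall>k<n. \<xi> k \<omega> = s k} = prob (?E 1) + prob (?E (- 1))"
        unfolding eq by (rule finite_measure_Union[OF ev ev disj])
      also have "\<dots> = (1/2) ^ Suc n + (1/2) ^ Suc n" using p[of 1] p[of "- 1"] by (simp only: simp_thms)
      also have "\<dots> = (1/2) ^ n" by simp
      finally show "prob {\<omega>\<in>space M. \<forall>k<n. \<xi> k \<omega> = s k} = (1/2) ^ n" .
    qed
  qed
  then show ?thesis using s by blast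
qed

section \<open>Error of the coupling at block boundaries\<close>

definition err :: "nat \<Rightarrow> 'a \<Rightarrow> real" where
  "err i \<omega> = sqrt (real (block_length i)) * (walk_quantile (block_length i) (increment i \<omega>) - increment i \<omega>)"

text \<open>Multiplied by the square root of the block length, \<open>walk_quantile\<close> is the
  sum of the signs of a block and \<open>increment\<close> the increment of \<open>W\<close>. The
  deviation at block boundaries is thus a sum of independent centred terms, to which Kolmogorov's
  inequality applies.\<close>

lemma S_block_start:
  assumes "\<omega> \<in> space M"
  shows "real_of_int (S (block_start i) \<omega>) - W (real (block_start i)) \<omega> = (\<Sum>j<i. err j \<omega>)"
proof (induction i)
  case 0 then show ?case using assms W_zero by (simp add: block_start_0 S_def)
next
  case (Suc i)
  have "S (block_start (Suc i)) \<omega> = S (block_start i) \<omega> + (\<Sum>r<block_length i. \<xi> (block_start i + r) \<omega>)"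
    unfolding S_def block_start_Suc by (rule sum_lessThan_add)
  also have "(\<Sum>r<block_length i. \<xi> (block_start i + r) \<omega>) = sum_list (signs i \<omega>)"
    by (simp add: \<xi>_block sum_list_sum_nth length_signs lessThan_atLeast0)
  finally have "real_of_int (S (block_start (Suc i)) \<omega>) = real_of_int (S (block_start i) \<omega>) + real_of_int (sum_list (signs i \<omega>))"
    by simp
  moreover have "err i \<omega> = real_of_int (sum_list (signs i \<omega>)) - (W (real (block_start (Suc i))) \<omega> - W (real (block_start i)) \<omega>)"
  proof -
    have "sqrt (real (block_length i)) * increment i \<omega> = W (real (block_start (Suc i))) \<omega> - W (real (block_start i)) \<omega>"
      using block_length_pos[of i] by (simp add: increment_def)
    then show ?thesis using block_length_pos[of i] by (simp add: err_def walk_quantile_def signs_def right_diff_distrib)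
  qed
  ultimately show ?case using Suc by simp
qed

lemma err_moments:
  shows "integrable M (err i)" "expectation (err i) = 0" "integrable M (\<lambda>\<omega>. (err i \<omega>)\<^sup>2)"
    "expectation (\<lambda>\<omega>. (err i \<omega>)\<^sup>2) = real (block_length i) * coupling_error (block_length i)"
proof -
  let ?L = "block_length i"
  note L = block_length_pos[of i]
  have i1: "integrable std_normal_distribution (\<lambda>x. x)" "(\<integral>x. x \<partial>std_normal_distribution) = 0"
    using integrable_std_normal_distribution_moment[of 1] integral_std_normal_distribution_moment_odd[of 1] by simp_all
  have t: "integrable M (\<lambda>\<omega>. f (increment i \<omega>)) \<longleftrightarrow> integrable std_normal_distribution f"
       "expectation (\<lambda>\<omega>. f (increment i \<omega>)) = (\<integral>x. f x \<partial>std_normal_distribution)"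
    if "f \<in> borel_measurable borel" for f :: "real \<Rightarrow> real"
    unfolding increment_distr[of i, symmetric] using that by (simp_all add: integrable_distr_eq integral_distr)
  have d: "integrable std_normal_distribution (\<lambda>x. walk_quantile ?L x - x)"
     "(\<integral>x. walk_quantile ?L x - x \<partial>std_normal_distribution) = 0"
    using Bochner_Integration.integrable_diff[OF walk_quantile_moments(1)[OF L] i1(1)]
      Bochner_Integration.integral_diff[OF walk_quantile_moments(1)[OF L] i1(1)] walk_quantile_moments(3)[OF L] i1(2) by auto
  have m1: "(\<lambda>x. walk_quantile ?L x - x) \<in> borel_measurable borel" and m2: "(\<lambda>x. (walk_quantile ?L x - x)\<^sup>2) \<in> borel_measurable borel"
    by measurable
  show "integrable M (err i)"
    unfolding err_def[abs_def] by (intro integrable_mult_right t(1)[OF m1, THEN iffD2] d)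
  show "expectation (err i) = 0"
    unfolding err_def[abs_def] integral_mult_right_zero t(2)[OF m1] d(2) by simp
  show "integrable M (\<lambda>\<omega>. (err i \<omega>)\<^sup>2)"
    unfolding err_def power_mult_distrib by (intro integrable_mult_right t(1)[OF m2, THEN iffD2] walk_quantile_products L)
  show "expectation (\<lambda>\<omega>. (err i \<omega>)\<^sup>2) = real ?L * coupling_error ?L"
    unfolding err_def power_mult_distrib integral_mult_right_zero t(2)[OF m2] by (simp add: coupling_error_def)
qed

lemma err_indep: "indep_vars (\<lambda>_. borel) err {..<m}"
  unfolding err_def[abs_def] by (rule indep_vars_compose2[OF increment_indep]) auto

lemma prob_err_large:
  assumes "0 < x"
  shows "prob {\<omega>\<in>space M. \<exists>i\<le>m. x < \<bar>\<Sum>j<i. err j \<omega>\<bar>} \<le> (\<Sum>j<m. real (block_length j) * coupling_error (block_length j)) / x\<^sup>2"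
proof -
  note sq = indep_sum_square[OF err_indep err_moments(2,3)]
  have "prob {\<omega>\<in>space M. \<exists>i\<le>m. x < \<bar>\<Sum>j<i. err j \<omega>\<bar>} \<le> expectation (\<lambda>\<omega>. (\<Sum>j<m. err j \<omega>)\<^sup>2) / x\<^sup>2"
  proof (rule maximal_inequality[OF err_indep err_moments(1,2), where f'="\<lambda>s. 2 * s"])
    show "s\<^sup>2 + 2 * s * r \<le> (s + r)\<^sup>2" for s r :: real by (simp add: power2_sum)
    show "x\<^sup>2 \<le> s\<^sup>2" if "x < \<bar>s\<bar>" for s using that assms by (metis abs_le_square_iff abs_of_pos less_imp_le)
    show "integrable M (\<lambda>\<omega>. 2 * (\<Sum>i<j. err i \<omega>))" for j
      using err_moments(1) by (intro integrable_mult_right Bochner_Integration.integrable_sum)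
  qed (use assms sq in auto)
  then show ?thesis by (simp add: sq(2)[OF order_refl] err_moments(4))
qed

text \<open>A Cesaro argument: the weights are block lengths with total at most C n, and the errors
  tend to 0 with the block index. The finitely many early blocks contribute a constant, which
  division by n removes.\<close>

lemma weighted_error_tendsto:
  "(\<lambda>n. (\<Sum>j<block_of (C * n). real (block_length j) * coupling_error (block_length j)) / real n) \<longlonglongrightarrow> 0"
proof (rule LIMSEQ_I)
  fix e :: real assume e: "0 < e"
  have nn: "0 \<le> coupling_error L" for L by (simp add: coupling_error_def)
  \<comment> \<open>Chosen such that \<theta> C n is at most half of e n; the other half is for the
    early blocks.\<close>
  define \<theta> where "\<theta> = e / (2 * (real C + 1))"
  have \<theta>: "0 < \<theta>" using e by (simp add: \<theta>_def)
  have "(\<lambda>j. coupling_error (block_length j)) \<longlonglongrightarrow> 0"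
    by (rule filterlim_compose[OF coupling_error_tendsto block_length_at_top])
  then have "\<forall>\<^sub>F j in sequentially. coupling_error (block_length j) < \<theta>" using \<theta> by (rule order_tendstoD)
  then obtain J where J: "\<And>j. j \<ge> J \<Longrightarrow> coupling_error (block_length j) < \<theta>" by (auto simp: eventually_sequentially)
  let ?g = "\<lambda>j. real (block_length j) * coupling_error (block_length j)"
  define K where "K = (\<Sum>j<J. ?g j)"
  obtain N :: nat where N: "2 * K / e < real N" using reals_Archimedean2 by blast
  have "norm ((\<Sum>j<block_of (C * n). ?g j) / real n - 0) < e" if n: "n \<ge> Suc N" for n
  proof -
    have "(\<Sum>j<block_of (C * n). ?g j) \<le> (\<Sum>j<block_of (C * n). (if j < J then ?g j else 0) + \<theta> * real (block_length j))"
    proof (rule sum_mono)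
      fix j
      show "?g j \<le> (if j < J then ?g j else 0) + \<theta> * real (block_length j)"
        using mult_left_mono[of "coupling_error (block_length j)" \<theta> "real (block_length j)"] J[of j] \<theta>
        by (cases "j < J") (auto simp: mult.commute[of \<theta>])
    qed
    also have "\<dots> = (\<Sum>j<block_of (C * n). if j < J then ?g j else 0) + \<theta> * real (block_start (block_of (C * n)))"
      by (simp add: sum.distrib block_start_def sum_distrib_left)
    also have "(\<Sum>j<block_of (C * n). if j < J then ?g j else 0) \<le> K"
      unfolding K_def using nn by (subst sum.If_cases, simp, simp, intro sum_mono2) auto
    also have "real (block_start (block_of (C * n))) \<le> real C * real n"
      using block_of(1)[of "C * n"] by (metis of_nat_le_iff of_nat_mult)
    finally have le: "(\<Sum>j<block_of (C * n). ?g j) \<le> K + \<theta> * (real C * real n)" using \<theta> by simp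
    have "K < e / 2 * real n" 
    proof -
      have "2 * K / e < real n" using N n by linarith
      then show ?thesis using e by (simp add: field_simps)
    qed
    moreover have "\<theta> * (real C * real n) \<le> e / 2 * real n"
    proof -
      have "\<theta> * real C \<le> \<theta> * (real C + 1)" using \<theta> by simp
      also have "\<dots> = e / 2" by (simp add: \<theta>_def field_simps)
      finally have "\<theta> * real C * real n \<le> e / 2 * real n" by (intro mult_right_mono) auto
      then show ?thesis by (simp add: mult.assoc)
    qed
    ultimately have "(\<Sum>j<block_of (C * n). ?g j) < e * real n" using le by linarith
    moreover have "0 \<le> (\<Sum>j<block_of (C * n). ?g j)" using nn by (intro sum_nonneg) auto
    ultimately show ?thesis using n by (simp add: divide_less_eq)
  qed
  then show "\<exists>no. \<forall>n\<ge>no. norm ((\<Sum>j<block_of (C * n). ?g j) / real n - 0) < e" by blast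
qed

text \<open>The set \<open>P n \<omega>\<close> of time pairs may be random. This covers both the
  fixed pairs within the length of a block and the pairs formed by the random clock and its
  limit.\<close>

lemma whp_time_change:
  assumes \<epsilon>: "0 < \<epsilon>"
    and P: "\<And>\<delta>. 0 < \<delta> \<Longrightarrow> whp M (\<lambda>n \<omega>. \<forall>(s, t)\<in>P n \<omega>.
      0 \<le> s \<and> s \<le> real C * real n \<and> 0 \<le> t \<and> t \<le> real C * real n \<and> \<bar>s - t\<bar> \<le> \<delta> * real n)"
  shows "whp M (\<lambda>n \<omega>. \<forall>(s, t)\<in>P n \<omega>. \<bar>W s \<omega> - W t \<omega>\<bar> \<le> \<epsilon> * sqrt (real n))"
  unfolding whp_def
proof safe
  fix \<eta> :: real assume "0 < \<eta>"
  then have \<eta>: "0 < \<eta> / 2" by simp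
  \<comment> \<open>The modulus of continuity asks for a positive constant, and \<open>C\<close> may
    be 0; hence C + 1.\<close>
  have C: "0 < real C + 1" by simp
  obtain \<delta> where \<delta>: "0 < \<delta>" "\<forall>n\<ge>1::nat. \<exists>B\<in>events. prob B \<le> \<eta> / 2 \<and>
    (\<forall>\<omega>\<in>space M - B. \<forall>s t. 0 \<le> s \<and> s \<le> (real C + 1) * real n \<and> 0 \<le> t \<and> t \<le> (real C + 1) * real n \<and> \<bar>s - t\<bar> \<le> \<delta> * real n
       \<longrightarrow> \<bar>W s \<omega> - W t \<omega>\<bar> \<le> \<epsilon> * sqrt (real n))"
    using modulus[OF \<epsilon> C \<eta>] by blast
  have "\<forall>\<^sub>F n in sequentially. \<exists>B\<in>events. prob B \<le> \<eta> / 2 \<and> (\<forall>\<omega>\<in>space M - B. \<forall>(s, t)\<in>P n \<omega>.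
      0 \<le> s \<and> s \<le> real C * real n \<and> 0 \<le> t \<and> t \<le> real C * real n \<and> \<bar>s - t\<bar> \<le> \<delta> * real n)"
    using P[OF \<delta>(1)] \<eta> unfolding whp_def by blast
  then show "\<forall>\<^sub>F n in sequentially. \<exists>B\<in>events. prob B \<le> \<eta> \<and>
    (\<forall>\<omega>\<in>space M - B. \<forall>(s, t)\<in>P n \<omega>. \<bar>W s \<omega> - W t \<omega>\<bar> \<le> \<epsilon> * sqrt (real n))"
    using eventually_ge_at_top[of 1]
  proof eventually_elim
    case (elim n)
    from elim(1) obtain A where A: "A \<in> events" "prob A \<le> \<eta> / 2" "\<forall>\<omega>\<in>space M - A. \<forall>(s, t)\<in>P n \<omega>.
      0 \<le> s \<and> s \<le> real C * real n \<and> 0 \<le> t \<and> t \<le> real C * real n \<and> \<bar>s - t\<bar> \<le> \<delta> * real n" by blast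
    from \<delta>(2)[THEN spec, THEN mp, OF elim(2)] obtain B where B: "B \<in> events" "prob B \<le> \<eta> / 2"
      "\<forall>\<omega>\<in>space M - B. \<forall>s t. 0 \<le> s \<and> s \<le> (real C + 1) * real n \<and> 0 \<le> t \<and> t \<le> (real C + 1) * real n \<and> \<bar>s - t\<bar> \<le> \<delta> * real n
       \<longrightarrow> \<bar>W s \<omega> - W t \<omega>\<bar> \<le> \<epsilon> * sqrt (real n)" by blast
    have le: "real C * real n \<le> (real C + 1) * real n" by (intro mult_right_mono) auto
    have "prob (A \<union> B) \<le> \<eta>" using measure_Un_le[OF A(1) B(1)] A(2) B(2) by simp
    moreover have "\<bar>W s \<omega> - W t \<omega>\<bar> \<le> \<epsilon> * sqrt (real n)" if w: "\<omega> \<in> space M - (A \<union> B)" and st: "(s, t) \<in> P n \<omega>" for \<omega> s t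
    proof -
      have "0 \<le> s \<and> s \<le> real C * real n \<and> 0 \<le> t \<and> t \<le> real C * real n \<and> \<bar>s - t\<bar> \<le> \<delta> * real n"
        using A(3) w st by blast
      then have "0 \<le> s \<and> s \<le> (real C + 1) * real n \<and> 0 \<le> t \<and> t \<le> (real C + 1) * real n \<and> \<bar>s - t\<bar> \<le> \<delta> * real n"
        using le by linarith
      moreover have "\<omega> \<in> space M - B" using w by blast
      ultimately show ?thesis using B(3) by blast
    qed
    ultimately show ?case using A(1) B(1) by (intro bexI[of _ "A \<union> B"]) auto
  qed
qed

text \<open>The error is split in three: the deviation at the start of the block containing k, the
  movement of \<open>W\<close> since then, and the movement of the walk since then. The last is at
  most the block length, as steps have size 1.\<close>

theorem walk_coupling:
  assumes \<epsilon>: "0 < \<epsilon>"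
  shows "whp M (\<lambda>n \<omega>. \<forall>k\<le>C * n. \<bar>real_of_int (S k \<omega>) - W (real k) \<omega>\<bar> \<le> \<epsilon> * sqrt (real n))"
proof -
  define \<epsilon>3 where "\<epsilon>3 = \<epsilon> / 3"
  have \<epsilon>3: "0 < \<epsilon>3" using \<epsilon> by (simp add: \<epsilon>3_def)
  have 1: "whp M (\<lambda>n \<omega>. \<forall>i\<le>block_of (C * n). \<bar>\<Sum>j<i. err j \<omega>\<bar> \<le> \<epsilon>3 * sqrt (real n))"
  proof (rule whpI[where N=1])
    fix n :: nat assume n: "1 \<le> n"
    let ?B = "{\<omega>\<in>space M. \<exists>i\<le>block_of (C * n). \<epsilon>3 * sqrt (real n) < \<bar>\<Sum>j<i. err j \<omega>\<bar>}"
    have [measurable]: "random_variable borel (err j)" for j using err_moments(1) by (rule borel_measurable_integrable)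
    show "?B \<in> events" by measurable
    show "\<forall>i\<le>block_of (C * n). \<bar>\<Sum>j<i. err j \<omega>\<bar> \<le> \<epsilon>3 * sqrt (real n)" if "\<omega> \<in> space M - ?B" for \<omega>
      using that by (auto simp: not_less)
    show "prob ?B \<le> (\<Sum>j<block_of (C * n). real (block_length j) * coupling_error (block_length j)) / real n / \<epsilon>3\<^sup>2"
      using prob_err_large[of "\<epsilon>3 * sqrt (real n)" "block_of (C * n)"] n \<epsilon>3 by (simp add: power_mult_distrib mult.commute)
  next
    show "(\<lambda>n. (\<Sum>j<block_of (C * n). real (block_length j) * coupling_error (block_length j)) / real n / \<epsilon>3\<^sup>2) \<longlonglongrightarrow> 0"
      using tendsto_divide_zero[OF weighted_error_tendsto] .
  qed
  define P where "P n \<omega> = {(s, t). 0 \<le> s \<and> s \<le> real C * real n \<and> 0 \<le> t \<and> t \<le> real C * real n \<and> \<bar>s - t\<bar> \<le> real (block_length (C * n))}"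
    for n and \<omega> :: 'a
  have 2: "whp M (\<lambda>n \<omega>. \<forall>(s, t)\<in>P n \<omega>. \<bar>W s \<omega> - W t \<omega>\<bar> \<le> \<epsilon>3 * sqrt (real n))"
  proof (rule whp_time_change[OF \<epsilon>3, where C=C])
    fix \<delta> :: real assume \<delta>: "0 < \<delta>"
    obtain N where N: "\<And>n. N \<le> n \<Longrightarrow> real (block_length (C * n)) \<le> \<delta> * sqrt (real n)"
      using block_length_small[OF \<delta>, of C] by (auto simp: eventually_sequentially)
    have "real (block_length (C * n)) \<le> \<delta> * real n" if "N \<le> n" for n
      using N[OF that] mult_left_mono[OF sqrt_le_self_nat[of n], of \<delta>] \<delta> by linarith
    then show "whp M (\<lambda>n \<omega>. \<forall>(s, t)\<in>P n \<omega>.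
      0 \<le> s \<and> s \<le> real C * real n \<and> 0 \<le> t \<and> t \<le> real C * real n \<and> \<bar>s - t\<bar> \<le> \<delta> * real n)"
      by (intro whp_eventually[where N=N]) (force simp: P_def)
  qed
  obtain n0 where n0: "\<And>n. n \<ge> n0 \<Longrightarrow> real (block_length (C * n)) \<le> \<epsilon>3 * sqrt (real n)"
    using block_length_small[OF \<epsilon>3, of C] by (auto simp: eventually_sequentially)
  show ?thesis
  proof (rule whp_mono[OF whp_conj[OF 1 2], where N=n0], intro allI impI)
    fix n \<omega> k
    assume n: "n0 \<le> n" and w: "\<omega> \<in> space M" and k: "k \<le> C * n"
      and *: "(\<forall>i\<le>block_of (C * n). \<bar>\<Sum>j<i. err j \<omega>\<bar> \<le> \<epsilon>3 * sqrt (real n)) \<and>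
       (\<forall>(s, t)\<in>P n \<omega>. \<bar>W s \<omega> - W t \<omega>\<bar> \<le> \<epsilon>3 * sqrt (real n))"
    define i where "i = block_of k"
    note b = block_of[of k, folded i_def]
    have "i \<le> C * n" using block_start_ge[of i] b k by linarith
    then have L: "block_length i \<le> block_length (C * n)" by (rule block_length_mono)
    have ib: "i \<le> block_of (C * n)"
    proof (rule ccontr)
      assume "\<not> i \<le> block_of (C * n)"
      then have "block_start (Suc (block_of (C * n))) \<le> block_start i" by (intro block_start_mono) auto
      then show False using block_of(2)[of "C * n"] b k by linarith
    qed
    have d: "k - block_start i \<le> block_length (C * n)" using b L by (simp add: block_start_Suc)
    have kr: "real k \<le> real C * real n" using k by (metis of_nat_le_iff of_nat_mult)
    have "\<bar>W (real (block_start i)) \<omega> - W (real k) \<omega>\<bar> \<le> \<epsilon>3 * sqrt (real n)"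
    proof -
      have "(real (block_start i), real k) \<in> P n \<omega>"
        using b d kr by (simp add: P_def of_nat_diff abs_le_iff)
      then show ?thesis using conjunct2[OF *] by blast
    qed
    moreover have "\<bar>real_of_int (S (block_start i) \<omega>) - W (real (block_start i)) \<omega>\<bar> \<le> \<epsilon>3 * sqrt (real n)"
      unfolding S_block_start[OF w] using conjunct1[OF *] ib by blast
    moreover have "\<bar>real_of_int (S k \<omega>) - real_of_int (S (block_start i) \<omega>)\<bar> \<le> \<epsilon>3 * sqrt (real n)"
    proof -
      have "S k \<omega> = S (block_start i) \<omega> + (\<Sum>j\<in>{block_start i..<k}. \<xi> j \<omega>)"
        unfolding S_def lessThan_atLeast0 using b by (simp add: sum.atLeastLessThan_concat)
      then have "\<bar>S k \<omega> - S (block_start i) \<omega>\<bar> \<le> (\<Sum>j\<in>{block_start i..<k}. \<bar>\<xi> j \<omega>\<bar>)" by (simp add: sum_abs)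
      also have "\<dots> = (\<Sum>j\<in>{block_start i..<k}. 1)" by (simp only: abs_\<xi>)
      also have "\<dots> \<le> int (block_length (C * n))" using d by simp
      finally have "\<bar>real_of_int (S k \<omega>) - real_of_int (S (block_start i) \<omega>)\<bar> \<le> real (block_length (C * n))"
        by (metis of_int_abs of_int_diff of_int_le_iff of_int_of_nat_eq)
      then show ?thesis using n0[OF n] by linarith
    qed
    moreover have "\<epsilon> * sqrt (real n) = 3 * (\<epsilon>3 * sqrt (real n))" by (simp add: \<epsilon>3_def)
    ultimately show "\<bar>real_of_int (S k \<omega>) - W (real k) \<omega>\<bar> \<le> \<epsilon> * sqrt (real n)" by linarith
  qed
qed

end

section \<open>Anisotropic walk\<close>

lemma measurable_count_space_binop:
  fixes f :: "'a \<Rightarrow> 'b::countable" and g :: "'a \<Rightarrow> 'c"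
  assumes "f \<in> measurable M (count_space UNIV)" "g \<in> measurable M (count_space UNIV)"
  shows "(\<lambda>x. h (f x) (g x)) \<in> measurable M (count_space UNIV)"
  by (rule measurable_compose_countable[OF _ assms(1)]) (rule measurable_compose[OF assms(2)], simp)

text \<open>The walk is driven by uniform variables \<open>U\<close>, which decide between horizontal and vertical moves,
  and by two independent sequences of fair signs \<open>\<xi>\<close>, \<open>\<eta>\<close> which are consumed one by one.\<close>

locale walk_driver = prob_space M for M :: "'a measure" +
  fixes p :: "int \<Rightarrow> real" and U :: "nat \<Rightarrow> 'a \<Rightarrow> real" and \<xi> \<eta> :: "nat \<Rightarrow> 'a \<Rightarrow> int"
  assumes p_bounds: "\<And>j. 0 < p j \<and> p j \<le> 1 / 2"
    and U_measurable[measurable]: "\<And>n. random_variable borel (U n)"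
    and \<xi>_measurable[measurable]: "\<And>n. \<xi> n \<in> measurable M (count_space UNIV)"
    and \<eta>_measurable[measurable]: "\<And>n. \<eta> n \<in> measurable M (count_space UNIV)"
    and \<xi>_values: "\<And>n \<omega>. \<xi> n \<omega> = 1 \<or> \<xi> n \<omega> = - 1"
    and \<eta>_values: "\<And>n \<omega>. \<eta> n \<omega> = 1 \<or> \<eta> n \<omega> = - 1"
    and joint: "\<And>n h v c b s t.
      (\<And>i. 0 \<le> c i \<and> c i \<le> (1::real)) \<Longrightarrow> (\<And>k. k < h \<Longrightarrow> s k = 1 \<or> s k = (- 1 :: int)) \<Longrightarrow> (\<And>k. k < v \<Longrightarrow> t k = 1 \<or> t k = (- 1 :: int)) \<Longrightarrow>
      prob {\<omega>\<in>space M. (\<forall>i<n. (U i \<omega> < c i) = b i) \<and> (\<forall>k<h. \<xi> k \<omega> = s k) \<and> (\<forall>k<v. \<eta> k \<omega> = t k)}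
        = (\<Prod>i<n. if b i then c i else 1 - c i) * (1/2) ^ h * (1/2) ^ v"
begin

definition S1 :: "nat \<Rightarrow> 'a \<Rightarrow> int" where "S1 k \<omega> = (\<Sum>j<k. \<xi> j \<omega>)"
definition S2 :: "nat \<Rightarrow> 'a \<Rightarrow> int" where "S2 k \<omega> = (\<Sum>j<k. \<eta> j \<omega>)"

text \<open>The two horizontal neighbours of column x have total probability 2 p(x), whence the
  threshold; the direction is left to the next fair sign.\<close>

primrec H :: "nat \<Rightarrow> 'a \<Rightarrow> nat" where
  "H 0 \<omega> = 0"
| "H (Suc n) \<omega> = (if U n \<omega> < 2 * p (S1 (H n \<omega>) \<omega>) then Suc (H n \<omega>) else H n \<omega>)"

definition Z :: "nat \<Rightarrow> 'a \<Rightarrow> int \<times> int" where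
  "Z n \<omega> = (S1 (H n \<omega>) \<omega>, S2 (n - H n \<omega>) \<omega>)"

lemma S1_measurable[measurable]: "S1 k \<in> measurable M (count_space UNIV)"
proof (induction k)
  case (Suc k)
  have "S1 (Suc k) = (\<lambda>\<omega>. S1 k \<omega> + \<xi> k \<omega>)" by (simp add: S1_def[abs_def])
  then show ?case using measurable_count_space_binop[OF Suc \<xi>_measurable] by simp
qed (simp add: S1_def[abs_def])

lemma S2_measurable[measurable]: "S2 k \<in> measurable M (count_space UNIV)"
proof (induction k)
  case (Suc k)
  have "S2 (Suc k) = (\<lambda>\<omega>. S2 k \<omega> + \<eta> k \<omega>)" by (simp add: S2_def[abs_def])
  then show ?case using measurable_count_space_binop[OF Suc \<eta>_measurable] by simp
qed (simp add: S2_def[abs_def])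

lemma H_measurable[measurable]: "H n \<in> measurable M (count_space UNIV)"
proof (induction n)
  case (Suc n)
  have step: "(\<lambda>\<omega>. if U n \<omega> < 2 * p (S1 h \<omega>) then Suc h else h) \<in> measurable M (count_space UNIV)" for h
  proof -
    have [measurable]: "(\<lambda>\<omega>. p (S1 h \<omega>)) \<in> borel_measurable M"
      by (rule measurable_compose[OF S1_measurable]) simp
    show ?thesis by measurable
  qed
  have "(\<lambda>\<omega>. if U n \<omega> < 2 * p (S1 (H n \<omega>) \<omega>) then Suc (H n \<omega>) else H n \<omega>) \<in> measurable M (count_space UNIV)"
    using measurable_compose_countable[OF step Suc] .
  then show ?case by simp
qed simp

lemma Z_measurable[measurable]: "Z n \<in> measurable M (count_space UNIV)"
proof -
  have "(\<lambda>\<omega>. (S1 h \<omega>, S2 (n - h) \<omega>)) \<in> measurable M (count_space UNIV)" for h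
    by (rule measurable_count_space_binop[OF S1_measurable S2_measurable])
  from measurable_compose_countable[OF this H_measurable[of n]] show ?thesis
    unfolding Z_def[abs_def] .
qed

lemma H_le: "H n \<omega> \<le> n" by (induction n) auto

lemma Z_Suc: "Z (Suc n) \<omega> = (if U n \<omega> < 2 * p (fst (Z n \<omega>))
    then (fst (Z n \<omega>) + \<xi> (H n \<omega>) \<omega>, snd (Z n \<omega>))
    else (fst (Z n \<omega>), snd (Z n \<omega>) + \<eta> (n - H n \<omega>) \<omega>))"
  using H_le[of n \<omega>] by (simp add: Z_def S1_def S2_def Suc_diff_le)

text \<open>A vertical move changes the second coordinate and a horizontal one does not, so the
  clock can be read off the path alone. This lets the law of the walk determine the behaviour of
  \<open>H\<close>.\<close>

lemma H_Suc: "H (Suc n) \<omega> = H n \<omega> + of_bool (snd (Z (Suc n) \<omega>) = snd (Z n \<omega>))"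
  unfolding Z_Suc using \<eta>_values[of "n - H n \<omega>" \<omega>] by (auto simp: Z_def)

definition history :: "nat \<Rightarrow> (nat \<Rightarrow> int \<times> int) \<Rightarrow> 'a set" where
  "history n z = {\<omega>\<in>space M. \<forall>i\<le>n. Z i \<omega> = z i}"

definition cylinder :: "nat \<Rightarrow> nat \<Rightarrow> (nat \<Rightarrow> real) \<Rightarrow> (nat \<Rightarrow> bool) \<Rightarrow> (nat \<Rightarrow> int) \<Rightarrow> (nat \<Rightarrow> int) \<Rightarrow> 'a set" where
  "cylinder n h c b s t = {\<omega>\<in>space M. (\<forall>i<n. (U i \<omega> < c i) = b i) \<and> (\<forall>k<h. \<xi> k \<omega> = s k) \<and> (\<forall>k<n - h. \<eta> k \<omega> = t k)}"

definition is_signs :: "(nat \<Rightarrow> int) \<Rightarrow> bool" where "is_signs s \<longleftrightarrow> (\<forall>k. s k = 1 \<or> s k = - 1)"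

lemma history_Suc: "history (Suc n) z = {\<omega>\<in>history n z. Z (Suc n) \<omega> = z (Suc n)}"
  by (auto simp: history_def le_Suc_eq)

text \<open>A path reveals which moves were horizontal, hence how many signs of either kind have
  been used and their values. A possible history is therefore a cylinder event: \<open>c i\<close>
  is the threshold 2 p at the column occupied at time \<open>i\<close>, and \<open>b i\<close> tells
  whether move \<open>i\<close> was horizontal. In total h + (n - h) = n signs are used, which
  accounts for the factor (1/2)^n.\<close>

lemma history_cylinder:
  assumes "z 0 = (0, 0)"
  shows "(history n z = {} \<and> (\<Prod>i<n. aniso_step p (z i) (z (Suc i))) = 0) \<or>
    (\<exists>h c b s t. h \<le> n \<and> (\<forall>i. 0 \<le> c i \<and> c i \<le> (1::real)) \<and> is_signs s \<and> is_signs t \<and>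
      history n z = cylinder n h c b s t \<and> (\<forall>\<omega>\<in>history n z. H n \<omega> = h) \<and>
      (\<Prod>i<n. if b i then c i else 1 - c i) * (1/2) ^ n = (\<Prod>i<n. aniso_step p (z i) (z (Suc i))))"
proof (induction n)
  case 0
  show ?case
    using assms by (intro disjI2 exI[of _ 0] exI[of _ "\<lambda>_. 0"] exI[of _ "\<lambda>_. True"] exI[of _ "\<lambda>_. 1"])
      (auto simp: history_def cylinder_def is_signs_def Z_def S1_def S2_def)
next
  case (Suc n)
  show ?case
  proof (cases "history n z = {} \<and> (\<Prod>i<n. aniso_step p (z i) (z (Suc i))) = 0")
    case True then show ?thesis by (auto simp: history_Suc)
  next
    case False
    then obtain h c b s t where IH: "h \<le> n" "\<forall>i. 0 \<le> c i \<and> c i \<le> (1::real)" "is_signs s" "is_signs t"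
      "history n z = cylinder n h c b s t" "\<And>\<omega>. \<omega> \<in> history n z \<Longrightarrow> H n \<omega> = h"
      "(\<Prod>i<n. if b i then c i else 1 - c i) * (1/2) ^ n = (\<Prod>i<n. aniso_step p (z i) (z (Suc i)))"
      using Suc by blast
    obtain x y where xy: "z n = (x, y)" by (cases "z n")
    have hist: "history (Suc n) z = {\<omega>\<in>cylinder n h c b s t.
        (if U n \<omega> < 2 * p x then (x + \<xi> h \<omega>, y) else (x, y + \<eta> (n - h) \<omega>)) = z (Suc n)}"
      unfolding history_Suc IH(5)[symmetric]
    proof (intro Collect_cong conj_cong refl)
      fix \<omega> assume w: "\<omega> \<in> history n z"
      then have "Z n \<omega> = (x, y)" using xy by (auto simp: history_def)
      then show "(Z (Suc n) \<omega> = z (Suc n)) = ((if U n \<omega> < 2 * p x then (x + \<xi> h \<omega>, y) else (x, y + \<eta> (n - h) \<omega>)) = z (Suc n))"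
        unfolding Z_Suc IH(6)[OF w] by simp
    qed
    have p: "0 < p x" "p x \<le> 1 / 2" using p_bounds[of x] by auto
    consider (hor) \<sigma> where "\<sigma> = 1 \<or> \<sigma> = - 1" "z (Suc n) = (x + \<sigma>, y)"
      | (ver) \<sigma> where "\<sigma> = 1 \<or> \<sigma> = - 1" "z (Suc n) = (x, y + \<sigma>)"
      | (none) "\<And>\<sigma>. \<sigma> = 1 \<or> \<sigma> = - 1 \<Longrightarrow> z (Suc n) \<noteq> (x + \<sigma>, y) \<and> z (Suc n) \<noteq> (x, y + \<sigma>)"
      by blast
    then show ?thesis
    proof cases
      case hor
      have "history (Suc n) z = cylinder (Suc n) (Suc h) (c(n := 2 * p x)) (b(n := True)) (s(h := \<sigma>)) t"
        unfolding hist cylinder_def using hor by (auto simp: less_Suc_eq)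
      moreover have "H (Suc n) \<omega> = Suc h" if "\<omega> \<in> history (Suc n) z" for \<omega>
      proof -
        have "\<omega> \<in> history n z" "Z (Suc n) \<omega> = z (Suc n)" "Z n \<omega> = z n" using that by (auto simp: history_Suc history_def)
        then show ?thesis unfolding H_Suc using IH(6) hor xy by simp
      qed
      moreover have step: "aniso_step p (z n) (z (Suc n)) = p x" using hor xy by (auto simp: aniso_step_def)
      moreover have "(\<Prod>i<Suc n. if (b(n := True)) i then (c(n := 2 * p x)) i else 1 - (c(n := 2 * p x)) i) * (1/2) ^ Suc n
          = (\<Prod>i<Suc n. aniso_step p (z i) (z (Suc i)))"
      proof -
        have "(\<Prod>i<n. if (b(n := True)) i then (c(n := 2 * p x)) i else 1 - (c(n := 2 * p x)) i) = (\<Prod>i<n. if b i then c i else 1 - c i)"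
          by (intro prod.cong) auto
        then show ?thesis unfolding prod.lessThan_Suc IH(7)[symmetric] step by (simp add: algebra_simps)
      qed
      moreover have "\<forall>i. 0 \<le> (c(n := 2 * p x)) i \<and> (c(n := 2 * p x)) i \<le> 1" using IH(2) p by simp
      moreover have "is_signs (s(h := \<sigma>))" "is_signs (t)" using IH(3,4) hor(1) by (auto simp: is_signs_def)
      moreover have "Suc h \<le> Suc n" using IH(1) by simp
      ultimately show ?thesis by blast
    next
      case ver
      have "history (Suc n) z = cylinder (Suc n) h (c(n := 2 * p x)) (b(n := False)) s (t(n - h := \<sigma>))"
        unfolding hist cylinder_def using ver IH(1) by (auto simp: less_Suc_eq Suc_diff_le)
      moreover have "H (Suc n) \<omega> = h" if "\<omega> \<in> history (Suc n) z" for \<omega>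
      proof -
        have "\<omega> \<in> history n z" "Z (Suc n) \<omega> = z (Suc n)" "Z n \<omega> = z n" using that by (auto simp: history_Suc history_def)
        then show ?thesis unfolding H_Suc using IH(6) ver xy by auto
      qed
      moreover have step: "aniso_step p (z n) (z (Suc n)) = 1 / 2 - p x" using ver xy by (auto simp: aniso_step_def)
      moreover have "(\<Prod>i<Suc n. if (b(n := False)) i then (c(n := 2 * p x)) i else 1 - (c(n := 2 * p x)) i) * (1/2) ^ Suc n
          = (\<Prod>i<Suc n. aniso_step p (z i) (z (Suc i)))"
      proof -
        have "(\<Prod>i<n. if (b(n := False)) i then (c(n := 2 * p x)) i else 1 - (c(n := 2 * p x)) i) = (\<Prod>i<n. if b i then c i else 1 - c i)"
          by (intro prod.cong) auto
        then show ?thesis unfolding prod.lessThan_Suc IH(7)[symmetric] step by (simp add: algebra_simps)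
      qed
      moreover have "\<forall>i. 0 \<le> (c(n := 2 * p x)) i \<and> (c(n := 2 * p x)) i \<le> 1" using IH(2) p by simp
      moreover have "is_signs (s)" "is_signs (t(n - h := \<sigma>))" using IH(3,4) ver(1) by (auto simp: is_signs_def)
      moreover have "h \<le> Suc n" using IH(1) by simp
      ultimately show ?thesis by blast
    next
      case none
      have "history (Suc n) z = {}"
        unfolding hist using none \<xi>_values[of h] \<eta>_values[of "n - h"] by (auto split: if_splits) (metis+)
      moreover have "aniso_step p (z n) (z (Suc n)) = 0" using none[of 1] none[of "- 1"] xy by (auto simp: aniso_step_def)
      ultimately show ?thesis by simp
    qed
  qed
qed

lemma prob_history:
  assumes "z 0 = (0, 0)"
  shows "prob (history n z) = (\<Prod>i<n. aniso_step p (z i) (z (Suc i)))"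
  using history_cylinder[where z=z and n=n, OF assms]
proof (elim disjE exE conjE)
  fix h c b s t
  assume *: "h \<le> n" "\<forall>i. 0 \<le> c i \<and> c i \<le> (1::real)" "is_signs s" "is_signs t" "history n z = cylinder n h c b s t"
     "(\<Prod>i<n. if b i then c i else 1 - c i) * (1/2) ^ n = (\<Prod>i<n. aniso_step p (z i) (z (Suc i)))"
  have "prob (cylinder n h c b s t) = (\<Prod>i<n. if b i then c i else 1 - c i) * (1/2) ^ h * (1/2) ^ (n - h)"
    unfolding cylinder_def using * by (intro joint) (auto simp: is_signs_def)
  also have "\<dots> = (\<Prod>i<n. if b i then c i else 1 - c i) * (1/2) ^ n"
    using *(1) by (simp add: mult.assoc flip: power_add)
  finally show ?thesis using * by simp
qed simp

theorem aniso_walk_Z: "aniso_walk p M Z"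
  unfolding aniso_walk_def
proof (intro conjI allI ballI impI)
  fix n z w
  assume pos: "0 < prob {\<omega>\<in>space M. \<forall>i\<le>n. Z i \<omega> = z i}"
  have z0: "z 0 = (0, 0)"
  proof (rule ccontr)
    assume "z 0 \<noteq> (0, 0)"
    then have "{\<omega>\<in>space M. \<forall>i\<le>n. Z i \<omega> = z i} = {}" by (auto simp: Z_def S1_def S2_def)
    then show False using pos by (metis measure_empty less_irrefl)
  qed
  let ?z = "z(Suc n := w)"
  have "{\<omega>\<in>space M. Z (Suc n) \<omega> = w \<and> (\<forall>i\<le>n. Z i \<omega> = z i)} = history (Suc n) ?z"
    by (auto simp: history_def le_Suc_eq)
  then have "prob {\<omega>\<in>space M. Z (Suc n) \<omega> = w \<and> (\<forall>i\<le>n. Z i \<omega> = z i)} = (\<Prod>i<Suc n. aniso_step p (?z i) (?z (Suc i)))"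
    using prob_history[where z="?z" and n="Suc n"] z0 by simp
  also have "\<dots> = (\<Prod>i<n. aniso_step p (z i) (z (Suc i))) * aniso_step p (z n) w"
    by simp
  also have "(\<Prod>i<n. aniso_step p (z i) (z (Suc i))) = prob {\<omega>\<in>space M. \<forall>i\<le>n. Z i \<omega> = z i}"
    using prob_history[where z=z and n=n, OF z0] by (simp add: history_def)
  finally show "\<P>(\<omega> in M. Z (Suc n) \<omega> = w \<bar> \<forall>i\<le>n. Z i \<omega> = z i) = aniso_step p (z n) w"
    using pos by (simp add: cond_prob_def)
qed (auto simp: prob_space_axioms Z_def S1_def S2_def)

end

section \<open>Number of horizontal moves\<close>

text \<open>At a fixed time the walk has only finitely many histories, so every function of the
  history is integrable and its expectation a finite sum.\<close>

lemma (in prob_space) expectation_finite_range: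
  fixes f :: "'b \<Rightarrow> real"
  assumes X: "X \<in> measurable M (count_space UNIV)" and A: "finite A" "\<And>\<omega>. \<omega> \<in> space M \<Longrightarrow> X \<omega> \<in> A"
  shows "integrable M (\<lambda>\<omega>. f (X \<omega>))"
    and "expectation (\<lambda>\<omega>. f (X \<omega>)) = (\<Sum>a\<in>A. f a * prob {\<omega>\<in>space M. X \<omega> = a})"
proof -
  have m: "{\<omega>\<in>space M. X \<omega> = a} \<in> events" for a
    using measurable_sets[OF X, of "{a}"] by (simp add: vimage_def Int_def conj_commute)
  have eq: "f (X \<omega>) = (\<Sum>a\<in>A. f a * indicator {\<omega>\<in>space M. X \<omega> = a} \<omega>)" if "\<omega> \<in> space M" for \<omega>
    using A(1) A(2)[OF that] that by (simp add: indicator_def if_distrib[of "\<lambda>c. _ * c"] sum.delta cong: if_cong)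
  have i: "integrable M (\<lambda>\<omega>. f a * indicator {\<omega>\<in>space M. X \<omega> = a} \<omega>)" for a
    using m by (intro integrable_mult_right integrable_real_indicator) (auto simp: emeasure_eq_measure)
  have "integrable M (\<lambda>\<omega>. \<Sum>a\<in>A. f a * indicator {\<omega>\<in>space M. X \<omega> = a} \<omega>)"
    using i by (rule Bochner_Integration.integrable_sum)
  then show "integrable M (\<lambda>\<omega>. f (X \<omega>))"
    by (rule Bochner_Integration.integrable_cong[THEN iffD1, rotated -1]) (auto simp: eq)
  have "expectation (\<lambda>\<omega>. f (X \<omega>)) = expectation (\<lambda>\<omega>. \<Sum>a\<in>A. f a * indicator {\<omega>\<in>space M. X \<omega> = a} \<omega>)"
    by (intro Bochner_Integration.integral_cong) (auto simp: eq)
  also have "\<dots> = (\<Sum>a\<in>A. f a * prob {\<omega>\<in>space M. X \<omega> = a})"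
    by (subst Bochner_Integration.integral_sum[OF i]) (simp add: m)
  finally show "expectation (\<lambda>\<omega>. f (X \<omega>)) = (\<Sum>a\<in>A. f a * prob {\<omega>\<in>space M. X \<omega> = a})" .
qed

definition nbrs :: "int \<times> int \<Rightarrow> (int \<times> int) set" where
  "nbrs z = {(fst z + 1, snd z), (fst z - 1, snd z), (fst z, snd z + 1), (fst z, snd z - 1)}"

text \<open>The law of the walk forces steps to neighbours only almost surely. \<open>Z_nbr\<close>
  asks for them at every sample point, which makes the set of possible histories finite.\<close>

locale nn_walk = prob_space M for M :: "'a measure" +
  fixes p :: "int \<Rightarrow> real" and Z :: "nat \<Rightarrow> 'a \<Rightarrow> int \<times> int"
  assumes p_bounds: "\<And>j. 0 < p j \<and> p j \<le> 1 / 2"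
    and walk: "aniso_walk p M Z"
    and Z_nbr: "\<And>n \<omega>. \<omega> \<in> space M \<Longrightarrow> Z (Suc n) \<omega> \<in> nbrs (Z n \<omega>)"
begin

lemma Z_measurable[measurable]: "Z n \<in> measurable M (count_space UNIV)"
  and Z_0: "\<omega> \<in> space M \<Longrightarrow> Z 0 \<omega> = (0, 0)"
  using walk by (auto simp: aniso_walk_def)

lemma Z_step: "prob {\<omega>\<in>space M. \<forall>i\<le>n. Z i \<omega> = z i} > 0 \<Longrightarrow>
        \<P>(\<omega> in M. Z (Suc n) \<omega> = w \<bar> \<forall>i\<le>n. Z i \<omega> = z i) = aniso_step p (z n) w"
  using walk unfolding aniso_walk_def by blast

definition hist :: "nat \<Rightarrow> 'a \<Rightarrow> (int \<times> int) list" where "hist n \<omega> = map (\<lambda>i. Z i \<omega>) [0..<Suc n]"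

lemma hist_measurable[measurable]: "hist n \<in> measurable M (count_space UNIV)"
proof (induction n)
  case 0
  have "hist 0 = (\<lambda>\<omega>. [Z 0 \<omega>])" by (simp add: hist_def[abs_def])
  then show ?case by simp
next
  case (Suc n)
  have "hist (Suc n) = (\<lambda>\<omega>. hist n \<omega> @ [Z (Suc n) \<omega>])" by (simp add: hist_def[abs_def])
  then show ?case using measurable_count_space_binop[OF Suc Z_measurable[of "Suc n"], of "\<lambda>l z. l @ [z]"] by simp
qed

lemma hist_nth: "i \<le> n \<Longrightarrow> hist n \<omega> ! i = Z i \<omega>"
  by (simp add: hist_def less_Suc_eq_le del: upt_Suc)

lemma length_hist: "length (hist n \<omega>) = Suc n"
  by (simp add: hist_def)

definition grid :: "nat \<Rightarrow> (int \<times> int) set" where "grid n = {- int n..int n} \<times> {- int n..int n}"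
definition paths :: "nat \<Rightarrow> (int \<times> int) list set" where "paths n = {l. set l \<subseteq> grid n \<and> length l = Suc n}"

lemma finite_grid: "finite (grid n)" by (simp add: grid_def)
lemma finite_paths: "finite (paths n)" unfolding paths_def using finite_grid by (rule finite_lists_length_eq)
lemma grid_mono: "m \<le> n \<Longrightarrow> grid m \<subseteq> grid n" by (auto simp: grid_def)
lemma nbrs_grid: "z \<in> grid n \<Longrightarrow> nbrs z \<subseteq> grid (Suc n)" by (auto simp: grid_def nbrs_def)

lemma Z_in_grid: "\<omega> \<in> space M \<Longrightarrow> Z n \<omega> \<in> grid n"
proof (induction n)
  case 0 then show ?case by (simp add: Z_0 grid_def)
next
  case (Suc n) then show ?case using nbrs_grid Z_nbr by blast
qed

lemma hist_in_paths: "\<omega> \<in> space M \<Longrightarrow> hist n \<omega> \<in> paths n"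
proof -
  assume w: "\<omega> \<in> space M"
  have "Z i \<omega> \<in> grid n" if "i \<le> n" for i using Z_in_grid[OF w, of i] grid_mono[OF that] by blast
  then show ?thesis by (auto simp: paths_def hist_def simp del: upt_Suc)
qed

definition avg :: "(int \<times> int \<Rightarrow> int \<times> int \<Rightarrow> real) \<Rightarrow> int \<times> int \<Rightarrow> real" where
  "avg g z = p (fst z) * (g z (fst z + 1, snd z) + g z (fst z - 1, snd z))
     + (1 / 2 - p (fst z)) * (g z (fst z, snd z + 1) + g z (fst z, snd z - 1))"

lemma sum_aniso_step:
  assumes "z \<in> grid n" shows "(\<Sum>w\<in>grid (Suc n). aniso_step p z w * g z w) = avg g z"
proof -
  obtain x y where z: "z = (x, y)" by (cases z)
  have "(\<Sum>w\<in>grid (Suc n). aniso_step p z w * g z w) = (\<Sum>w\<in>nbrs z. aniso_step p z w * g z w)"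
    using nbrs_grid[OF assms] finite_grid by (intro sum.mono_neutral_right) (auto simp: aniso_step_def nbrs_def z)
  also have "\<dots> = aniso_step p z (x + 1, y) * g z (x + 1, y) + aniso_step p z (x - 1, y) * g z (x - 1, y)
      + aniso_step p z (x, y + 1) * g z (x, y + 1) + aniso_step p z (x, y - 1) * g z (x, y - 1)"
    by (simp add: nbrs_def z)
  finally have eq: "(\<Sum>w\<in>grid (Suc n). aniso_step p z w * g z w) = aniso_step p z (x + 1, y) * g z (x + 1, y) + aniso_step p z (x - 1, y) * g z (x - 1, y)
      + aniso_step p z (x, y + 1) * g z (x, y + 1) + aniso_step p z (x, y - 1) * g z (x, y - 1)" .
  have st: "aniso_step p z (x + 1, y) = p x" "aniso_step p z (x - 1, y) = p x"
    "aniso_step p z (x, y + 1) = 1 / 2 - p x" "aniso_step p z (x, y - 1) = 1 / 2 - p x" by (simp_all add: aniso_step_def z)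
  show ?thesis unfolding eq st by (simp add: avg_def z distrib_left)
qed

text \<open>The Markov property in integrated form: \<open>avg g\<close> is the mean of
  \<open>g\<close> over the next step, and \<open>F\<close> is an arbitrary weight depending on the
  past. With \<open>F\<close> equal to the earlier value of a martingale it yields orthogonality of
  increments.\<close>

lemma one_step:
  "integrable M (\<lambda>\<omega>. F (hist n \<omega>) * g (Z n \<omega>) (Z (Suc n) \<omega>))"
  "expectation (\<lambda>\<omega>. F (hist n \<omega>) * g (Z n \<omega>) (Z (Suc n) \<omega>)) = expectation (\<lambda>\<omega>. F (hist n \<omega>) * avg g (Z n \<omega>))"
proof -
  define X where "X \<omega> = (hist n \<omega>, Z (Suc n) \<omega>)" for \<omega>
  have mX: "X \<in> measurable M (count_space UNIV)" unfolding X_def[abs_def]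
    by (rule measurable_count_space_binop[OF hist_measurable Z_measurable])
  have X_in: "X \<omega> \<in> paths n \<times> grid (Suc n)" if "\<omega> \<in> space M" for \<omega>
    using that hist_in_paths Z_in_grid by (simp add: X_def)
  have fin: "finite (paths n \<times> grid (Suc n))" using finite_paths finite_grid by simp
  have eqX: "F (hist n \<omega>) * g (Z n \<omega>) (Z (Suc n) \<omega>) = (case X \<omega> of (l, w) \<Rightarrow> F l * g (l ! n) w)" for \<omega>
    by (simp add: X_def hist_nth)
  show "integrable M (\<lambda>\<omega>. F (hist n \<omega>) * g (Z n \<omega>) (Z (Suc n) \<omega>))"
    unfolding eqX by (rule expectation_finite_range(1)[OF mX fin X_in])
  have pr: "prob {\<omega>\<in>space M. X \<omega> = (l, w)} = prob {\<omega>\<in>space M. hist n \<omega> = l} * aniso_step p (l ! n) w" if l: "l \<in> paths n" for l w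
  proof -
    have iff: "hist n \<omega> = l \<longleftrightarrow> (\<forall>i\<le>n. Z i \<omega> = l ! i)" for \<omega>
      using l by (auto simp: list_eq_iff_nth_eq length_hist paths_def hist_nth less_Suc_eq_le)
    have *: "{\<omega>\<in>space M. X \<omega> = (l, w)} = {\<omega>\<in>space M. Z (Suc n) \<omega> = w \<and> (\<forall>i\<le>n. Z i \<omega> = l ! i)}"
      "{\<omega>\<in>space M. hist n \<omega> = l} = {\<omega>\<in>space M. \<forall>i\<le>n. Z i \<omega> = l ! i}"
      unfolding X_def prod.inject iff by auto
    show ?thesis
    proof (cases "prob {\<omega>\<in>space M. \<forall>i\<le>n. Z i \<omega> = l ! i} > 0")
      case True
      have "prob {\<omega>\<in>space M. Z (Suc n) \<omega> = w \<and> (\<forall>i\<le>n. Z i \<omega> = l ! i)} / prob {\<omega>\<in>space M. \<forall>i\<le>n. Z i \<omega> = l ! i} = aniso_step p (l ! n) w"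
        using Z_step[OF True, of w] unfolding cond_prob_def .
      then have "prob {\<omega>\<in>space M. Z (Suc n) \<omega> = w \<and> (\<forall>i\<le>n. Z i \<omega> = l ! i)} = aniso_step p (l ! n) w * prob {\<omega>\<in>space M. \<forall>i\<le>n. Z i \<omega> = l ! i}"
        by (subst (asm) nonzero_divide_eq_eq) (use True in auto)
      then show ?thesis unfolding * by (simp only: mult.commute)
    next
      \<comment> \<open>For a history of probability 0 the transition probability is unspecified,
        but both sides vanish.\<close>
      case False
      then have 0: "prob {\<omega>\<in>space M. \<forall>i\<le>n. Z i \<omega> = l ! i} = 0" by (simp add: zero_less_measure_iff)
      have "{\<omega>\<in>space M. \<forall>i\<le>n. Z i \<omega> = l ! i} \<in> events" unfolding *(2)[symmetric] by measurable
      then have "prob {\<omega>\<in>space M. Z (Suc n) \<omega> = w \<and> (\<forall>i\<le>n. Z i \<omega> = l ! i)} \<le> prob {\<omega>\<in>space M. \<forall>i\<le>n. Z i \<omega> = l ! i}"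
        by (intro finite_measure_mono) auto
      then show ?thesis unfolding * using 0 measure_nonneg[of M "{\<omega>\<in>space M. Z (Suc n) \<omega> = w \<and> (\<forall>i\<le>n. Z i \<omega> = l ! i)}"] by simp
    qed
  qed
  have "expectation (\<lambda>\<omega>. F (hist n \<omega>) * g (Z n \<omega>) (Z (Suc n) \<omega>))
     = (\<Sum>a\<in>paths n \<times> grid (Suc n). (case a of (l, w) \<Rightarrow> F l * g (l ! n) w) * prob {\<omega>\<in>space M. X \<omega> = a})"
    unfolding eqX by (rule expectation_finite_range(2)[OF mX fin X_in])
  also have "\<dots> = (\<Sum>l\<in>paths n. \<Sum>w\<in>grid (Suc n). F l * g (l ! n) w * prob {\<omega>\<in>space M. X \<omega> = (l, w)})"
    by (simp add: sum.cartesian_product case_prod_beta)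
  also have "\<dots> = (\<Sum>l\<in>paths n. F l * avg g (l ! n) * prob {\<omega>\<in>space M. hist n \<omega> = l})"
  proof (rule sum.cong[OF refl])
    fix l assume l: "l \<in> paths n"
    then have "l ! n \<in> grid n" by (auto simp: paths_def)
    from sum_aniso_step[OF this, of g]
    have "F l * avg g (l ! n) * prob {\<omega>\<in>space M. hist n \<omega> = l} = (\<Sum>w\<in>grid (Suc n). F l * (aniso_step p (l ! n) w * g (l ! n) w) * prob {\<omega>\<in>space M. hist n \<omega> = l})"
      by (simp only: sum_distrib_left[symmetric] sum_distrib_right[symmetric])
    also have "\<dots> = (\<Sum>w\<in>grid (Suc n). F l * g (l ! n) w * prob {\<omega>\<in>space M. X \<omega> = (l, w)})"
      by (intro sum.cong refl) (simp add: pr[OF l] mult_ac)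
    finally show "(\<Sum>w\<in>grid (Suc n). F l * g (l ! n) w * prob {\<omega>\<in>space M. X \<omega> = (l, w)}) = F l * avg g (l ! n) * prob {\<omega>\<in>space M. hist n \<omega> = l}" by simp
  qed
  also have "\<dots> = expectation (\<lambda>\<omega>. F (hist n \<omega>) * avg g (hist n \<omega> ! n))"
    by (rule expectation_finite_range(2)[OF hist_measurable finite_paths hist_in_paths, symmetric])
  finally show "expectation (\<lambda>\<omega>. F (hist n \<omega>) * g (Z n \<omega>) (Z (Suc n) \<omega>)) = expectation (\<lambda>\<omega>. F (hist n \<omega>) * avg g (Z n \<omega>))"
    by (simp add: hist_nth)
qed

lemma integrable_hist: "integrable M (\<lambda>\<omega>. F (hist n \<omega>) :: real)"
  by (rule expectation_finite_range(1)[OF hist_measurable finite_paths hist_in_paths])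

lemma integrable_Z: "integrable M (\<lambda>\<omega>. f (Z n \<omega>) :: real)"
  using integrable_hist[of "\<lambda>l. f (l ! n)" n] by (simp add: hist_nth)

text \<open>From column x the mean of the squared first coordinate grows by 2 p(x), which is at most
  1.\<close>

lemma second_moment_X: "expectation (\<lambda>\<omega>. (real_of_int (fst (Z n \<omega>)))\<^sup>2) \<le> real n"
proof (induction n)
  case 0
  have "expectation (\<lambda>\<omega>. (real_of_int (fst (Z 0 \<omega>)))\<^sup>2) = expectation (\<lambda>\<omega>. 0)"
    by (intro Bochner_Integration.integral_cong) (auto simp: Z_0)
  then show ?case by simp
next
  case (Suc n)
  have "expectation (\<lambda>\<omega>. (real_of_int (fst (Z (Suc n) \<omega>)))\<^sup>2) = expectation (\<lambda>\<omega>. avg (\<lambda>z w. (real_of_int (fst w))\<^sup>2) (Z n \<omega>))"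
    using one_step(2)[of "\<lambda>_. 1" n "\<lambda>z w. (real_of_int (fst w))\<^sup>2"] by simp
  also have "\<dots> \<le> expectation (\<lambda>\<omega>. (real_of_int (fst (Z n \<omega>)))\<^sup>2 + 1)"
  proof (rule integral_mono)
    fix \<omega>
    obtain x y where z: "Z n \<omega> = (x, y)" by (cases "Z n \<omega>")
    have "avg (\<lambda>z w. (real_of_int (fst w))\<^sup>2) (Z n \<omega>) = (real_of_int x)\<^sup>2 + 2 * p x"
      by (simp add: z avg_def power2_eq_square algebra_simps)
    then show "avg (\<lambda>z w. (real_of_int (fst w))\<^sup>2) (Z n \<omega>) \<le> (real_of_int (fst (Z n \<omega>)))\<^sup>2 + 1"
      using p_bounds[of x] z by simp
  next
    show "integrable M (\<lambda>\<omega>. avg (\<lambda>z w. (real_of_int (fst w))\<^sup>2) (Z n \<omega>))" by (rule integrable_Z)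
    show "integrable M (\<lambda>\<omega>. (real_of_int (fst (Z n \<omega>)))\<^sup>2 + 1)"
      by (rule integrable_Z[of "\<lambda>z. (real_of_int (fst z))\<^sup>2 + 1"])
  qed
  also have "\<dots> = expectation (\<lambda>\<omega>. (real_of_int (fst (Z n \<omega>)))\<^sup>2) + 1"
    using integrable_Z[of "\<lambda>z. (real_of_int (fst z))\<^sup>2" n] by (simp add: prob_space)
  finally show ?case using Suc by simp
qed

definition horizontal :: "nat \<Rightarrow> 'a \<Rightarrow> nat" where
  "horizontal n \<omega> = (\<Sum>i<n. of_bool (snd (Z (Suc i) \<omega>) = snd (Z i \<omega>)))"

lemma horizontal_mono: "m \<le> n \<Longrightarrow> horizontal m \<omega> \<le> horizontal n \<omega>"
  unfolding horizontal_def by (rule sum_mono2) auto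

text \<open>If \<open>u\<close> solves the discrete Poisson equation with right-hand side \<open>1/(2p) - \<gamma>\<close>, then
  \<open>u(X\<^sub>n) - n + \<gamma> H\<^sub>n\<close> is a martingale; the hypothesis on \<open>p\<close> makes the gradient \<open>d\<close> of \<open>u\<close> sublinear.\<close>

lemma clock_mean:
  fixes u d :: "int \<Rightarrow> real"
  assumes u: "\<And>x. u (x + 1) - u x = d x" "u 0 = 0"
    and d: "\<And>x. d x - d (x - 1) = inverse (p x) - 2 * \<gamma>" and \<gamma>: "0 < \<gamma>" and \<epsilon>: "0 < \<epsilon>" and C: "0 \<le> C"
    and d_bound: "\<And>x. \<bar>d x\<bar> \<le> C + \<epsilon> * \<bar>real_of_int x\<bar>"
    and u_bound: "\<And>x. \<bar>u x\<bar> \<le> \<bar>real_of_int x\<bar> * (C + \<epsilon> * \<bar>real_of_int x\<bar>)"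
    and N: "1 \<le> N" "n \<le> N"
  shows "expectation (\<lambda>\<omega>. \<bar>real n - \<gamma> * real (horizontal n \<omega>)\<bar>)
    \<le> (2 * (C + \<epsilon> + 1 + \<gamma>)\<^sup>2 + C\<^sup>2) / \<epsilon> + 5 * \<epsilon> * real N"
proof -
  define \<Delta> where "\<Delta> z w = u (fst w) - u (fst z) - 1 + \<gamma> * of_bool (snd w = snd z)" for z w :: "int \<times> int"
  \<comment> \<open>The martingale is written as a function of the list of positions, the form in
    which \<open>one_step\<close> accepts a weight.\<close>
  define KF where "KF n l = (\<Sum>i<n. \<Delta> (l ! i) (l ! Suc i))" for n and l :: "(int \<times> int) list"
  define K where "K n \<omega> = KF n (hist n \<omega>)" for n \<omega>
  \<comment> \<open>A horizontal step changes \<open>u\<close> by \<open>d x\<close> or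
    \<open>- d (x - 1)\<close>. The summand \<epsilon> pays for bounding the latter in terms of x,
    and 1 + \<gamma> bounds the remaining terms of \<Delta>.\<close>
  define C' where "C' = C + \<epsilon> + 1 + \<gamma>"
  have K_sum: "K n \<omega> = (\<Sum>i<n. \<Delta> (Z i \<omega>) (Z (Suc i) \<omega>))" for n \<omega>
    unfolding K_def KF_def by (intro sum.cong) (auto simp: hist_nth)
  have K_eq: "K n \<omega> = u (fst (Z n \<omega>)) - real n + \<gamma> * real (horizontal n \<omega>)" if "\<omega> \<in> space M" for n \<omega>
    unfolding K_sum by (induction n) (auto simp: Z_0[OF that] u(2) horizontal_def \<Delta>_def algebra_simps)
  \<comment> \<open>The martingale property. The second difference of \<open>u\<close> enters with
    weight p(x) and the term with \<gamma> with weight 2 p(x), so the Poisson equation balances the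
    loss of 1 per step.\<close>
  have avg0: "avg \<Delta> z = 0" for z
  proof -
    have "u (fst z + 1) + u (fst z - 1) - 2 * u (fst z) = inverse (p (fst z)) - 2 * \<gamma>"
      using u(1)[of "fst z"] u(1)[of "fst z - 1"] d[of "fst z"] by simp
    moreover have "avg \<Delta> z = p (fst z) * (u (fst z + 1) + u (fst z - 1) - 2 * u (fst z)) + p (fst z) * 2 * \<gamma> - 1"
      by (simp add: avg_def \<Delta>_def algebra_simps)
    ultimately show ?thesis using p_bounds[of "fst z"] by (simp add: right_diff_distrib)
  qed
  have \<Delta>_bound: "\<bar>\<Delta> (Z i \<omega>) (Z (Suc i) \<omega>)\<bar> \<le> C' + \<epsilon> * \<bar>real_of_int (fst (Z i \<omega>))\<bar>" if w: "\<omega> \<in> space M" for i \<omega>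
  proof -
    obtain x y where z: "Z i \<omega> = (x, y)" by (cases "Z i \<omega>")
    have "\<bar>real_of_int (x - 1)\<bar> \<le> \<bar>real_of_int x\<bar> + 1" by auto
    then have "\<epsilon> * \<bar>real_of_int (x - 1)\<bar> \<le> \<epsilon> * (\<bar>real_of_int x\<bar> + 1)" using \<epsilon> by (intro mult_left_mono) auto
    then have 1: "\<bar>d (x - 1)\<bar> \<le> C + \<epsilon> + \<epsilon> * \<bar>real_of_int x\<bar>" using d_bound[of "x - 1"] by (simp add: algebra_simps)
    have 2: "\<bar>d x\<bar> \<le> C + \<epsilon> + \<epsilon> * \<bar>real_of_int x\<bar>" using d_bound[of x] \<epsilon> by simp
    have "0 \<le> \<epsilon> * \<bar>real_of_int x\<bar>" using \<epsilon> by simp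
    moreover consider "Z (Suc i) \<omega> = (x + 1, y)" | "Z (Suc i) \<omega> = (x - 1, y)" | "Z (Suc i) \<omega> = (x, y + 1)" | "Z (Suc i) \<omega> = (x, y - 1)"
      using Z_nbr[OF w, of i] unfolding nbrs_def z by auto
    then have "\<Delta> (Z i \<omega>) (Z (Suc i) \<omega>) = d x - 1 + \<gamma> \<or> \<Delta> (Z i \<omega>) (Z (Suc i) \<omega>) = - d (x - 1) - 1 + \<gamma> \<or> \<Delta> (Z i \<omega>) (Z (Suc i) \<omega>) = - 1"
      by cases (use u(1)[of x] u(1)[of "x - 1"] in \<open>simp_all add: \<Delta>_def z\<close>)
    ultimately have "\<bar>\<Delta> (Z i \<omega>) (Z (Suc i) \<omega>)\<bar> \<le> C + \<epsilon> + \<epsilon> * \<bar>real_of_int x\<bar> + 1 + \<gamma>"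
      using 1 2 \<gamma> C \<epsilon> by linarith
    then show ?thesis by (simp add: z C'_def)
  qed
  \<comment> \<open>Martingale increments are orthogonal, so the second moments of the increments
    add up; each is controlled by the second moment of the first coordinate, at most
    \<open>N\<close>.\<close>
  have K2: "expectation (\<lambda>\<omega>. (K n \<omega>)\<^sup>2) \<le> real n * (2 * C'\<^sup>2 + 2 * \<epsilon>\<^sup>2 * real N)" if "n \<le> N" for n
    using that
  proof (induction n)
    case 0 then show ?case by (simp add: K_sum)
  next
    case (Suc n)
    note i1 = integrable_hist[of "\<lambda>l. (KF n l)\<^sup>2" n, folded K_def]
    note i2 = one_step(1)[of "KF n" n \<Delta>, folded K_def]
    note i3 = one_step(1)[of "\<lambda>_. 1" n "\<lambda>z w. (\<Delta> z w)\<^sup>2", unfolded mult_1]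
    have e2: "expectation (\<lambda>\<omega>. K n \<omega> * \<Delta> (Z n \<omega>) (Z (Suc n) \<omega>)) = 0"
      using one_step(2)[of "KF n" n \<Delta>, folded K_def] by (simp add: avg0)
    have "expectation (\<lambda>\<omega>. (\<Delta> (Z n \<omega>) (Z (Suc n) \<omega>))\<^sup>2) \<le> expectation (\<lambda>\<omega>. 2 * C'\<^sup>2 + 2 * \<epsilon>\<^sup>2 * (real_of_int (fst (Z n \<omega>)))\<^sup>2)"
    proof (rule integral_mono[OF i3])
      show "integrable M (\<lambda>\<omega>. 2 * C'\<^sup>2 + 2 * \<epsilon>\<^sup>2 * (real_of_int (fst (Z n \<omega>)))\<^sup>2)"
        by (rule integrable_Z[of "\<lambda>z. 2 * C'\<^sup>2 + 2 * \<epsilon>\<^sup>2 * (real_of_int (fst z))\<^sup>2"])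
      fix \<omega> assume w: "\<omega> \<in> space M"
      have sq: "(a + b)\<^sup>2 \<le> 2 * a\<^sup>2 + 2 * b\<^sup>2" for a b :: real
        using zero_le_power2[of "a - b"] by (simp add: power2_eq_square algebra_simps)
      have "(\<Delta> (Z n \<omega>) (Z (Suc n) \<omega>))\<^sup>2 \<le> (C' + \<epsilon> * \<bar>real_of_int (fst (Z n \<omega>))\<bar>)\<^sup>2"
        using power_mono[OF \<Delta>_bound[OF w, of n] abs_ge_zero, of 2] by simp
      also have "\<dots> \<le> 2 * C'\<^sup>2 + 2 * \<epsilon>\<^sup>2 * (real_of_int (fst (Z n \<omega>)))\<^sup>2"
        using sq[of C' "\<epsilon> * \<bar>real_of_int (fst (Z n \<omega>))\<bar>"] by (simp add: power_mult_distrib)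
      finally show "(\<Delta> (Z n \<omega>) (Z (Suc n) \<omega>))\<^sup>2 \<le> 2 * C'\<^sup>2 + 2 * \<epsilon>\<^sup>2 * (real_of_int (fst (Z n \<omega>)))\<^sup>2" .
    qed
    also have "\<dots> = 2 * C'\<^sup>2 + 2 * \<epsilon>\<^sup>2 * expectation (\<lambda>\<omega>. (real_of_int (fst (Z n \<omega>)))\<^sup>2)"
      using integrable_Z[of "\<lambda>z. (real_of_int (fst z))\<^sup>2" n] by (simp add: prob_space)
    also have "\<dots> \<le> 2 * C'\<^sup>2 + 2 * \<epsilon>\<^sup>2 * real N"
      using second_moment_X[of n] Suc.prems \<epsilon> by (intro add_left_mono mult_left_mono) auto
    finally have e3: "expectation (\<lambda>\<omega>. (\<Delta> (Z n \<omega>) (Z (Suc n) \<omega>))\<^sup>2) \<le> 2 * C'\<^sup>2 + 2 * \<epsilon>\<^sup>2 * real N" .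
    have "K (Suc n) \<omega> = K n \<omega> + \<Delta> (Z n \<omega>) (Z (Suc n) \<omega>)" for \<omega> by (simp add: K_sum)
    then have "expectation (\<lambda>\<omega>. (K (Suc n) \<omega>)\<^sup>2) = expectation (\<lambda>\<omega>. ((K n \<omega>)\<^sup>2 + 2 * (K n \<omega> * \<Delta> (Z n \<omega>) (Z (Suc n) \<omega>))) + (\<Delta> (Z n \<omega>) (Z (Suc n) \<omega>))\<^sup>2)"
      by (simp add: power2_sum algebra_simps)
    also have "\<dots> = expectation (\<lambda>\<omega>. (K n \<omega>)\<^sup>2) + 2 * 0 + expectation (\<lambda>\<omega>. (\<Delta> (Z n \<omega>) (Z (Suc n) \<omega>))\<^sup>2)"
      using i1 i2 i3 e2 by simp
    also have "\<dots> \<le> real (Suc n) * (2 * C'\<^sup>2 + 2 * \<epsilon>\<^sup>2 * real N)"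
      using Suc.IH Suc.prems e3 by (simp add: algebra_simps)
    finally show ?case .
  qed
  \<comment> \<open>The second moment of the martingale is about \<epsilon>^2 N^2. Splitting |k|
    into k^2/a + a with a = \<epsilon> N keeps both parts of order \<epsilon> N.\<close>
  let ?a = "\<epsilon> * real N"
  have a: "0 < ?a" using \<epsilon> N by simp
  note iK = integrable_hist[of "\<lambda>l. (KF n l)\<^sup>2" n, folded K_def]
  note iX = integrable_Z[of "\<lambda>z. (real_of_int (fst z))\<^sup>2" n]
  have "expectation (\<lambda>\<omega>. \<bar>real n - \<gamma> * real (horizontal n \<omega>)\<bar>)
    \<le> expectation (\<lambda>\<omega>. ((K n \<omega>)\<^sup>2 / ?a + ?a) + (C\<^sup>2 / \<epsilon> + 2 * \<epsilon> * (real_of_int (fst (Z n \<omega>)))\<^sup>2))"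
  proof (rule integral_mono)
    have "integrable M (\<lambda>\<omega>. \<bar>u (fst (hist n \<omega> ! n)) - KF n (hist n \<omega>)\<bar>)" by (rule integrable_hist)
    then show "integrable M (\<lambda>\<omega>. \<bar>real n - \<gamma> * real (horizontal n \<omega>)\<bar>)"
      by (rule Bochner_Integration.integrable_cong[THEN iffD1, rotated -1]) (auto simp: hist_nth K_eq[unfolded K_def])
    show "integrable M (\<lambda>\<omega>. ((K n \<omega>)\<^sup>2 / ?a + ?a) + (C\<^sup>2 / \<epsilon> + 2 * \<epsilon> * (real_of_int (fst (Z n \<omega>)))\<^sup>2))"
      using iK iX by simp
    fix \<omega> assume w: "\<omega> \<in> space M"
    have amgm: "\<bar>k\<bar> \<le> k\<^sup>2 / b + b" if "0 < b" for k b :: real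
    proof (cases "\<bar>k\<bar> \<le> b")
      case True
      have "0 \<le> k\<^sup>2 / b" using that by simp
      then show ?thesis using True by linarith
    next
      case False
      then have "b * \<bar>k\<bar> \<le> \<bar>k\<bar> * \<bar>k\<bar>" by (intro mult_right_mono) auto
      then have "\<bar>k\<bar> \<le> k\<^sup>2 / b" using that by (simp add: le_divide_eq power2_eq_square mult.commute)
      then show ?thesis using that by linarith
    qed
    have "\<bar>real n - \<gamma> * real (horizontal n \<omega>)\<bar> \<le> \<bar>K n \<omega>\<bar> + \<bar>u (fst (Z n \<omega>))\<bar>"
      unfolding K_eq[OF w] by linarith
    also have "\<bar>K n \<omega>\<bar> \<le> (K n \<omega>)\<^sup>2 / ?a + ?a" by (rule amgm[OF a])
    also have "\<bar>u (fst (Z n \<omega>))\<bar> \<le> C\<^sup>2 / \<epsilon> + 2 * \<epsilon> * (real_of_int (fst (Z n \<omega>)))\<^sup>2"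
    proof -
      define x where "x = \<bar>real_of_int (fst (Z n \<omega>))\<bar>"
      have "C * x \<le> C\<^sup>2 / \<epsilon> + \<epsilon> * x\<^sup>2"
      proof -
        have "0 \<le> (C / \<epsilon> - x)\<^sup>2 * \<epsilon>" using \<epsilon> by simp
        also have "\<dots> = C\<^sup>2 / \<epsilon> - 2 * (C * x) + \<epsilon> * x\<^sup>2" using \<epsilon> by (simp add: power2_eq_square field_simps)
        finally have "2 * (C * x) \<le> C\<^sup>2 / \<epsilon> + \<epsilon> * x\<^sup>2" by simp
        moreover have "0 \<le> C * x" using C by (simp add: x_def)
        ultimately show ?thesis by linarith
      qed
      moreover have "x * (C + \<epsilon> * x) = C * x + \<epsilon> * x\<^sup>2" by (simp add: power2_eq_square algebra_simps)
      moreover have "x\<^sup>2 = (real_of_int (fst (Z n \<omega>)))\<^sup>2" by (simp add: x_def)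
      ultimately show ?thesis using u_bound[of "fst (Z n \<omega>)"] unfolding x_def[symmetric] by simp
    qed
    finally show "\<bar>real n - \<gamma> * real (horizontal n \<omega>)\<bar> \<le> ((K n \<omega>)\<^sup>2 / ?a + ?a) + (C\<^sup>2 / \<epsilon> + 2 * \<epsilon> * (real_of_int (fst (Z n \<omega>)))\<^sup>2)" by simp
  qed
  also have "\<dots> = (expectation (\<lambda>\<omega>. (K n \<omega>)\<^sup>2) / ?a + ?a) + (C\<^sup>2 / \<epsilon> + 2 * \<epsilon> * expectation (\<lambda>\<omega>. (real_of_int (fst (Z n \<omega>)))\<^sup>2))"
    using iK iX by (simp add: prob_space)
  also have "\<dots> \<le> ((2 * C'\<^sup>2 / \<epsilon> + 2 * \<epsilon> * real N) + ?a) + (C\<^sup>2 / \<epsilon> + 2 * \<epsilon> * real N)"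
  proof (intro add_mono order_refl mult_left_mono)
    have "expectation (\<lambda>\<omega>. (K n \<omega>)\<^sup>2) \<le> real N * (2 * C'\<^sup>2 + 2 * \<epsilon>\<^sup>2 * real N)"
      using K2[OF N(2)] N(2) by (elim order_trans, intro mult_right_mono) auto
    then have "expectation (\<lambda>\<omega>. (K n \<omega>)\<^sup>2) / ?a \<le> real N * (2 * C'\<^sup>2 + 2 * \<epsilon>\<^sup>2 * real N) / ?a" using a by (intro divide_right_mono) auto
    also have "\<dots> = 2 * C'\<^sup>2 / \<epsilon> + 2 * \<epsilon> * real N" using \<epsilon> N by (simp add: field_simps power2_eq_square)
    finally show "expectation (\<lambda>\<omega>. (K n \<omega>)\<^sup>2) / ?a \<le> 2 * C'\<^sup>2 / \<epsilon> + 2 * \<epsilon> * real N" .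
  qed (use second_moment_X[of n] N \<epsilon> in auto)
  also have "\<dots> = (2 * (C + \<epsilon> + 1 + \<gamma>)\<^sup>2 + C\<^sup>2) / \<epsilon> + 5 * \<epsilon> * real N"
    by (simp add: C'_def add_divide_distrib)
  finally show ?thesis .
qed

end

section \<open>Discrete antiderivatives and solution of the Poisson equation\<close>

definition antidiff :: "(int \<Rightarrow> real) \<Rightarrow> int \<Rightarrow> real" where
  "antidiff f x = (if 0 \<le> x then \<Sum>j<nat x. f (int j) else - (\<Sum>j<nat (- x). f (- int j - 1)))"

lemma antidiff_0: "antidiff f 0 = 0" by (simp add: antidiff_def)

text \<open>Below 0 the sum runs over the arguments x, ..., -1 and is counted negatively. The case x
  = -1 stands apart because x + 1 = 0 already falls under the other branch.\<close>

lemma antidiff_diff: "antidiff f (x + 1) - antidiff f x = f x"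
proof (cases "0 \<le> x")
  case True
  then have "nat (x + 1) = Suc (nat x)" by simp
  then show ?thesis using True by (simp add: antidiff_def)
next
  case False
  then have "nat (- x) = Suc (nat (- (x + 1)))" by simp
  moreover have "- int (nat (- (x + 1))) - 1 = x" using False by simp
  ultimately show ?thesis using False by (cases "x = - 1") (auto simp: antidiff_def)
qed

lemma antidiff_bound:
  assumes "\<And>y. \<bar>y\<bar> \<le> \<bar>x\<bar> \<Longrightarrow> \<bar>f y\<bar> \<le> B" shows "\<bar>antidiff f x\<bar> \<le> \<bar>real_of_int x\<bar> * B"
proof (cases "0 \<le> x")
  case True
  have "\<bar>\<Sum>j<nat x. f (int j)\<bar> \<le> (\<Sum>j<nat x. B)"
    using True by (intro sum_abs[THEN order_trans] sum_mono assms) auto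
  then show ?thesis using True by (simp add: antidiff_def)
next
  case False
  have "\<bar>\<Sum>j<nat (- x). f (- int j - 1)\<bar> \<le> (\<Sum>j<nat (- x). B)"
    using False by (intro sum_abs[THEN order_trans] sum_mono assms) auto
  then show ?thesis using False by (simp add: antidiff_def)
qed

text \<open>The limit gives the bound for large k; the finitely many other k are absorbed into the
  constant.\<close>

lemma Cesaro_bound:
  fixes a :: "nat \<Rightarrow> real"
  assumes lim: "(\<lambda>k. (\<Sum>j=1..k. a j) / real k) \<longlonglongrightarrow> c" and \<epsilon>: "0 < \<epsilon>"
  shows "\<exists>C\<ge>0. \<forall>k. \<bar>(\<Sum>j=1..k. a j) - c * real k\<bar> \<le> C + \<epsilon> * real k"
proof -
  let ?s = "\<lambda>k. (\<Sum>j=1..k. a j) - c * real k"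
  obtain N where N: "\<And>k. k \<ge> N \<Longrightarrow> \<bar>(\<Sum>j=1..k. a j) / real k - c\<bar> < \<epsilon>"
    using LIMSEQ_D[OF lim \<epsilon>] by auto
  have "\<bar>?s k\<bar> \<le> (\<Sum>k<Suc N. \<bar>?s k\<bar>) + \<epsilon> * real k" for k
  proof (cases "k \<le> N")
    case True
    then have "\<bar>?s k\<bar> \<le> (\<Sum>k<Suc N. \<bar>?s k\<bar>)" by (intro member_le_sum) auto
    moreover have "0 \<le> \<epsilon> * real k" using \<epsilon> by simp
    ultimately show ?thesis by linarith
  next
    case False
    then have "?s k = ((\<Sum>j=1..k. a j) / real k - c) * real k" by (simp add: left_diff_distrib)
    then have "\<bar>?s k\<bar> = \<bar>(\<Sum>j=1..k. a j) / real k - c\<bar> * real k" by (simp only: abs_mult abs_of_nat)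
    also have "\<dots> \<le> \<epsilon> * real k" using N[of k] False by (intro mult_right_mono) auto
    finally have "\<bar>?s k\<bar> \<le> \<epsilon> * real k" .
    moreover have "0 \<le> (\<Sum>k<Suc N. \<bar>?s k\<bar>)" by (intro sum_nonneg) auto
    ultimately show ?thesis by linarith
  qed
  then show ?thesis by (intro exI[of _ "\<Sum>k<Suc N. \<bar>?s k\<bar>"] conjI allI sum_nonneg) auto
qed

text \<open>The shift by 1 makes the backward difference at x equal to \<open>q x - c\<close>, the
  second difference wanted at x. To the right of 0 the antiderivative is then the centred sum over
  1, ..., x that the hypothesis controls.\<close>

lemma antidiff_sublinear:
  fixes q :: "int \<Rightarrow> real"
  assumes right: "(\<lambda>k::nat. (\<Sum>j=1..k. q (int j)) / real k) \<longlonglongrightarrow> c"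
    and left: "(\<lambda>k::nat. (\<Sum>j=1..k. q (- int j)) / real k) \<longlonglongrightarrow> c" and \<epsilon>: "0 < \<epsilon>"
  shows "\<exists>C\<ge>0. \<forall>x. \<bar>antidiff (\<lambda>y. q (y + 1) - c) x\<bar> \<le> C + \<epsilon> * \<bar>real_of_int x\<bar>"
proof -
  obtain C1 where C1: "0 \<le> C1" "\<And>k. \<bar>(\<Sum>j=1..k. q (int j)) - c * real k\<bar> \<le> C1 + \<epsilon> * real k"
    using Cesaro_bound[OF right \<epsilon>] by auto
  obtain C2 where C2: "0 \<le> C2" "\<And>k. \<bar>(\<Sum>j=1..k. q (- int j)) - c * real k\<bar> \<le> C2 + \<epsilon> * real k"
    using Cesaro_bound[OF left \<epsilon>] by auto
  have "\<bar>antidiff (\<lambda>y. q (y + 1) - c) x\<bar> \<le> (C1 + C2 + \<bar>q 0 - c\<bar>) + \<epsilon> * \<bar>real_of_int x\<bar>" for x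
  proof (cases "0 \<le> x")
    case True
    define k where "k = nat x"
    have x: "x = int k" using True by (simp add: k_def)
    have "antidiff (\<lambda>y. q (y + 1) - c) x = (\<Sum>j<k. q (int (Suc j)) - c)"
      unfolding x antidiff_def by (simp add: add.commute)
    also have "\<dots> = (\<Sum>j=1..k. q (int j)) - c * real k"
      by (simp add: sum_subtractf sum.atLeast1_atMost_eq mult.commute)
    finally show ?thesis using C1(2)[of k] C2(1) x by simp
  next
    case False
    \<comment> \<open>To the left of 0 the sum includes the term \<open>q 0 - c\<close>, about which
      the averages from 1 on say nothing; it is split off and goes into the constant.\<close>
    define k where "k = nat (- x) - 1"
    have x: "x = - int (Suc k)" using False by (simp add: k_def)
    have k: "nat (- x) = Suc k" by (simp add: x)
    have "antidiff (\<lambda>y. q (y + 1) - c) x = - (\<Sum>j<nat (- x). q (- int j) - c)"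
      using False by (simp add: antidiff_def)
    also have "\<dots> = - (\<Sum>j<Suc k. q (- int j) - c)" unfolding k ..
    also have "\<dots> = - ((q 0 - c) + (\<Sum>j<k. q (- int (Suc j)) - c))"
      by (subst sum.lessThan_Suc_shift) simp
    also have "(\<Sum>j<k. q (- int (Suc j)) - c) = (\<Sum>j=1..k. q (- int j)) - c * real k"
      by (simp add: sum_subtractf sum.atLeast1_atMost_eq mult.commute)
    finally have "\<bar>antidiff (\<lambda>y. q (y + 1) - c) x\<bar> \<le> \<bar>q 0 - c\<bar> + (C2 + \<epsilon> * real k)"
      using C2(2)[of k] by linarith
    moreover have "\<epsilon> * real k \<le> \<epsilon> * \<bar>real_of_int x\<bar>" using \<epsilon> x by (intro mult_left_mono) auto
    ultimately show ?thesis using C1(1) by linarith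
  qed
  then show ?thesis using C1(1) C2(1) by (intro exI[of _ "C1 + C2 + \<bar>q 0 - c\<bar>"]) auto
qed

context nn_walk
begin

context
  fixes \<gamma> :: real
  assumes \<gamma>: "1 < \<gamma>"
    and right: "(\<lambda>k::nat. (\<Sum>j=1..k. inverse (p (int j))) / real k) \<longlonglongrightarrow> 2 * \<gamma>"
    and left: "(\<lambda>k::nat. (\<Sum>j=1..k. inverse (p (- int j))) / real k) \<longlonglongrightarrow> 2 * \<gamma>"
begin

lemma clock_mean_sublinear:
  assumes \<epsilon>: "0 < \<epsilon>"
  shows "\<exists>C\<ge>0. \<forall>N\<ge>1. \<forall>n\<le>N. expectation (\<lambda>\<omega>. \<bar>real n - \<gamma> * real (horizontal n \<omega>)\<bar>) \<le> C + \<epsilon> * real N"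
proof -
  define d where "d = antidiff (\<lambda>y. inverse (p (y + 1)) - 2 * \<gamma>)"
  define u where "u = antidiff d"
  \<comment> \<open>The estimate for the mean carries the factor 5 in front of \<epsilon> N.\<close>
  have \<epsilon>5: "0 < \<epsilon> / 5" using \<epsilon> by simp
  obtain C where C: "0 \<le> C" "\<And>x. \<bar>d x\<bar> \<le> C + \<epsilon> / 5 * \<bar>real_of_int x\<bar>"
    unfolding d_def using antidiff_sublinear[OF right left \<epsilon>5] by blast
  have ub: "\<bar>u x\<bar> \<le> \<bar>real_of_int x\<bar> * (C + \<epsilon> / 5 * \<bar>real_of_int x\<bar>)" for x
    unfolding u_def
  proof (rule antidiff_bound)
    fix y :: int assume "\<bar>y\<bar> \<le> \<bar>x\<bar>"
    then have "\<epsilon> / 5 * \<bar>real_of_int y\<bar> \<le> \<epsilon> / 5 * \<bar>real_of_int x\<bar>" using \<epsilon> by (intro mult_left_mono) linarith+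
    then show "\<bar>d y\<bar> \<le> C + \<epsilon> / 5 * \<bar>real_of_int x\<bar>" using C(2)[of y] by linarith
  qed
  have dd: "d x - d (x - 1) = inverse (p x) - 2 * \<gamma>" for x
    using antidiff_diff[of "\<lambda>y. inverse (p (y + 1)) - 2 * \<gamma>" "x - 1"] by (simp add: d_def)
  have uu: "u (x + 1) - u x = d x" "u 0 = 0" for x by (simp_all add: u_def antidiff_diff antidiff_0)
  have \<gamma>0: "0 < \<gamma>" using \<gamma> by simp
  let ?C = "(2 * (C + \<epsilon> / 5 + 1 + \<gamma>)\<^sup>2 + C\<^sup>2) / (\<epsilon> / 5)"
  have "expectation (\<lambda>\<omega>. \<bar>real n - \<gamma> * real (horizontal n \<omega>)\<bar>) \<le> ?C + \<epsilon> * real N" if "1 \<le> N" "n \<le> N" for n N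
    using clock_mean[OF uu dd \<gamma>0 \<epsilon>5 C ub that] by simp
  moreover have "0 \<le> ?C" using \<epsilon> by simp
  ultimately show ?thesis by blast
qed

lemma horizontal_measurable: "(\<lambda>\<omega>. real (horizontal n \<omega>)) \<in> borel_measurable M"
proof -
  have "(\<lambda>\<omega>. real (\<Sum>i<n. of_bool (snd (hist n \<omega> ! Suc i) = snd (hist n \<omega> ! i)))) \<in> borel_measurable M"
    by (rule measurable_compose[OF hist_measurable, of "\<lambda>l. real (\<Sum>i<n. of_bool (snd (l ! Suc i) = snd (l ! i)))"]) simp
  moreover have "(\<Sum>i<n. of_bool (snd (hist n \<omega> ! Suc i) = snd (hist n \<omega> ! i))) = horizontal n \<omega>" for \<omega>
    unfolding horizontal_def by (intro sum.cong) (auto simp: hist_nth)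
  ultimately show ?thesis by simp
qed

text \<open>The estimate in mean holds at single times. Since both k and the number of horizontal
  moves are monotone, control on a grid of mesh \<delta> n / 4 with boundedly many points extends to
  all k by sandwiching.\<close>

theorem clock:
  assumes \<delta>: "0 < \<delta>"
  shows "whp M (\<lambda>n \<omega>. \<forall>k\<le>C * n. \<bar>real k - \<gamma> * real (horizontal k \<omega>)\<bar> \<le> \<delta> * real n)"
  unfolding whp_def
proof safe
  fix \<eta> :: real assume \<eta>: "0 < \<eta>"
  \<comment> \<open>The mesh \<open>g\<close> is \<delta> n / 4 rounded down, at least \<delta> n /
    8, so \<open>J\<close> meshes cover C n.\<close>
  define J where "J = Suc (nat \<lceil>8 * real C / \<delta>\<rceil>)"
  have J: "8 * real C / \<delta> \<le> real J" unfolding J_def by linarith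
  \<comment> \<open>Each of the J + 2 grid times costs at most \<epsilon> (J + 2) by Markov's
    inequality, apart from a term of order 1/n. The product is \<eta>/2.\<close>
  define \<epsilon> where "\<epsilon> = \<eta> / (2 * (real J + 2) ^ 2)"
  have \<epsilon>: "0 < \<epsilon>" using \<eta> by (simp add: \<epsilon>_def)
  obtain C0 where C0: "0 \<le> C0" "\<And>N n. 1 \<le> N \<Longrightarrow> n \<le> N \<Longrightarrow> expectation (\<lambda>\<omega>. \<bar>real n - \<gamma> * real (horizontal n \<omega>)\<bar>) \<le> C0 + \<epsilon> * real N"
    using clock_mean_sublinear[OF \<epsilon>] by blast
  \<comment> \<open>The first bound makes \<delta> n exceed 8, so that rounding loses at most half
    of \<delta> n / 4. The second makes the contribution of the constant \<open>C0\<close> at most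
    \<eta>/2.\<close>
  obtain n1 :: nat where n1: "max (8 / \<delta>) ((real J + 2) * 8 * C0 / (\<delta> * \<eta>)) < real n1" using reals_Archimedean2 by blast
  have "\<exists>B\<in>events. prob B \<le> \<eta> \<and> (\<forall>\<omega>\<in>space M - B. \<forall>k\<le>C * n. \<bar>real k - \<gamma> * real (horizontal k \<omega>)\<bar> \<le> \<delta> * real n)"
    if n: "n1 \<le> n" for n
  proof -
    have n': "8 / \<delta> < real n" "(real J + 2) * 8 * C0 / (\<delta> * \<eta>) < real n" using n n1 by linarith+
    have \<delta>n: "8 < \<delta> * real n" using n'(1) \<delta> by (simp add: divide_less_eq mult.commute)
    have npos: "0 < real n" using n'(1) \<delta> order.strict_trans[of 0 "8 / \<delta>" "real n"] by simp
    define g where "g = nat \<lfloor>\<delta> * real n / 4\<rfloor>"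
    have g: "real g \<le> \<delta> * real n / 4" "\<delta> * real n / 8 \<le> real g" "1 \<le> g"
      using \<delta>n unfolding g_def by linarith+
    have Jg: "real (C * n) \<le> real J * real g"
    proof -
      have "real (C * n) = 8 * real C / \<delta> * (\<delta> * real n / 8)" using \<delta> by simp
      also have "\<dots> \<le> real J * real g" using J g \<delta> npos by (intro mult_mono) auto
      finally show ?thesis .
    qed
    \<comment> \<open>The last grid time; it lies one mesh beyond \<open>J * g\<close>, as the
      sandwich also uses the grid point after k.\<close>
    define N where "N = (J + 1) * g"
    have N: "1 \<le> N" "real N \<le> (real J + 2) * (\<delta> * real n / 4)"
    proof -
      show "1 \<le> N" using g(3) by (simp add: N_def)
      have "real N = (real J + 1) * real g" by (simp add: N_def algebra_simps)
      also have "\<dots> \<le> (real J + 2) * (\<delta> * real n / 4)" using g(1) by (intro mult_mono) auto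
      finally show "real N \<le> (real J + 2) * (\<delta> * real n / 4)" .
    qed
    note [measurable] = horizontal_measurable
    define A where "A k = {\<omega>\<in>space M. \<delta> * real n / 4 \<le> \<bar>real k - \<gamma> * real (horizontal k \<omega>)\<bar>}" for k
    have [measurable]: "A k \<in> events" for k unfolding A_def by measurable
    have pA: "prob (A k) \<le> (C0 + \<epsilon> * real N) / (\<delta> * real n / 4)" if k: "k \<le> N" for k
    proof -
      have "integrable M (\<lambda>\<omega>. \<bar>real k - \<gamma> * real (\<Sum>i<k. of_bool (snd (hist k \<omega> ! Suc i) = snd (hist k \<omega> ! i)))\<bar>)"
        by (rule integrable_hist)
      moreover have "(\<Sum>i<k. of_bool (snd (hist k \<omega> ! Suc i) = snd (hist k \<omega> ! i))) = horizontal k \<omega>" for \<omega>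
        unfolding horizontal_def by (intro sum.cong) (auto simp: hist_nth)
      ultimately have i: "integrable M (\<lambda>\<omega>. \<bar>real k - \<gamma> * real (horizontal k \<omega>)\<bar>)" by simp
      have "prob (A k) \<le> expectation (\<lambda>\<omega>. \<bar>real k - \<gamma> * real (horizontal k \<omega>)\<bar>) / (\<delta> * real n / 4)"
        unfolding A_def using integral_Markov_inequality_measure[OF i, of "{}" "\<delta> * real n / 4"] \<delta>n by simp
      also have "\<dots> \<le> (C0 + \<epsilon> * real N) / (\<delta> * real n / 4)"
        using C0(2)[OF N(1) k] \<delta>n by (intro divide_right_mono) auto
      finally show ?thesis .
    qed
    have "prob (\<Union>j\<le>J + 1. A (j * g)) \<le> (\<Sum>j\<le>J + 1. prob (A (j * g)))"
      by (intro finite_measure_subadditive_finite) auto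
    also have "\<dots> \<le> (\<Sum>j\<le>J + 1. (C0 + \<epsilon> * real N) / (\<delta> * real n / 4))"
      by (intro sum_mono pA) (unfold N_def, intro mult_le_mono1, simp)
    also have "\<dots> = (real J + 2) * ((C0 + \<epsilon> * real N) / (\<delta> * real n / 4))" by simp
    also have "\<dots> \<le> (real J + 2) * ((C0 + \<epsilon> * ((real J + 2) * (\<delta> * real n / 4))) / (\<delta> * real n / 4))"
      using N(2) \<epsilon> \<delta>n by (intro mult_left_mono divide_right_mono add_left_mono) auto
    also have "\<dots> = (real J + 2) * 4 * C0 / (\<delta> * real n) + \<epsilon> * (real J + 2) ^ 2"
      using \<delta> npos by (simp add: field_simps power2_eq_square)
    also have "(real J + 2) * 4 * C0 / (\<delta> * real n) \<le> \<eta> / 2"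
      using n'(2) \<delta> \<eta> npos by (simp add: field_simps)
    also have "\<epsilon> * (real J + 2) ^ 2 = \<eta> / 2"
    proof -
      have "(real J + 2) ^ 2 \<noteq> 0" by (simp add: add_nonneg_eq_0_iff)
      then show ?thesis by (simp add: \<epsilon>_def)
    qed
    finally have pB: "prob (\<Union>j\<le>J + 1. A (j * g)) \<le> \<eta>" by simp
    have "\<bar>real k - \<gamma> * real (horizontal k \<omega>)\<bar> \<le> \<delta> * real n"
      if w: "\<omega> \<in> space M - (\<Union>j\<le>J + 1. A (j * g))" and k: "k \<le> C * n" for \<omega> k
    proof -
      define j where "j = k div g"
      have jk: "j * g \<le> k" "k < (j + 1) * g"
        using g(3) by (auto simp: j_def dividend_less_div_times)
      have "j \<le> J"
      proof -
        have "real k \<le> real J * real g" using k Jg by (metis of_nat_le_iff order_trans)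
        then have "k \<le> J * g" by (metis of_nat_le_iff of_nat_mult)
        then have "k div g \<le> J * g div g" by (rule div_le_mono)
        then show ?thesis using g(3) by (simp add: j_def)
      qed
      then have 1: "\<bar>real (j * g) - \<gamma> * real (horizontal (j * g) \<omega>)\<bar> < \<delta> * real n / 4"
        and 2: "\<bar>real ((j + 1) * g) - \<gamma> * real (horizontal ((j + 1) * g) \<omega>)\<bar> < \<delta> * real n / 4"
        using w by (fastforce simp: A_def not_le)+
      have "\<gamma> * real (horizontal (j * g) \<omega>) \<le> \<gamma> * real (horizontal k \<omega>)"
        "\<gamma> * real (horizontal k \<omega>) \<le> \<gamma> * real (horizontal ((j + 1) * g) \<omega>)"
        using jk \<gamma> by (auto intro!: mult_left_mono horizontal_mono)
      moreover have "real ((j + 1) * g) = real (j * g) + real g" by (simp add: algebra_simps)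
      moreover have "real (j * g) \<le> real k" "real k \<le> real ((j + 1) * g)" using jk by (metis of_nat_le_iff, metis of_nat_le_iff less_imp_le)
      ultimately show ?thesis using 1 2 g(1) \<delta>n unfolding abs_less_iff abs_le_iff by linarith
    qed
    then show ?thesis using pB by (intro bexI[of _ "\<Union>j\<le>J + 1. A (j * g)"]) auto
  qed
  then show "\<forall>\<^sub>F n in sequentially. \<exists>B\<in>events. prob B \<le> \<eta> \<and> (\<forall>\<omega>\<in>space M - B. \<forall>k\<le>C * n. \<bar>real k - \<gamma> * real (horizontal k \<omega>)\<bar> \<le> \<delta> * real n)"
    unfolding eventually_sequentially by blast
qed

end

end

section \<open>Suprema of step paths\<close>

lemma is_norm_nonneg: assumes "is_norm N" shows "0 \<le> N x"
proof -
  have *: "N 0 = 0" "N (x + - x) \<le> N x + N (- x)" "N ((- 1) *\<^sub>R x) = \<bar>- 1\<bar> * N x" using assms unfolding is_norm_def by blast+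
  then show ?thesis by simp
qed

lemma is_norm_pair_bound:
  fixes x y :: real
  assumes N: "is_norm N" shows "N (x, y) \<le> \<bar>x\<bar> * N (1, 0) + \<bar>y\<bar> * N (0, 1)"
proof -
  have "N (x, y) = N (x *\<^sub>R (1, 0) + y *\<^sub>R (0, 1))" by simp
  also have "\<dots> \<le> N (x *\<^sub>R (1, 0)) + N (y *\<^sub>R (0, 1))" using N unfolding is_norm_def by blast
  also have "\<dots> = \<bar>x\<bar> * N (1, 0) + \<bar>y\<bar> * N (0, 1)" using N unfolding is_norm_def by presburger
  finally show ?thesis .
qed

text \<open>The triangle inequality and homogeneity make the function convex, and a convex function
  on a finite-dimensional space is continuous.\<close>

lemma is_norm_continuous:
  fixes N :: "'a::euclidean_space \<Rightarrow> real"
  assumes N: "is_norm N" shows "continuous_on UNIV N"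
proof (rule convex_on_continuous[OF open_UNIV])
  show "convex_on UNIV N"
  proof (rule convex_onI)
    fix t :: real and x y :: 'a assume t: "0 < t" "t < 1"
    have "N ((1 - t) *\<^sub>R x + t *\<^sub>R y) \<le> N ((1 - t) *\<^sub>R x) + N (t *\<^sub>R y)" using N unfolding is_norm_def by blast
    also have "\<dots> = \<bar>1 - t\<bar> * N x + \<bar>t\<bar> * N y" using N unfolding is_norm_def by presburger
    finally show "N ((1 - t) *\<^sub>R x + t *\<^sub>R y) \<le> (1 - t) * N x + t * N y" using t by simp
  qed simp
qed

text \<open>The supremum may be taken over the rationals and \<open>T\<close>, since the path is right-continuous.\<close>

lemma SUP_step_path:
  fixes g :: "nat \<Rightarrow> real \<Rightarrow> 'a \<Rightarrow> real"
  assumes cont: "\<And>m \<omega>. \<omega> \<in> space M \<Longrightarrow> continuous_on {0..T} (\<lambda>t. g m t \<omega>)"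
    and meas: "\<And>m t. 0 \<le> t \<Longrightarrow> g m t \<in> borel_measurable M"
    and c: "0 < c" and T: "0 < T"
  shows "\<And>\<omega>. \<omega> \<in> space M \<Longrightarrow> bdd_above ((\<lambda>t. g (nat \<lfloor>c * t\<rfloor>) t \<omega>) ` {0..T})"
    and "(\<lambda>\<omega>. SUP t\<in>{0..T}. g (nat \<lfloor>c * t\<rfloor>) t \<omega>) \<in> borel_measurable M"
proof -
  show bdd: "bdd_above ((\<lambda>t. g (nat \<lfloor>c * t\<rfloor>) t \<omega>) ` {0..T})" if w: "\<omega> \<in> space M" for \<omega>
  proof (rule bdd_above_mono)
    have "bdd_above ((\<lambda>t. g m t \<omega>) ` {0..T})" for m
      using compact_continuous_image[OF cont[OF w] compact_Icc] by (intro bounded_imp_bdd_above compact_imp_bounded)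
    then show "bdd_above (\<Union>m\<in>{..nat \<lfloor>c * T\<rfloor>}. (\<lambda>t. g m t \<omega>) ` {0..T})" by simp
    show "(\<lambda>t. g (nat \<lfloor>c * t\<rfloor>) t \<omega>) ` {0..T} \<subseteq> (\<Union>m\<in>{..nat \<lfloor>c * T\<rfloor>}. (\<lambda>t. g m t \<omega>) ` {0..T})"
    proof safe
      fix t assume t: "t \<in> {0..T}"
      then have "nat \<lfloor>c * t\<rfloor> \<le> nat \<lfloor>c * T\<rfloor>" using c by (intro nat_mono floor_mono mult_left_mono) auto
      then show "g (nat \<lfloor>c * t\<rfloor>) t \<omega> \<in> (\<Union>m\<in>{..nat \<lfloor>c * T\<rfloor>}. (\<lambda>t. g m t \<omega>) ` {0..T})" using t by blast
    qed
  qed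
  define Q where "Q = insert T (\<rat> \<inter> {0..T})"
  have Q: "countable Q" "Q \<subseteq> {0..T}" "Q \<noteq> {}" using T countable_rat by (auto simp: Q_def)
  have eq: "(SUP t\<in>{0..T}. g (nat \<lfloor>c * t\<rfloor>) t \<omega>) = (SUP t\<in>Q. g (nat \<lfloor>c * t\<rfloor>) t \<omega>)" if w: "\<omega> \<in> space M" for \<omega>
  proof (rule antisym)
    let ?f = "\<lambda>t. g (nat \<lfloor>c * t\<rfloor>) t \<omega>"
    have bQ: "bdd_above (?f ` Q)" using bdd[OF w] Q(2) by (meson bdd_above_mono image_mono)
    show "(SUP t\<in>Q. ?f t) \<le> (SUP t\<in>{0..T}. ?f t)"
      using Q bdd[OF w] by (intro cSUP_subset_mono) auto
    show "(SUP t\<in>{0..T}. ?f t) \<le> (SUP t\<in>Q. ?f t)"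
    proof (rule cSUP_least)
      fix t assume t: "t \<in> {0..T}"
      show "?f t \<le> (SUP t\<in>Q. ?f t)"
      proof (cases "t = T")
        case True then show ?thesis using bQ by (intro cSUP_upper) (auto simp: Q_def)
      next
        case False
        show ?thesis
        proof (rule ccontr)
          assume "\<not> ?f t \<le> (SUP t\<in>Q. ?f t)"
          then have gt: "(SUP t\<in>Q. ?f t) < g (nat \<lfloor>c * t\<rfloor>) t \<omega>" by simp
          have "((\<lambda>s. g (nat \<lfloor>c * t\<rfloor>) s \<omega>) \<longlongrightarrow> g (nat \<lfloor>c * t\<rfloor>) t \<omega>) (at t within {0..T})"
            using cont[OF w] t by (auto simp: continuous_on_def)
          from order_tendstoD(1)[OF this gt] obtain d where d: "0 < d"
            "\<And>s. s \<in> {0..T} \<Longrightarrow> s \<noteq> t \<Longrightarrow> dist s t < d \<Longrightarrow> (SUP t\<in>Q. ?f t) < g (nat \<lfloor>c * t\<rfloor>) s \<omega>"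
            by (auto simp: eventually_at)
          \<comment> \<open>A rational time between \<open>t\<close> and \<open>b\<close> stays
            below \<open>T\<close>, within the continuity distance \<open>d\<close>, and in the same
            step of the floor function.\<close>
          define b where "b = min (min T (t + d)) ((of_int \<lfloor>c * t\<rfloor> + 1) / c)"
          have "c * t < of_int \<lfloor>c * t\<rfloor> + 1" by linarith
          then have "t < b" using False t d c by (simp add: b_def less_divide_eq mult.commute)
          then obtain q where q: "q \<in> \<rat>" "t < q" "q < b" using Rats_dense_in_real by blast
          have "c * q < of_int \<lfloor>c * t\<rfloor> + 1" using q c by (simp add: b_def less_divide_eq mult.commute)
          moreover have "c * t \<le> c * q" using q c by simp
          ultimately have fl: "\<lfloor>c * q\<rfloor> = \<lfloor>c * t\<rfloor>" by linarith
          have "(SUP t\<in>Q. ?f t) < g (nat \<lfloor>c * t\<rfloor>) q \<omega>"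
            using q t by (intro d) (auto simp: b_def dist_real_def)
          moreover have "?f q \<le> (SUP t\<in>Q. ?f t)" using q t bQ by (intro cSUP_upper) (auto simp: Q_def b_def)
          ultimately show False using fl by simp
        qed
      qed
    qed (use T in auto)
  qed
  have "(\<lambda>\<omega>. SUP t\<in>Q. g (nat \<lfloor>c * t\<rfloor>) t \<omega>) \<in> borel_measurable M"
  proof (rule borel_measurable_cSUP[OF Q(1)])
    show "g (nat \<lfloor>c * t\<rfloor>) t \<in> borel_measurable M" if "t \<in> Q" for t using that Q(2) by (intro meas) auto
    show "bdd_above ((\<lambda>t. g (nat \<lfloor>c * t\<rfloor>) t \<omega>) ` Q)" if "\<omega> \<in> space M" for \<omega>
      using bdd[OF that] Q(2) by (meson bdd_above_mono image_mono)
  qed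
  then show "(\<lambda>\<omega>. SUP t\<in>{0..T}. g (nat \<lfloor>c * t\<rfloor>) t \<omega>) \<in> borel_measurable M"
    by (rule measurable_cong[THEN iffD1, rotated]) (simp add: eq)
qed

section \<open>Time change\<close>

text \<open>The first coordinate at time [n t] is the first simple walk at the random time
  \<open>H\<close>. It is compared with \<open>W1\<close> at \<open>H\<close> by the coupling, and
  there with \<open>W1\<close> at n t / \<gamma> by the modulus of continuity. The second coordinate
  is handled alike at the time [n t] - H.\<close>

lemma coupled_walk:
  fixes M :: "'a measure"
  assumes W1: "wiener_process M W1" and W2: "wiener_process M W2"
    and driver: "walk_driver M p U (wiener_space.\<xi> W1) (wiener_space.\<xi> W2)"
    and gamma: "1 < \<gamma>"
    and right: "(\<lambda>k::nat. (\<Sum>j=1..k. inverse (p (int j))) / real k) \<longlonglongrightarrow> 2 * \<gamma>"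
    and left: "(\<lambda>k::nat. (\<Sum>j=1..k. inverse (p (- int j))) / real k) \<longlonglongrightarrow> 2 * \<gamma>"
    and \<epsilon>: "0 < \<epsilon>" and T: "0 < T"
  defines "Z \<equiv> walk_driver.Z p U (wiener_space.\<xi> W1) (wiener_space.\<xi> W2)"
  shows "whp M (\<lambda>n \<omega>. \<forall>t\<in>{0..T}.
    \<bar>real_of_int (fst (Z (nat \<lfloor>real n * t\<rfloor>) \<omega>)) - W1 (real n * t * inverse \<gamma>) \<omega>\<bar> \<le> \<epsilon> * sqrt (real n) \<and>
    \<bar>real_of_int (snd (Z (nat \<lfloor>real n * t\<rfloor>) \<omega>)) - W2 (real n * t * (1 - inverse \<gamma>)) \<omega>\<bar> \<le> \<epsilon> * sqrt (real n))"
proof -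
  interpret prob_space M using W1 by (simp add: wiener_process_def)
  interpret A: wiener_space M W1 by unfold_locales fact
  interpret B: wiener_space M W2 by unfold_locales fact
  interpret D: walk_driver M p U A.\<xi> B.\<xi> by fact
  have nbr: "D.Z (Suc n) \<omega> \<in> nbrs (D.Z n \<omega>)" for n \<omega>
    unfolding D.Z_Suc nbrs_def using A.\<xi>_values[of "D.H n \<omega>" \<omega>] B.\<xi>_values[of "n - D.H n \<omega>" \<omega>] by auto
  interpret N: nn_walk M p D.Z
    by unfold_locales (use D.p_bounds D.aniso_walk_Z nbr in auto)
  have H: "N.horizontal n \<omega> = D.H n \<omega>" for n \<omega>
  proof (induction n)
    case (Suc n) then show ?case unfolding D.H_Suc by (simp add: N.horizontal_def)
  qed (simp add: N.horizontal_def)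
  have Z_fst: "fst (D.Z n \<omega>) = A.S (D.H n \<omega>) \<omega>" and Z_snd: "snd (D.Z n \<omega>) = B.S (n - D.H n \<omega>) \<omega>" for n \<omega>
    by (simp_all add: D.Z_def D.S1_def D.S2_def A.S_def B.S_def)
  define C where "C = nat \<lceil>T\<rceil>"
  have C: "T \<le> real C" unfolding C_def by linarith
  define m where "m n t = nat \<lfloor>real n * t\<rfloor>" for n :: nat and t :: real
  have m: "real (m n t) \<le> real n * t" "real n * t - 1 \<le> real (m n t)" "real n * t \<le> real C * real n" "m n t \<le> C * n"
    if "t \<in> {0..T}" for n t
  proof -
    have "0 \<le> real n * t" using that by simp
    then show 1: "real (m n t) \<le> real n * t" "real n * t - 1 \<le> real (m n t)" unfolding m_def by linarith+
    have "real n * t \<le> real n * real C" using that C by (intro mult_left_mono) auto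
    then show 2: "real n * t \<le> real C * real n" by (simp add: mult.commute)
    have "real (m n t) \<le> real (C * n)" using 1(1) 2 by simp
    then show "m n t \<le> C * n" by (simp only: of_nat_le_iff)
  qed
  have ig: "0 < inverse \<gamma>" "inverse \<gamma> < 1" using gamma by (auto simp: inverse_less_1_iff)
  define P1 where "P1 n \<omega> = (\<lambda>t. (real (D.H (m n t) \<omega>), real n * t * inverse \<gamma>)) ` {0..T}" for n \<omega>
  define P2 where "P2 n \<omega> = (\<lambda>t. (real (m n t - D.H (m n t) \<omega>), real n * t * (1 - inverse \<gamma>))) ` {0..T}" for n \<omega>
  \<comment> \<open>The clock estimate supplies \<delta>/4, rounding n t to an integer costs at most
    1, which is below \<delta> n / 4 eventually, and dividing by \<gamma> > 1 only shrinks the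
    error.\<close>
  have near: "whp M (\<lambda>n \<omega>. \<forall>t\<in>{0..T}. \<bar>real (D.H (m n t) \<omega>) - real n * t * inverse \<gamma>\<bar> \<le> \<delta> / 2 * real n)" if \<delta>: "0 < \<delta>" for \<delta>
  proof -
    have w: "whp M (\<lambda>n \<omega>. \<forall>k\<le>C * n. \<bar>real k - \<gamma> * real (N.horizontal k \<omega>)\<bar> \<le> \<delta> / 4 * real n)"
      using N.clock[OF gamma right left, of "\<delta> / 4" C] \<delta> by simp
    obtain n0 :: nat where n0: "4 / \<delta> \<le> real n0" using real_arch_simple by blast
    show ?thesis
    proof (rule whp_mono[OF w, where N=n0], intro ballI)
      fix n \<omega> t assume n: "n0 \<le> n" and *: "\<forall>k\<le>C * n. \<bar>real k - \<gamma> * real (N.horizontal k \<omega>)\<bar> \<le> \<delta> / 4 * real n" and t: "t \<in> {0..T}"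
      have "\<bar>real (m n t) - \<gamma> * real (D.H (m n t) \<omega>)\<bar> \<le> \<delta> / 4 * real n" using * m(4)[OF t] unfolding H by blast
      moreover have "1 \<le> \<delta> / 4 * real n"
      proof -
        have "4 / \<delta> \<le> real n" using n n0 by linarith
        then show ?thesis using \<delta> by (simp add: divide_le_eq mult.commute)
      qed
      ultimately have le: "\<bar>real n * t - \<gamma> * real (D.H (m n t) \<omega>)\<bar> \<le> \<delta> / 2 * real n" using m(1,2)[OF t, of n] by linarith
      have "real (D.H (m n t) \<omega>) - real n * t * inverse \<gamma> = - (real n * t - \<gamma> * real (D.H (m n t) \<omega>)) * inverse \<gamma>"
        using gamma by (simp add: left_diff_distrib field_simps)
      then have "\<bar>real (D.H (m n t) \<omega>) - real n * t * inverse \<gamma>\<bar> = \<bar>real n * t - \<gamma> * real (D.H (m n t) \<omega>)\<bar> * inverse \<gamma>"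
        using ig by (simp add: abs_mult)
      also have "\<dots> \<le> \<bar>real n * t - \<gamma> * real (D.H (m n t) \<omega>)\<bar> * 1" using ig by (intro mult_left_mono) auto
      also have "\<dots> \<le> \<delta> / 2 * real n" unfolding mult_1_right by (rule le)
      finally show "\<bar>real (D.H (m n t) \<omega>) - real n * t * inverse \<gamma>\<bar> \<le> \<delta> / 2 * real n" .
    qed
  qed
  have range1: "0 \<le> real n * t * inverse \<gamma>" "real n * t * inverse \<gamma> \<le> real C * real n"
    "0 \<le> real n * t * (1 - inverse \<gamma>)" "real n * t * (1 - inverse \<gamma>) \<le> real C * real n" if t: "t \<in> {0..T}" for n t
  proof -
    have nt: "0 \<le> real n * t" using t by simp
    show "0 \<le> real n * t * inverse \<gamma>" "0 \<le> real n * t * (1 - inverse \<gamma>)" using nt ig by auto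
    have "real n * t * inverse \<gamma> \<le> real n * t * 1" "real n * t * (1 - inverse \<gamma>) \<le> real n * t * 1"
      using nt ig by (intro mult_left_mono; simp)+
    then show "real n * t * inverse \<gamma> \<le> real C * real n" "real n * t * (1 - inverse \<gamma>) \<le> real C * real n"
      using m(3)[OF t, of n] by linarith+
  qed
  have Hm: "real (D.H (m n t) \<omega>) \<le> real (m n t)" for n t \<omega> using D.H_le by simp
  have \<epsilon>2: "0 < \<epsilon> / 2" using \<epsilon> by simp
  have mod1: "whp M (\<lambda>n \<omega>. \<forall>(s, t)\<in>P1 n \<omega>. \<bar>W1 s \<omega> - W1 t \<omega>\<bar> \<le> \<epsilon> / 2 * sqrt (real n))"
  proof (rule A.whp_time_change[OF \<epsilon>2, where C=C])
    fix \<delta> :: real assume \<delta>: "0 < \<delta>"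
    show "whp M (\<lambda>n \<omega>. \<forall>(s, t)\<in>P1 n \<omega>. 0 \<le> s \<and> s \<le> real C * real n \<and> 0 \<le> t \<and> t \<le> real C * real n \<and> \<bar>s - t\<bar> \<le> \<delta> * real n)"
    proof (rule whp_mono[OF near[OF \<delta>], where N=0])
      fix n \<omega> assume *: "\<forall>t\<in>{0..T}. \<bar>real (D.H (m n t) \<omega>) - real n * t * inverse \<gamma>\<bar> \<le> \<delta> / 2 * real n"
      have "0 \<le> \<delta> / 2 * real n" using \<delta> by simp
      moreover have "\<delta> * real n = \<delta> / 2 * real n + \<delta> / 2 * real n" by simp
      ultimately have le: "\<delta> / 2 * real n \<le> \<delta> * real n" by linarith
      have "0 \<le> real (D.H (m n t) \<omega>) \<and> real (D.H (m n t) \<omega>) \<le> real C * real n \<and> 0 \<le> real n * t * inverse \<gamma> \<and>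
         real n * t * inverse \<gamma> \<le> real C * real n \<and> \<bar>real (D.H (m n t) \<omega>) - real n * t * inverse \<gamma>\<bar> \<le> \<delta> * real n"
        if t: "t \<in> {0..T}" for t
        using *[THEN bspec, OF t] le Hm[of n t \<omega>] m(1,3)[OF t, of n] range1[OF t, of n] by linarith
      then show "\<forall>(s, t)\<in>P1 n \<omega>. 0 \<le> s \<and> s \<le> real C * real n \<and> 0 \<le> t \<and> t \<le> real C * real n \<and> \<bar>s - t\<bar> \<le> \<delta> * real n"
        unfolding P1_def by blast
    qed
  qed
  have mod2: "whp M (\<lambda>n \<omega>. \<forall>(s, t)\<in>P2 n \<omega>. \<bar>W2 s \<omega> - W2 t \<omega>\<bar> \<le> \<epsilon> / 2 * sqrt (real n))"
  proof (rule B.whp_time_change[OF \<epsilon>2, where C=C])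
    fix \<delta> :: real assume \<delta>: "0 < \<delta>"
    \<comment> \<open>The time [n t] - H contains the rounding a second time; it is absorbed in the
      other half of \<delta> n.\<close>
    obtain n0 :: nat where n0: "2 / \<delta> \<le> real n0" using real_arch_simple by blast
    show "whp M (\<lambda>n \<omega>. \<forall>(s, t)\<in>P2 n \<omega>. 0 \<le> s \<and> s \<le> real C * real n \<and> 0 \<le> t \<and> t \<le> real C * real n \<and> \<bar>s - t\<bar> \<le> \<delta> * real n)"
    proof (rule whp_mono[OF near[OF \<delta>], where N=n0])
      fix n \<omega> assume n: "n0 \<le> n" and *: "\<forall>t\<in>{0..T}. \<bar>real (D.H (m n t) \<omega>) - real n * t * inverse \<gamma>\<bar> \<le> \<delta> / 2 * real n"
      have "2 / \<delta> \<le> real n" using n n0 by linarith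
      then have one: "1 \<le> \<delta> / 2 * real n" using \<delta> by (simp add: divide_le_eq mult.commute)
      have half: "\<delta> * real n = \<delta> / 2 * real n + \<delta> / 2 * real n" by simp
      have "0 \<le> real (m n t - D.H (m n t) \<omega>) \<and> real (m n t - D.H (m n t) \<omega>) \<le> real C * real n \<and> 0 \<le> real n * t * (1 - inverse \<gamma>) \<and>
         real n * t * (1 - inverse \<gamma>) \<le> real C * real n \<and> \<bar>real (m n t - D.H (m n t) \<omega>) - real n * t * (1 - inverse \<gamma>)\<bar> \<le> \<delta> * real n"
        if t: "t \<in> {0..T}" for t
      proof -
        have eq: "real (m n t - D.H (m n t) \<omega>) = real (m n t) - real (D.H (m n t) \<omega>)" using D.H_le by (simp add: of_nat_diff)
        have eq2: "real n * t * (1 - inverse \<gamma>) = real n * t - real n * t * inverse \<gamma>" by (simp add: right_diff_distrib)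
        have H0: "0 \<le> real (D.H (m n t) \<omega>)" by simp
        show ?thesis
          using *[THEN bspec, OF t] half one Hm[of n t \<omega>] m(1,2,3)[OF t, of n] range1[OF t, of n] H0 unfolding eq eq2 abs_le_iff by linarith
      qed
      then show "\<forall>(s, t)\<in>P2 n \<omega>. 0 \<le> s \<and> s \<le> real C * real n \<and> 0 \<le> t \<and> t \<le> real C * real n \<and> \<bar>s - t\<bar> \<le> \<delta> * real n"
        unfolding P2_def by blast
    qed
  qed
  note all = whp_conj[OF whp_conj[OF A.walk_coupling[OF \<epsilon>2, of C] B.walk_coupling[OF \<epsilon>2, of C]] whp_conj[OF mod1 mod2]]
  show ?thesis
  proof (rule whp_mono[OF all, where N=0], intro ballI)
    fix n \<omega> t
    assume *: "((\<forall>k\<le>C * n. \<bar>real_of_int (A.S k \<omega>) - W1 (real k) \<omega>\<bar> \<le> \<epsilon> / 2 * sqrt (real n)) \<and>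
         (\<forall>k\<le>C * n. \<bar>real_of_int (B.S k \<omega>) - W2 (real k) \<omega>\<bar> \<le> \<epsilon> / 2 * sqrt (real n))) \<and>
        (\<forall>(s, t)\<in>P1 n \<omega>. \<bar>W1 s \<omega> - W1 t \<omega>\<bar> \<le> \<epsilon> / 2 * sqrt (real n)) \<and>
        (\<forall>(s, t)\<in>P2 n \<omega>. \<bar>W2 s \<omega> - W2 t \<omega>\<bar> \<le> \<epsilon> / 2 * sqrt (real n))"
      and t: "t \<in> {0..T}"
    let ?H = "D.H (m n t) \<omega>"
    have k: "?H \<le> C * n" "m n t - ?H \<le> C * n" using D.H_le[of "m n t" \<omega>] m(4)[OF t, of n] by linarith+
    have "(real ?H, real n * t * inverse \<gamma>) \<in> P1 n \<omega>" "(real (m n t - ?H), real n * t * (1 - inverse \<gamma>)) \<in> P2 n \<omega>"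
      using t by (auto simp: P1_def P2_def)
    then have "\<bar>W1 (real ?H) \<omega> - W1 (real n * t * inverse \<gamma>) \<omega>\<bar> \<le> \<epsilon> / 2 * sqrt (real n)"
      "\<bar>W2 (real (m n t - ?H)) \<omega> - W2 (real n * t * (1 - inverse \<gamma>)) \<omega>\<bar> \<le> \<epsilon> / 2 * sqrt (real n)" using * by blast+
    moreover have "\<bar>real_of_int (A.S ?H \<omega>) - W1 (real ?H) \<omega>\<bar> \<le> \<epsilon> / 2 * sqrt (real n)"
      "\<bar>real_of_int (B.S (m n t - ?H) \<omega>) - W2 (real (m n t - ?H)) \<omega>\<bar> \<le> \<epsilon> / 2 * sqrt (real n)" using * k by blast+
    moreover have "\<epsilon> * sqrt (real n) = \<epsilon> / 2 * sqrt (real n) + \<epsilon> / 2 * sqrt (real n)" by simp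
    ultimately show "\<bar>real_of_int (fst (Z (nat \<lfloor>real n * t\<rfloor>) \<omega>)) - W1 (real n * t * inverse \<gamma>) \<omega>\<bar> \<le> \<epsilon> * sqrt (real n) \<and>
      \<bar>real_of_int (snd (Z (nat \<lfloor>real n * t\<rfloor>) \<omega>)) - W2 (real n * t * (1 - inverse \<gamma>)) \<omega>\<bar> \<le> \<epsilon> * sqrt (real n)"
      unfolding Z_def m_def[symmetric] Z_fst Z_snd by linarith
  qed
qed

text \<open>A norm on the plane is dominated by a combination of the coordinates, so the
  coordinatewise bounds carry over. Measurability of the supremum comes from step paths that are
  continuous between jumps.\<close>

lemma sup_tends_to_0:
  fixes M :: "'a measure" and nrm :: "real \<times> real \<Rightarrow> real"
  assumes W1: "wiener_process M W1" and W2: "wiener_process M W2"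
    and Z: "\<And>n. Z n \<in> measurable M (count_space UNIV)"
    and nrm: "is_norm nrm" and gamma: "1 < \<gamma>" and T: "0 < T"
    and close: "\<And>\<epsilon>. 0 < \<epsilon> \<Longrightarrow> whp M (\<lambda>n \<omega>. \<forall>t\<in>{0..T}.
      \<bar>real_of_int (fst (Z (nat \<lfloor>real n * t\<rfloor>) \<omega>)) - W1 (real n * t * inverse \<gamma>) \<omega>\<bar> \<le> \<epsilon> * sqrt (real n) \<and>
      \<bar>real_of_int (snd (Z (nat \<lfloor>real n * t\<rfloor>) \<omega>)) - W2 (real n * t * (1 - inverse \<gamma>)) \<omega>\<bar> \<le> \<epsilon> * sqrt (real n))"
  shows "tends_to_0_in_prob M (\<lambda>n \<omega>. SUP t\<in>{0..T}. nrm ((1 / sqrt (real n)) *\<^sub>R real_point (Z (nat \<lfloor>real n * t\<rfloor>) \<omega>) - scaled_wiener \<gamma> W1 W2 n t \<omega>))"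
proof -
  interpret prob_space M using W1 by (simp add: wiener_process_def)
  interpret A: wiener_space M W1 by unfold_locales fact
  interpret B: wiener_space M W2 by unfold_locales fact
  have ig: "0 < inverse \<gamma>" "inverse \<gamma> < 1" using gamma by (auto simp: inverse_less_1_iff)
  define g where "g n m t \<omega> = nrm ((1 / sqrt (real n)) *\<^sub>R real_point (Z m \<omega>) - scaled_wiener \<gamma> W1 W2 n t \<omega>)" for n m t \<omega>
  define R where "R n \<omega> = (SUP t\<in>{0..T}. g n (nat \<lfloor>real n * t\<rfloor>) t \<omega>)" for n \<omega>
  have nrm0: "nrm 0 = 0" using nrm unfolding is_norm_def by blast
  have cont: "continuous_on {0..T} (\<lambda>t. g n m t \<omega>)" if w: "\<omega> \<in> space M" for n m \<omega>
  proof -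
    have "continuous_on {0..T} (\<lambda>t. W1 (real n * t * inverse \<gamma>) \<omega>)" "continuous_on {0..T} (\<lambda>t. W2 (real n * t * (1 - inverse \<gamma>)) \<omega>)"
      using ig by (auto intro!: continuous_on_compose2[OF A.W_continuous[OF w]] continuous_on_compose2[OF B.W_continuous[OF w]] continuous_intros mult_nonneg_nonneg)
    then have "continuous_on {0..T} (\<lambda>t. (1 / sqrt (real n)) *\<^sub>R real_point (Z m \<omega>) - scaled_wiener \<gamma> W1 W2 n t \<omega>)"
      unfolding scaled_wiener_def divide_inverse by (intro continuous_intros)
    then show ?thesis unfolding g_def
      by (intro continuous_on_compose2[OF is_norm_continuous[OF nrm]]) auto
  qed
  have nm[measurable]: "nrm \<in> borel_measurable borel" using is_norm_continuous[OF nrm] by (rule borel_measurable_continuous_onI)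
  have meas: "g n m t \<in> borel_measurable M" if t: "0 \<le> t" for n m t
  proof -
    have [measurable]: "random_variable borel (W1 (real n * t * inverse \<gamma>))" "random_variable borel (W2 (real n * t * (1 - inverse \<gamma>)))"
      using t ig by (auto intro!: A.W_measurable B.W_measurable mult_nonneg_nonneg)
    have [measurable]: "(\<lambda>\<omega>. real_point (Z m \<omega>)) \<in> borel_measurable M" by (rule measurable_compose[OF Z]) simp
    show ?thesis unfolding g_def[abs_def] scaled_wiener_def by measurable
  qed
  note step = SUP_step_path[where M=M and T=T, OF cont meas _ T]
  \<comment> \<open>Measurability is demanded for n = 0 too. There both scaled points are 0 because
    division by \<open>sqrt 0\<close> gives 0, whereas the lemma on step paths needs a positive
    speed.\<close>
  have zero: "R 0 = (\<lambda>\<omega>. 0)" using T by (auto simp: R_def g_def scaled_wiener_def nrm0 fun_eq_iff simp flip: zero_prod_def)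
  have mR[measurable]: "R n \<in> borel_measurable M" for n
  proof (cases "n = 0")
    case True then show ?thesis using zero by simp
  next
    case False then show ?thesis unfolding R_def[abs_def] by (intro step(2)) auto
  qed
  define K where "K = nrm (1, 0) + nrm (0, 1)"
  have K: "0 \<le> nrm (1, 0)" "0 \<le> nrm (0, 1)" "0 \<le> K" using is_norm_nonneg[OF nrm] by (auto simp: K_def)
  have "(\<lambda>n. prob {\<omega>\<in>space M. e < \<bar>R n \<omega>\<bar>}) \<longlonglongrightarrow> 0" if e: "0 < e" for e
  proof (rule LIMSEQ_I)
    fix \<eta> :: real assume \<eta>: "0 < \<eta>"
    define \<epsilon> where "\<epsilon> = e / (K + 1)"
    have \<epsilon>: "0 < \<epsilon>" "\<epsilon> * K \<le> e"
    proof -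
      show "0 < \<epsilon>" using e K by (simp add: \<epsilon>_def)
      have "\<epsilon> * K \<le> \<epsilon> * (K + 1)" using \<open>0 < \<epsilon>\<close> by simp
      also have "\<dots> = e" using K by (simp add: \<epsilon>_def)
      finally show "\<epsilon> * K \<le> e" .
    qed
    have "0 < \<eta> / 2" using \<eta> by simp
    with close[OF \<epsilon>(1)] have "\<forall>\<^sub>F n in sequentially. \<exists>B\<in>events. prob B \<le> \<eta> / 2 \<and> (\<forall>\<omega>\<in>space M - B. \<forall>t\<in>{0..T}.
      \<bar>real_of_int (fst (Z (nat \<lfloor>real n * t\<rfloor>) \<omega>)) - W1 (real n * t * inverse \<gamma>) \<omega>\<bar> \<le> \<epsilon> * sqrt (real n) \<and>
      \<bar>real_of_int (snd (Z (nat \<lfloor>real n * t\<rfloor>) \<omega>)) - W2 (real n * t * (1 - inverse \<gamma>)) \<omega>\<bar> \<le> \<epsilon> * sqrt (real n))"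
      unfolding whp_def by blast
    then have "\<forall>\<^sub>F n in sequentially. prob {\<omega>\<in>space M. e < \<bar>R n \<omega>\<bar>} \<le> \<eta> / 2"
      using eventually_gt_at_top[of 0]
    proof eventually_elim
      case (elim n)
      then obtain B where B: "B \<in> events" "prob B \<le> \<eta> / 2" "\<And>\<omega> t. \<omega> \<in> space M - B \<Longrightarrow> t \<in> {0..T} \<Longrightarrow>
        \<bar>real_of_int (fst (Z (nat \<lfloor>real n * t\<rfloor>) \<omega>)) - W1 (real n * t * inverse \<gamma>) \<omega>\<bar> \<le> \<epsilon> * sqrt (real n) \<and>
        \<bar>real_of_int (snd (Z (nat \<lfloor>real n * t\<rfloor>) \<omega>)) - W2 (real n * t * (1 - inverse \<gamma>)) \<omega>\<bar> \<le> \<epsilon> * sqrt (real n)" by blast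
      have n: "0 < sqrt (real n)" using elim(2) by simp
      have "{\<omega>\<in>space M. e < \<bar>R n \<omega>\<bar>} \<subseteq> B"
      proof (rule ccontr)
        assume "\<not> {\<omega>\<in>space M. e < \<bar>R n \<omega>\<bar>} \<subseteq> B"
        then obtain \<omega> where w: "\<omega> \<in> space M - B" "e < \<bar>R n \<omega>\<bar>" by blast
        have le: "g n (nat \<lfloor>real n * t\<rfloor>) t \<omega> \<le> e" if t: "t \<in> {0..T}" for t
        proof -
          define x where "x = (real_of_int (fst (Z (nat \<lfloor>real n * t\<rfloor>) \<omega>)) - W1 (real n * t * inverse \<gamma>) \<omega>) / sqrt (real n)"
          define y where "y = (real_of_int (snd (Z (nat \<lfloor>real n * t\<rfloor>) \<omega>)) - W2 (real n * t * (1 - inverse \<gamma>)) \<omega>) / sqrt (real n)"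
          have "g n (nat \<lfloor>real n * t\<rfloor>) t \<omega> = nrm (x, y)"
            by (simp add: g_def scaled_wiener_def real_point_def x_def y_def diff_divide_distrib)
          also have "\<dots> \<le> \<bar>x\<bar> * nrm (1, 0) + \<bar>y\<bar> * nrm (0, 1)" by (rule is_norm_pair_bound[OF nrm])
          also have "\<dots> \<le> \<epsilon> * nrm (1, 0) + \<epsilon> * nrm (0, 1)"
          proof (intro add_mono mult_right_mono K)
            show "\<bar>x\<bar> \<le> \<epsilon>" "\<bar>y\<bar> \<le> \<epsilon>" using B(3)[OF w(1) t] n by (simp_all add: x_def y_def abs_divide divide_le_eq)
          qed
          also have "\<dots> = \<epsilon> * K" by (simp add: K_def distrib_left)
          finally show ?thesis using \<epsilon>(2) by simp
        qed
        have "R n \<omega> \<le> e" unfolding R_def using T le by (intro cSUP_least) auto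
        moreover have "0 \<le> R n \<omega>"
        proof -
          have "0 \<le> g n (nat \<lfloor>real n * 0\<rfloor>) 0 \<omega>" unfolding g_def by (rule is_norm_nonneg[OF nrm])
          also have "\<dots> \<le> R n \<omega>" unfolding R_def using step(1)[of "real n" \<omega>] elim(2) w T by (intro cSUP_upper) auto
          finally show ?thesis .
        qed
        ultimately show False using w(2) by simp
      qed
      then have "prob {\<omega>\<in>space M. e < \<bar>R n \<omega>\<bar>} \<le> prob B" using B(1) by (rule finite_measure_mono)
      then show ?case using B(2) by simp
    qed
    then obtain N where N: "\<And>n. n \<ge> N \<Longrightarrow> prob {\<omega>\<in>space M. e < \<bar>R n \<omega>\<bar>} \<le> \<eta> / 2" by (auto simp: eventually_sequentially)
    then show "\<exists>N. \<forall>n\<ge>N. norm (prob {\<omega>\<in>space M. e < \<bar>R n \<omega>\<bar>} - 0) < \<eta>"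
    proof (intro exI[of _ N] allI impI)
      fix n assume "N \<le> n"
      then have "prob {\<omega>\<in>space M. e < \<bar>R n \<omega>\<bar>} \<le> \<eta> / 2" by (rule N)
      also have "\<dots> < \<eta>" using \<eta> by simp
      finally show "norm (prob {\<omega>\<in>space M. e < \<bar>R n \<omega>\<bar>} - 0) < \<eta>" by simp
    qed
  qed
  then show ?thesis using mR unfolding tends_to_0_in_prob_def R_def[symmetric, unfolded g_def] by blast
qed

section \<open>Probability space\<close>

text \<open>Independence says that the joint law is the product of the marginals, and composition
  with a measure-preserving map keeps all these laws.\<close>

lemma indep_vars_transport:
  assumes M: "prob_space M" and f: "f \<in> measurable M N" and d: "distr M N f = N"
    and ind: "prob_space.indep_vars N M' X I"
  shows "prob_space.indep_vars M M' (\<lambda>i \<omega>. X i (f \<omega>)) I"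
proof -
  interpret M: prob_space M by fact
  interpret N: prob_space N using M.prob_space_distr[OF f] d by simp
  show ?thesis
  proof (cases "I = {}")
    case True then show ?thesis by (auto simp: M.indep_vars_def2 M.indep_sets_def)
  next
    case False
    have rv: "X i \<in> measurable N (M' i)" if "i \<in> I" for i using ind that by (auto simp: N.indep_vars_def2)
    have rv': "(\<lambda>\<omega>. X i (f \<omega>)) \<in> measurable M (M' i)" if "i \<in> I" for i using measurable_compose[OF f rv[OF that]] .
    have "distr M (PiM I M') (\<lambda>x. \<lambda>i\<in>I. X i (f x)) = distr (distr M N f) (PiM I M') (\<lambda>x. \<lambda>i\<in>I. X i x)"
      using rv f by (subst distr_distr) (auto simp: comp_def intro!: measurable_restrict)
    also have "\<dots> = (\<Pi>\<^sub>M i\<in>I. distr N (M' i) (X i))"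
      unfolding d using ind N.indep_vars_iff_distr_eq_PiM'[OF False, of X M'] rv by simp
    also have "\<dots> = (\<Pi>\<^sub>M i\<in>I. distr M (M' i) (\<lambda>\<omega>. X i (f \<omega>)))"
    proof (rule PiM_cong[OF refl])
      fix i assume "i \<in> I"
      then have "distr (distr M N f) (M' i) (X i) = distr M (M' i) (\<lambda>\<omega>. X i (f \<omega>))"
        using rv f by (subst distr_distr) (auto simp: comp_def)
      then show "distr N (M' i) (X i) = distr M (M' i) (\<lambda>\<omega>. X i (f \<omega>))" unfolding d .
    qed
    finally show ?thesis using M.indep_vars_iff_distr_eq_PiM'[OF False, of "\<lambda>i \<omega>. X i (f \<omega>)" M'] rv' by simp
  qed
qed

lemma wiener_process_transport:
  assumes M: "prob_space M" and f: "f \<in> measurable M N" and d: "distr M N f = N" and W: "wiener_process N W"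
  shows "wiener_process M (\<lambda>t \<omega>. W t (f \<omega>))"
proof -
  interpret N: wiener_space N W using W by (auto simp: wiener_space_def wiener_space_axioms_def wiener_process_def)
  show ?thesis
    unfolding wiener_process_def
  proof (intro conjI allI impI ballI)
    fix t :: real assume "0 \<le> t"
    then show "(\<lambda>\<omega>. W t (f \<omega>)) \<in> borel_measurable M" by (intro measurable_compose[OF f] N.W_measurable)
  next
    fix \<omega> assume "\<omega> \<in> space M"
    then have "f \<omega> \<in> space N" using f by (rule measurable_space[rotated])
    then show "W 0 (f \<omega>) = 0" "continuous_on {0..} (\<lambda>t. W t (f \<omega>))" using N.W_zero N.W_continuous by auto
  next
    fix s t :: real assume st: "0 \<le> s \<and> s < t"
    have n: "distributed N lborel (\<lambda>\<omega>. W t \<omega> - W s \<omega>) (normal_density 0 (sqrt (t - s)))" using st by (intro N.W_normal) auto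
    then have m: "(\<lambda>\<omega>. W t \<omega> - W s \<omega>) \<in> measurable N lborel" by (simp add: distributed_def)
    have "distr M lborel (\<lambda>\<omega>. W t (f \<omega>) - W s (f \<omega>)) = distr (distr M N f) lborel (\<lambda>\<omega>. W t \<omega> - W s \<omega>)"
      using m f by (subst distr_distr) (auto simp: comp_def)
    then show "distributed M lborel (\<lambda>\<omega>. W t (f \<omega>) - W s (f \<omega>)) (normal_density 0 (sqrt (t - s)))"
      using n measurable_compose[OF f m] unfolding d distributed_def by simp
  next
    fix m :: nat and \<tau> :: "nat \<Rightarrow> real" assume \<tau>: "0 \<le> \<tau> 0 \<and> mono \<tau>"
    then have "prob_space.indep_vars N (\<lambda>_. borel) (\<lambda>i \<omega>. W (\<tau> (Suc i)) \<omega> - W (\<tau> i) \<omega>) {..<m}" by (intro N.W_indep) auto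
    from indep_vars_transport[OF M f d this]
    show "prob_space.indep_vars M (\<lambda>_. borel) (\<lambda>i \<omega>. W (\<tau> (Suc i)) (f \<omega>) - W (\<tau> i) (f \<omega>)) {..<m}" .
  qed (rule M)
qed

section \<open>Arrays of normals and the measure on joint paths\<close>

definition normal_array :: "(nat \<times> nat \<Rightarrow> real) measure" where
  "normal_array = PiM UNIV (\<lambda>_. std_normal_distribution)"

lemma prob_space_normal_array: "prob_space normal_array"
  unfolding normal_array_def by (intro prob_space_PiM std_normal.prob_space_axioms)

lemma space_normal_array[simp]: "space normal_array = UNIV"
  by (simp add: normal_array_def space_PiM PiE_def extensional_def)

lemma measurable_normal_array[measurable]: "(\<lambda>\<omega>. \<omega> i) \<in> borel_measurable normal_array"
proof -
  have "(\<lambda>\<omega>. \<omega> i) \<in> measurable normal_array std_normal_distribution"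
    unfolding normal_array_def by (rule measurable_component_singleton) simp
  then show ?thesis by (simp cong: measurable_cong_sets)
qed

lemma distr_normal_array: "distr normal_array borel (\<lambda>\<omega>. \<omega> i) = std_normal_distribution"
proof -
  have "distr normal_array std_normal_distribution (\<lambda>\<omega>. \<omega> i) = std_normal_distribution"
    unfolding normal_array_def by (rule distr_PiM_component) (auto intro: std_normal.prob_space_axioms)
  then show ?thesis by (simp cong: distr_cong)
qed

lemma indep_vars_normal_array: "prob_space.indep_vars normal_array (\<lambda>_. borel) (\<lambda>i \<omega>. \<omega> i) UNIV"
proof -
  interpret prob_space normal_array by (rule prob_space_normal_array)
  have "distr normal_array (PiM UNIV (\<lambda>_. borel)) (\<lambda>x. \<lambda>i\<in>UNIV. x i) = normal_array"
    by (subst restrict_UNIV, rule distr_id2) (auto simp: normal_array_def intro!: sets_PiM_cong)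
  then show ?thesis
    by (subst indep_vars_iff_distr_eq_PiM) (auto simp: distr_normal_array, simp add: normal_array_def)
qed

interpretation normal_array: gauss_array normal_array "\<lambda>n k \<omega>. \<omega> (n, k)"
proof -
  interpret prob_space normal_array by (rule prob_space_normal_array)
  show "gauss_array normal_array (\<lambda>n k \<omega>. \<omega> (n, k))"
  proof unfold_locales
    show "indep_vars (\<lambda>_. borel) (\<lambda>(n, k) \<omega>. \<omega> (n, k)) UNIV"
      using indep_vars_normal_array by (simp add: case_prod_beta')
    show "distributed normal_array lborel (\<lambda>\<omega>. \<omega> (n, k)) std_normal_density" for n k
      using distr_normal_array[of "(n, k)"] by (auto simp: distributed_def cong: distr_cong)
  qed
qed

interpretation bm: wiener_space normal_array normal_array.W
  by unfold_locales (rule normal_array.wiener_process_W)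

text \<open>The first column of the array, transformed by \<open>Phi\<close>, is a sequence of
  independent uniform variables.\<close>

lemma prob_uniform_array:
  assumes c: "\<And>i. 0 \<le> c i \<and> c i \<le> 1"
  shows "measure normal_array {\<omega>. \<forall>i<n. (Phi (\<omega> (i, 0::nat)) < c i) = b i} = (\<Prod>i<n. if b i then c i else 1 - c i)"
proof (cases "n = 0")
  case True then show ?thesis using normal_array.prob_space by simp
next
  case False
  define A where "A p = {x. (Phi x < c (fst p)) = b (fst p)}" for p :: "nat \<times> nat"
  have A: "A p \<in> sets borel" for p unfolding A_def by measurable
  have mA: "measure std_normal_distribution (A p) = (if b (fst p) then c (fst p) else 1 - c (fst p))" for p
  proof (cases "b (fst p)")
    case True then show ?thesis using measure_Phi_less c by (simp add: A_def)
  next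
    case False
    then have "A p = UNIV - {x. Phi x < c (fst p)}" by (auto simp: A_def)
    moreover have "{x. Phi x < c (fst p)} \<in> sets borel" by measurable
    ultimately show ?thesis using False std_normal.prob_compl[of "{x. Phi x < c (fst p)}"] measure_Phi_less[of "c (fst p)"] c[of "fst p"] by simp
  qed
  let ?J = "(\<lambda>i. (i, 0::nat)) ` {..<n}"
  have "{\<omega>. \<forall>i<n. (Phi (\<omega> (i, 0::nat)) < c i) = b i} = (\<Inter>p\<in>?J. (\<lambda>\<omega>. \<omega> p) -` A p \<inter> space normal_array)"
    using False by (auto simp: A_def)
  also have "measure normal_array \<dots> = (\<Prod>p\<in>?J. measure normal_array ((\<lambda>\<omega>. \<omega> p) -` A p \<inter> space normal_array))"
    using False A by (intro normal_array.indep_varsD[OF indep_vars_normal_array]) auto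
  also have "\<dots> = (\<Prod>p\<in>?J. if b (fst p) then c (fst p) else 1 - c (fst p))"
  proof (intro prod.cong refl)
    fix q
    show "measure normal_array ((\<lambda>\<omega>. \<omega> q) -` A q \<inter> space normal_array) = (if b (fst q) then c (fst q) else 1 - c (fst q))"
      using measure_distr[OF measurable_normal_array A, of q q] distr_normal_array[of q] mA[of q] by simp
  qed
  also have "\<dots> = (\<Prod>i<n. if b i then c i else 1 - c i)"
    by (subst prod.reindex) (auto simp: inj_on_def intro!: prod.cong)
  finally show ?thesis .
qed

text \<open>Three independent arrays of normals read off a joint path: the first two drive the Wiener
  processes, the third one the choice between horizontal and vertical moves.\<close>

definition arrays :: "joint_path \<Rightarrow> (nat \<times> nat \<Rightarrow> real) \<times> (nat \<times> nat \<Rightarrow> real) \<times> (nat \<times> nat \<Rightarrow> real)" where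
  "arrays = (\<lambda>(_, f, g). (\<lambda>i. f (real (prod_encode i)), \<lambda>i. g (real (prod_encode i)), \<lambda>i. f (- 1 - real (prod_encode i))))"

text \<open>The arrays are stored at disjoint places: in the first real path at nonnegative
  integers, in the second one likewise, and in the first path at negative integers. Hence any three
  arrays occur together.\<close>

lemma surj_arrays: "surj arrays"
proof (rule surjI)
  fix x :: "(nat \<times> nat \<Rightarrow> real) \<times> (nat \<times> nat \<Rightarrow> real) \<times> (nat \<times> nat \<Rightarrow> real)"
  obtain a b c where x: "x = (a, b, c)" by (cases x)
  let ?r = "\<lambda>x. case x of (a, b, c) \<Rightarrow> (\<lambda>_. (0, 0), \<lambda>t. if 0 \<le> t then a (prod_decode (nat \<lfloor>t\<rfloor>)) else c (prod_decode (nat \<lfloor>- 1 - t\<rfloor>)), \<lambda>t. b (prod_decode (nat \<lfloor>t\<rfloor>)))"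
  show "arrays (?r x) = x"
  proof -
    have "\<not> 0 \<le> - 1 - real n" "- 1 - (- 1 - real n) = real n" for n :: nat by linarith+
    then show ?thesis by (simp add: x arrays_def)
  qed
qed

text \<open>A right inverse of \<open>arrays\<close> carries the product measure to joint paths,
  with the sigma-algebra generated by \<open>arrays\<close>; under it \<open>arrays\<close> has the
  product law. Joint paths only serve as sample points: walk and Wiener processes are functions of
  the arrays, not the components of the path.\<close>

definition path_measure :: "joint_path measure" where
  "path_measure = (let \<Omega> = normal_array \<Otimes>\<^sub>M (normal_array \<Otimes>\<^sub>M normal_array)
     in distr \<Omega> (vimage_algebra UNIV arrays \<Omega>) (inv arrays))"

abbreviation "array1 \<omega> \<equiv> fst (arrays \<omega>)"
abbreviation "array2 \<omega> \<equiv> fst (snd (arrays \<omega>))"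
abbreviation "array3 \<omega> \<equiv> snd (snd (arrays \<omega>))"

lemma space_path_measure[simp]: "space path_measure = UNIV"
  by (simp add: path_measure_def Let_def)

lemma path_measure_distr:
  shows measurable_arrays: "arrays \<in> measurable path_measure (normal_array \<Otimes>\<^sub>M (normal_array \<Otimes>\<^sub>M normal_array))"
    and distr_arrays: "distr path_measure (normal_array \<Otimes>\<^sub>M (normal_array \<Otimes>\<^sub>M normal_array)) arrays = normal_array \<Otimes>\<^sub>M (normal_array \<Otimes>\<^sub>M normal_array)"
proof -
  let ?\<Omega> = "normal_array \<Otimes>\<^sub>M (normal_array \<Otimes>\<^sub>M normal_array)"
  have sp: "space ?\<Omega> = UNIV" by (simp add: space_pair_measure)
  have inv: "arrays (inv arrays x) = x" for x using surj_arrays by (rule surj_f_inv_f)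
  have m1: "arrays \<in> measurable (vimage_algebra UNIV arrays ?\<Omega>) ?\<Omega>" by (rule measurable_vimage_algebra1) (simp add: sp)
  have m2: "inv arrays \<in> measurable ?\<Omega> (vimage_algebra UNIV arrays ?\<Omega>)" by (rule measurable_vimage_algebra2) (auto simp: inv)
  show "arrays \<in> measurable path_measure ?\<Omega>" using m1 by (simp add: path_measure_def Let_def)
  show "distr path_measure ?\<Omega> arrays = ?\<Omega>"
    unfolding path_measure_def Let_def by (subst distr_distr[OF m1 m2]) (simp add: comp_def inv distr_id2)
qed

lemma measurable_array:
  shows measurable_array1: "array1 \<in> measurable path_measure normal_array"
    and measurable_array2: "array2 \<in> measurable path_measure normal_array"
    and measurable_array3: "array3 \<in> measurable path_measure normal_array"
  using measurable_compose[OF measurable_arrays measurable_fst] 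
    measurable_compose[OF measurable_compose[OF measurable_arrays measurable_snd] measurable_fst]
    measurable_compose[OF measurable_compose[OF measurable_arrays measurable_snd] measurable_snd] by auto

text \<open>Independence of the three arrays in the form of rectangles; marginals and the joint law
  required of the driver are read off from it.\<close>

lemma emeasure_path_measure:
  assumes [measurable]: "A \<in> sets normal_array" "B \<in> sets normal_array" "C \<in> sets normal_array"
  shows "emeasure path_measure {\<omega>. array1 \<omega> \<in> A \<and> array2 \<omega> \<in> B \<and> array3 \<omega> \<in> C} = emeasure normal_array A * (emeasure normal_array B * emeasure normal_array C)"
proof -
  interpret P: pair_prob_space normal_array normal_array ..
  have sf: "sigma_finite_measure (normal_array \<Otimes>\<^sub>M normal_array)" ..
  have "{\<omega>. array1 \<omega> \<in> A \<and> array2 \<omega> \<in> B \<and> array3 \<omega> \<in> C} = arrays -` (A \<times> (B \<times> C)) \<inter> space path_measure"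
    by (auto simp: mem_Times_iff)
  also have "emeasure path_measure \<dots> = emeasure (distr path_measure (normal_array \<Otimes>\<^sub>M (normal_array \<Otimes>\<^sub>M normal_array)) arrays) (A \<times> (B \<times> C))"
    by (rule emeasure_distr[symmetric, OF measurable_arrays]) auto
  also have "\<dots> = emeasure normal_array A * (emeasure normal_array B * emeasure normal_array C)"
    unfolding distr_arrays by (simp add: sigma_finite_measure.emeasure_pair_measure_Times[OF sf] normal_array.emeasure_pair_measure_Times)
  finally show ?thesis .
qed

lemma distr_array:
  shows distr_array1: "distr path_measure normal_array array1 = normal_array"
    and distr_array2: "distr path_measure normal_array array2 = normal_array"
    and prob_space_path_measure: "prob_space path_measure"
proof -
  have one: "emeasure normal_array UNIV = 1" using normal_array.emeasure_space_1 by simp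
  have U: "UNIV \<in> sets normal_array" using sets.top[of normal_array] by simp
  show "distr path_measure normal_array array1 = normal_array"
    using emeasure_path_measure[OF _ U U] one
    by (intro measure_eqI) (auto simp: emeasure_distr[OF measurable_array1] vimage_def)
  show "distr path_measure normal_array array2 = normal_array"
    using emeasure_path_measure[OF U _ U] one
    by (intro measure_eqI) (auto simp: emeasure_distr[OF measurable_array2] vimage_def)
  show "prob_space path_measure" by (rule prob_spaceI) (use emeasure_path_measure[OF U U U] one in auto)
qed

interpretation path: prob_space path_measure by (rule prob_space_path_measure)

definition wiener1 :: "real \<Rightarrow> joint_path \<Rightarrow> real" where "wiener1 t \<omega> = normal_array.W t (array1 \<omega>)"
definition wiener2 :: "real \<Rightarrow> joint_path \<Rightarrow> real" where "wiener2 t \<omega> = normal_array.W t (array2 \<omega>)"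

lemma wiener_process1: "wiener_process path_measure wiener1" and wiener_process2: "wiener_process path_measure wiener2"
  unfolding wiener1_def[abs_def] wiener2_def[abs_def]
  by (rule wiener_process_transport[OF prob_space_path_measure measurable_array1 distr_array1 bm.wiener],
      rule wiener_process_transport[OF prob_space_path_measure measurable_array2 distr_array2 bm.wiener])

interpretation bm1: wiener_space path_measure wiener1 by unfold_locales (rule wiener_process1)
interpretation bm2: wiener_space path_measure wiener2 by unfold_locales (rule wiener_process2)

lemma indep_processes_wiener: "indep_processes path_measure wiener1 wiener2"
proof -
  have one: "emeasure normal_array UNIV = 1" using normal_array.emeasure_space_1 by simp
  have U: "UNIV \<in> sets normal_array" using sets.top[of normal_array] by simp
  have m: "(\<lambda>\<omega>. (array1 \<omega>, array2 \<omega>)) \<in> measurable path_measure (normal_array \<Otimes>\<^sub>M normal_array)"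
    using measurable_array by (intro measurable_Pair) auto
  have "normal_array \<Otimes>\<^sub>M normal_array = distr path_measure (normal_array \<Otimes>\<^sub>M normal_array) (\<lambda>\<omega>. (array1 \<omega>, array2 \<omega>))"
  proof (rule pair_measure_eqI)
    fix A B assume AB: "A \<in> sets normal_array" "B \<in> sets normal_array"
    then have "emeasure (distr path_measure (normal_array \<Otimes>\<^sub>M normal_array) (\<lambda>\<omega>. (array1 \<omega>, array2 \<omega>))) (A \<times> B)
      = emeasure path_measure {\<omega>. array1 \<omega> \<in> A \<and> array2 \<omega> \<in> B \<and> array3 \<omega> \<in> UNIV}"
      by (subst emeasure_distr[OF m]) (auto simp: vimage_def)
    then show "emeasure normal_array A * emeasure normal_array B
      = emeasure (distr path_measure (normal_array \<Otimes>\<^sub>M normal_array) (\<lambda>\<omega>. (array1 \<omega>, array2 \<omega>))) (A \<times> B)"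
      using emeasure_path_measure[OF AB U] one by simp
  qed (auto intro: normal_array.sigma_finite_measure_axioms)
  then have "path.indep_var normal_array array1 normal_array array2"
    unfolding path.indep_var_distribution_eq using measurable_array distr_array by simp
  moreover have "(\<lambda>\<omega>. \<lambda>t\<in>{0..}. normal_array.W t \<omega>) \<in> measurable normal_array (PiM {0..} (\<lambda>_. borel))"
    by (intro measurable_restrict normal_array.W_measurable)
  ultimately have "path.indep_var (PiM {0..} (\<lambda>_. borel)) ((\<lambda>\<omega>. \<lambda>t\<in>{0..}. normal_array.W t \<omega>) \<circ> array1)
      (PiM {0..} (\<lambda>_. borel)) ((\<lambda>\<omega>. \<lambda>t\<in>{0..}. normal_array.W t \<omega>) \<circ> array2)"
    by (rule path.indep_var_compose) measurable
  then show ?thesis by (simp add: indep_processes_def wiener1_def wiener2_def comp_def)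
qed

text \<open>The signs attached to a Wiener process depend on its own array only, so events about the
  two sign sequences are events about separate arrays.\<close>

lemma \<xi>_transport: "bm1.\<xi> k \<omega> = bm.\<xi> k (array1 \<omega>)" "bm2.\<xi> k \<omega> = bm.\<xi> k (array2 \<omega>)"
  by (simp_all add: bm1.\<xi>_def bm2.\<xi>_def bm.\<xi>_def bm1.signs_def bm2.signs_def bm.signs_def
      bm1.increment_def bm2.increment_def bm.increment_def wiener1_def wiener2_def)

definition uniform :: "nat \<Rightarrow> joint_path \<Rightarrow> real" where "uniform i \<omega> = Phi (array3 \<omega> (i, 0))"

text \<open>The thresholds concern the third array and the signs the first two, so the probability
  splits into one uniform and two sign factors.\<close>

lemma driver:
  assumes p: "\<And>j. 0 < p j \<and> p j \<le> 1 / 2"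
  shows "walk_driver path_measure p uniform bm1.\<xi> bm2.\<xi>"
proof unfold_locales
  show "uniform n \<in> borel_measurable path_measure" for n
    unfolding uniform_def[abs_def]
    using measurable_compose[OF measurable_compose[OF measurable_array3 measurable_normal_array] borel_measurable_Phi] .
  fix n h v :: nat and c :: "nat \<Rightarrow> real" and b :: "nat \<Rightarrow> bool" and s t :: "nat \<Rightarrow> int"
  assume c: "\<And>i. 0 \<le> c i \<and> c i \<le> 1" and s: "\<And>k. k < h \<Longrightarrow> s k = 1 \<or> s k = - 1" and t: "\<And>k. k < v \<Longrightarrow> t k = 1 \<or> t k = - 1"
  let ?A = "{w\<in>space normal_array. \<forall>k<h. bm.\<xi> k w = s k}" and ?B = "{w\<in>space normal_array. \<forall>k<v. bm.\<xi> k w = t k}"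
    and ?C = "{w. \<forall>i<n. (Phi (w (i, 0::nat)) < c i) = b i}"
  have m: "?A \<in> sets normal_array" "?B \<in> sets normal_array" by measurable
  have "{w\<in>space normal_array. \<forall>i<n. (Phi (w (i, 0::nat)) < c i) = b i} \<in> sets normal_array" by measurable
  then have mC: "?C \<in> sets normal_array" by simp
  have "{\<omega>\<in>space path_measure. (\<forall>i<n. (uniform i \<omega> < c i) = b i) \<and> (\<forall>k<h. bm1.\<xi> k \<omega> = s k) \<and> (\<forall>k<v. bm2.\<xi> k \<omega> = t k)}
    = {\<omega>. array1 \<omega> \<in> ?A \<and> array2 \<omega> \<in> ?B \<and> array3 \<omega> \<in> ?C}"
    by (auto simp: uniform_def \<xi>_transport)
  then have "path.prob {\<omega>\<in>space path_measure. (\<forall>i<n. (uniform i \<omega> < c i) = b i) \<and> (\<forall>k<h. bm1.\<xi> k \<omega> = s k) \<and> (\<forall>k<v. bm2.\<xi> k \<omega> = t k)}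
    = measure normal_array ?A * (measure normal_array ?B * measure normal_array ?C)"
    using emeasure_path_measure[OF m mC] unfolding measure_def by (simp add: enn2real_mult)
  then show "path.prob {\<omega>\<in>space path_measure. (\<forall>i<n. (uniform i \<omega> < c i) = b i) \<and> (\<forall>k<h. bm1.\<xi> k \<omega> = s k) \<and> (\<forall>k<v. bm2.\<xi> k \<omega> = t k)}
    = (\<Prod>i<n. if b i then c i else 1 - c i) * (1 / 2) ^ h * (1 / 2) ^ v"
    using bm.prob_\<xi>[where s=s and m=h, OF s] bm.prob_\<xi>[where s=t and m=v, OF t] prob_uniform_array[where c=c and b=b and n=n, OF c] by simp
qed (use p bm1.\<xi>_measurable bm2.\<xi>_measurable bm1.\<xi>_values bm2.\<xi>_values in auto)

theorem theorem1:
  fixes p :: "int \<Rightarrow> real" and \<gamma> :: real and nrm :: "real \<times> real \<Rightarrow> real"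
  assumes p_range: "\<And>j. 0 < p j \<and> p j \<le> 1 / 2"
    and p_min: "\<exists>j. p j < 1 / 2"
    and gamma: "1 < \<gamma>"
    and right: "(\<lambda>k::nat. (\<Sum>j=1..k. inverse (p (int j))) / real k) \<longlonglongrightarrow> 2 * \<gamma>"
    and left: "(\<lambda>k::nat. (\<Sum>j=1..k. inverse (p (- int j))) / real k) \<longlonglongrightarrow> 2 * \<gamma>"
    and nrm: "is_norm nrm"
  shows "\<exists>(M :: joint_path measure) Z W1 W2.
    aniso_walk p M Z \<and>
    wiener_process M W1 \<and> wiener_process M W2 \<and> indep_processes M W1 W2 \<and>
    (\<forall>T>0.
      (\<forall>n\<ge>1. \<forall>\<omega>\<in>space M.
        (SUP t\<in>{0..T}. nrm ((1 / sqrt (real n)) *\<^sub>R real_point (Z (nat \<lfloor>real n * t\<rfloor>) \<omega>)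
                              - scaled_wiener \<gamma> W1 W2 n t \<omega>)) =
        (SUP t\<in>{0..T}. nrm
          ((real_of_int (fst (Z (nat \<lfloor>real n * t\<rfloor>) \<omega>)) - W1 (real n * t * inverse \<gamma>) \<omega>)
              / sqrt (real n),
           (real_of_int (snd (Z (nat \<lfloor>real n * t\<rfloor>) \<omega>)) - W2 (real n * t * (1 - inverse \<gamma>)) \<omega>)
              / sqrt (real n)))) \<and>
      tends_to_0_in_prob M (\<lambda>n \<omega>.
        SUP t\<in>{0..T}. nrm ((1 / sqrt (real n)) *\<^sub>R real_point (Z (nat \<lfloor>real n * t\<rfloor>) \<omega>)
                              - scaled_wiener \<gamma> W1 W2 n t \<omega>)))"
proof -
  interpret D: walk_driver path_measure p uniform bm1.\<xi> bm2.\<xi> using p_range by (rule driver)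
  show ?thesis
  proof (rule exI[of _ path_measure], rule exI[of _ D.Z], rule exI[of _ wiener1], rule exI[of _ wiener2], intro conjI allI impI ballI)
    show "aniso_walk p path_measure D.Z" by (rule D.aniso_walk_Z)
    show "wiener_process path_measure wiener1" "wiener_process path_measure wiener2" "indep_processes path_measure wiener1 wiener2"
      by (rule wiener_process1 wiener_process2 indep_processes_wiener)+
  next
    fix T :: real assume T: "0 < T"
    show "(SUP t\<in>{0..T}. nrm ((1 / sqrt (real n)) *\<^sub>R real_point (D.Z (nat \<lfloor>real n * t\<rfloor>) \<omega>) - scaled_wiener \<gamma> wiener1 wiener2 n t \<omega>)) =
        (SUP t\<in>{0..T}. nrm
          ((real_of_int (fst (D.Z (nat \<lfloor>real n * t\<rfloor>) \<omega>)) - wiener1 (real n * t * inverse \<gamma>) \<omega>) / sqrt (real n),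
           (real_of_int (snd (D.Z (nat \<lfloor>real n * t\<rfloor>) \<omega>)) - wiener2 (real n * t * (1 - inverse \<gamma>)) \<omega>) / sqrt (real n)))" for n \<omega>
      by (simp add: real_point_def scaled_wiener_def diff_divide_distrib)
    show "tends_to_0_in_prob path_measure (\<lambda>n \<omega>.
        SUP t\<in>{0..T}. nrm ((1 / sqrt (real n)) *\<^sub>R real_point (D.Z (nat \<lfloor>real n * t\<rfloor>) \<omega>) - scaled_wiener \<gamma> wiener1 wiener2 n t \<omega>))"
      by (rule sup_tends_to_0[OF wiener_process1 wiener_process2 D.Z_measurable nrm gamma T])
        (rule coupled_walk[OF wiener_process1 wiener_process2 D.walk_driver_axioms gamma right left _ T])
  qed
qed

end
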